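(* Let $n\ge 14$. Then the Hamiltonian cycle $(1,3,5,7,9,11,13,8,10,12,14,15,16,\dots,n,2,4,6)$ in $\widetilde{K}_n$ is ambient isotopic to a connected sum $T\# T$, where $T$ is the trefoil knot type of the cycle $(1,3,5,7,2,4,6)$ in $\widetilde{K}_7$.
   Context: Canonical book representation $\widetilde{K}_n$: label the vertices of the complete graph $K_n$ by $1,\dots,n$ and place them in this cyclic order on a round circle $C$ in a plane $P\subset\mathbb{R}^3$. The "sheets" $S_1,\dots,S_k$ are topological disks in $\mathbb{R}^3$ with common boundary $C$ and pairwise disjoint interiors, stacked so that, in the projection to $P$, $S_a$ lies above $S_b$ whenever $a<b$. Each edge $\{i,j\}$ is embedded as a chord with endpoints $i,j$ inside exactly one sheet, chords in a common sheet being disjoint except at shared endpoints; the resulting spatial graph is determined up to ambient isotopy by the assignment of edges to sheets. If $n=2m$ there are $m$ sheets, and for $1\le i\le m$ sheet $S_i$ contains the edges $\{i,i+j\}$ for $1\le j\le m$ and $\{i+m,(i+m+j)\bmod 2m\}$ for $1\le j\le m-1$. If $n=2m+1$ there are $m+1$ sheets; for $1\le i\le m$ sheet $S_i$ contains the edges $\{i,i+j\}$ and $\{i+m+1,(i+m+j+1)\bmod(2m+1)\}$ for $1\le j\le m$, and $S_{m+1}$ contains the edges $\{m+1,m+1+j\}$ for $1\le j\le m$. Residues mod $n$ are taken in $\{1,\dots,n\}$. A cycle $(\alpha_1,\dots,\alpha_r)$ of distinct vertices denotes the closed curve formed by the embedded edges $\{\alpha_1,\alpha_2\},\dots,\{\alpha_{r-1},\alpha_r\},\{\alpha_r,\alpha_1\}$,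 regarded as a knot in $\mathbb{R}^3$; it is Hamiltonian if it uses all vertices of the graph. The cycle $(1,3,5,7,2,4,6)$ in $\widetilde{K}_7$ is a (right-handed) trefoil. *)

theory Defs
  imports "HOL-Analysis.Analysis"
begin

type_synonym R3 = "real \<times> real \<times> real"

definition rmod :: "nat \<Rightarrow> nat \<Rightarrow> nat" where
  "rmod n x = ((x + n - 1) mod n) + 1"

definition nsheets :: "nat \<Rightarrow> nat" where
  "nsheets n = (if even n then n div 2 else n div 2 + 1)"

definition in_sheet :: "nat \<Rightarrow> nat \<Rightarrow> nat \<Rightarrow> nat \<Rightarrow> bool" where
  "in_sheet n s a b =
    (let m = n div 2 in
     if even n then
       1 \<le> s \<and> s \<le> m \<and>
       ((\<exists>j\<in>{1..m}. {a, b} = {s, s + j}) \<or>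
        (\<exists>j\<in>{1..m - 1}. {a, b} = {s + m, rmod n (s + m + j)}))
     else
       (1 \<le> s \<and> s \<le> m \<and>
         ((\<exists>j\<in>{1..m}. {a, b} = {s, s + j}) \<or>
          (\<exists>j\<in>{1..m}. {a, b} = {s + m + 1, rmod n (s + m + j + 1)}))) \<or>
       (s = m + 1 \<and> (\<exists>j\<in>{1..m}. {a, b} = {m + 1, m + 1 + j})))"

definition sheet_of :: "nat \<Rightarrow> nat \<Rightarrow> nat \<Rightarrow> nat" where
  "sheet_of n a b = (SOME s. in_sheet n s a b)"

definition vert2 :: "nat \<Rightarrow> nat \<Rightarrow> real \<times> real" where
  "vert2 n i = (cos (2 * pi * real i / real n), sin (2 * pi * real i / real n))"

text \<open>Height of sheet s: sheet S_s is the disk {(x,y,h_s (1 - x^2 - y^2)) | x^2+y^2 <= 1};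
  these disks have common boundary C, pairwise disjoint interiors, and S_a lies above S_b
  for a < b.\<close>
definition sheet_height :: "nat \<Rightarrow> nat \<Rightarrow> real" where
  "sheet_height n s = real (nsheets n + 1 - s)"

definition lift :: "real \<Rightarrow> real \<times> real \<Rightarrow> R3" where
  "lift h p = (fst p, snd p, h * (1 - (fst p)\<^sup>2 - (snd p)\<^sup>2))"

definition edge_arc :: "nat \<Rightarrow> nat \<Rightarrow> nat \<Rightarrow> R3 set" where
  "edge_arc n a b =
     lift (sheet_height n (sheet_of n a b)) ` closed_segment (vert2 n a) (vert2 n b)"

definition cycle_knot :: "nat \<Rightarrow> nat list \<Rightarrow> R3 set" where
  "cycle_knot n cs =
     (\<Union>k<length cs. edge_arc n (cs ! k) (cs ! ((k + 1) mod length cs)))"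

definition ambient_isotopic :: "R3 set \<Rightarrow> R3 set \<Rightarrow> bool" where
  "ambient_isotopic K1 K2 =
     (\<exists>H :: real \<Rightarrow> R3 \<Rightarrow> R3.
        continuous_on ({0..1} \<times> UNIV) (\<lambda>(t, x). H t x) \<and>
        (\<forall>t\<in>{0..1}. \<exists>g. homeomorphism UNIV UNIV (H t) g) \<and>
        H 0 = id \<and> H 1 ` K1 = K2)"

text \<open>K is ambient isotopic to a connected sum of (the knot types of) K1 and K2:
  some knot K' isotopic to K meets the plane {x = 0} in exactly two points p, q, and the
  two pieces of K' on either side, closed up by the segment [p,q] in the plane, are
  isotopic to K1 and K2 respectively (decomposing-sphere description of connected sum).\<close>
definition isotopic_to_connected_sum :: "R3 set \<Rightarrow> R3 set \<Rightarrow> R3 set \<Rightarrow> bool" where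
  "isotopic_to_connected_sum K K1 K2 =
     (\<exists>K' p q. ambient_isotopic K K' \<and> p \<noteq> q \<and>
        K' \<inter> {x. fst x = 0} = {p, q} \<and>
        ambient_isotopic ((K' \<inter> {x. fst x \<le> 0}) \<union> closed_segment p q) K1 \<and>
        ambient_isotopic ((K' \<inter> {x. fst x \<ge> 0}) \<union> closed_segment p q) K2)"

end

(*
  Only the relative heights of crossing chords matter, so the edge {7,9} and the path 14,...,n,2 may
  be pressed flat into the plane of the circle C; the path then shrinks to the chord {14,2}, because
  apart from {7,9} the rest of the knot meets that plane only in vertices.  The vertical plane separating the vertices 8,...,14 from the others now meets
  the knot in two points, and closing either half along the cut gives a star heptagon {7/2} whose
  seven crossings read, in order, as a closed 2-braid with five crossings of one sign and two of the
  other.  Lifting an edge that lies below both edges it crosses to above both of them (it passes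
  around the vertex they share) exchanges two neighbouring opposite signs, so all such stars are
  isotopic, and the 7-cycle of K_7 is one of them.

  Isotopies come from one principle: a family of maps c_t with
  |(c_u - c_t) x - (c_u - c_t) y| <= M |u - t| |c_t x - c_t y| moves its image by an ambient isotopy,
  since a displacement with small Lipschitz constant extends to R^3 (McShane) and x + t F(x) is a
  homeomorphism when F is a contraction.
*)

theory Submission
  imports Defs
begin

section \<open>Ambient isotopies\<close>

text \<open>The delicate places are those where arcs meet. At a common vertex both the displacement
  and the distance tend to 0, so the quotient controlled by the Lipschitz principle stays bounded
  only if the arcs leave the vertex at different angles in projection. This is why pairs of arcs are
  sorted into equal, consecutive and disjoint ones, and why triangle moves carry an angle condition
  at their corners. The second obstacle is the dependence on \<open>n\<close>. With
  \<open>M = (n + 1) div 2\<close>, a short edge whose smaller end is \<open>a\<close> lies in sheet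
  \<open>a\<close> for \<open>a <= M\<close>, but in sheet \<open>a - M\<close> afterwards. As
  \<open>n >= 14\<close> gives \<open>M >= 7\<close>, the restart never touches the left half or the
  edge {7,9}; it does reach the right half when \<open>M <= 11\<close>. So the two exceptional
  crossings of the right star sit in six different positions. An exceptional crossing is moved by
  bending the edge {7,2} to a path outside the unit disk. There no other edge lies above or below
  it, so its height can be changed freely before it is bent back on the other side of its two
  neighbours.\<close>

lemma ambient_isotopicI:
  fixes H G :: "real \<Rightarrow> R3 \<Rightarrow> R3"
  assumes cont: "continuous_on ({0..1} \<times> UNIV) (\<lambda>(t, x). H t x)"
    and inv: "\<And>t. t \<in> {0..1} \<Longrightarrow> continuous_on UNIV (G t)"
             "\<And>t x. t \<in> {0..1} \<Longrightarrow> G t (H t x) = x"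
             "\<And>t x. t \<in> {0..1} \<Longrightarrow> H t (G t x) = x"
    and ends: "\<And>x. H 0 x = x" "H 1 ` K1 = K2"
  shows "ambient_isotopic K1 K2"
  unfolding ambient_isotopic_def
proof (intro exI[of _ H] conjI ballI)
  show "continuous_on ({0..1} \<times> UNIV) (\<lambda>(t, x). H t x)" by (rule cont)
  show "H 0 = id" using ends(1) by auto
  show "H 1 ` K1 = K2" by (rule ends)
  fix t :: real assume t: "t \<in> {0..1}"
  have "continuous_on UNIV ((\<lambda>(t, x). H t x) \<circ> (\<lambda>x. (t, x)))"
    by (intro continuous_on_compose continuous_intros continuous_on_subset[OF cont]) (use t in auto)
  then have "continuous_on UNIV (H t)" by (simp add: o_def)
  then show "\<exists>g. homeomorphism UNIV UNIV (H t) g"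
    using inv[OF t] by (intro exI[of _ "G t"] homeomorphismI) auto
qed

lemma ambient_isotopic_refl: "ambient_isotopic K K"
  by (rule ambient_isotopicI[where H = "\<lambda>t x. x" and G = "\<lambda>t x. x"])
     (auto simp: case_prod_unfold intro!: continuous_intros)

text \<open>Time runs backwards from \<open>H 1\<close>, and precomposing with the inverse of that
  one map restores the identity at time 0. Joint continuity then follows from that of
  \<open>H\<close>.\<close>

lemma ambient_isotopic_sym:
  assumes "ambient_isotopic K1 K2"
  shows "ambient_isotopic K2 K1"
proof -
  obtain H :: "real \<Rightarrow> R3 \<Rightarrow> R3" where
    cont: "continuous_on ({0..1} \<times> UNIV) (\<lambda>(t, x). H t x)"
    and hom: "\<And>t. t\<in>{0..1} \<Longrightarrow> \<exists>g. homeomorphism UNIV UNIV (H t) g"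
    and H0: "H 0 = id" and H1: "H 1 ` K1 = K2"
    using assms unfolding ambient_isotopic_def by (elim exE conjE) (rule that, assumption, erule bspec, assumption+)
  obtain g where g: "homeomorphism UNIV UNIV (H 1) g" using hom[of 1] by auto
  have gc: "continuous_on A g" for A
    using g by (auto simp: homeomorphism_def intro: continuous_on_subset)
  show ?thesis
    unfolding ambient_isotopic_def
  proof (intro exI[of _ "\<lambda>t. H (1 - t) \<circ> g"] conjI ballI)
    have "continuous_on ({0..1} \<times> UNIV) ((\<lambda>(t, x). H t x) \<circ> (\<lambda>(t, x). (1 - t, g x)))"
    proof (rule continuous_on_compose[OF _ continuous_on_subset[OF cont]])
      show "continuous_on ({0..1} \<times> UNIV) (\<lambda>(t, x). (1 - t :: real, g x))"
        unfolding case_prod_unfold by (intro continuous_intros continuous_on_compose2[OF gc[of UNIV]]) auto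
    qed auto
    then show "continuous_on ({0..1} \<times> UNIV) (\<lambda>(t, x). (H (1 - t) \<circ> g) x)"
      by (simp add: o_def case_prod_unfold)
    show "H (1 - 0) \<circ> g = id" using homeomorphism_apply2[OF g] by (simp add: fun_eq_iff)
    have "g ` K2 = K1" using homeomorphism_apply1[OF g] by (simp add: H1[symmetric] image_image)
    then show "(H (1 - 1) \<circ> g) ` K2 = K1" using H0 by (simp add: image_comp[symmetric])
    fix t :: real assume "t \<in> {0..1}"
    then obtain g' where "homeomorphism UNIV UNIV (H (1 - t)) g'" using hom[of "1 - t"] by auto
    then show "\<exists>k. homeomorphism UNIV UNIV (H (1 - t) \<circ> g) k"
      using homeomorphism_compose g homeomorphism_symD by blast
  qed
qed

lemma ambient_isotopic_trans [trans]:
  assumes "ambient_isotopic K1 K2" "ambient_isotopic K2 K3"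
  shows "ambient_isotopic K1 K3"
proof -
  obtain H :: "real \<Rightarrow> R3 \<Rightarrow> R3" where
    Hc: "continuous_on ({0..1} \<times> UNIV) (\<lambda>(t, x). H t x)"
    and Hh: "\<And>t. t\<in>{0..1} \<Longrightarrow> \<exists>g. homeomorphism UNIV UNIV (H t) g"
    and H0: "H 0 = id" and H1: "H 1 ` K1 = K2"
    using assms(1) unfolding ambient_isotopic_def by (elim exE conjE) (rule that, assumption, erule bspec, assumption+)
  obtain G :: "real \<Rightarrow> R3 \<Rightarrow> R3" where
    Gc: "continuous_on ({0..1} \<times> UNIV) (\<lambda>(t, x). G t x)"
    and Gh: "\<And>t. t\<in>{0..1} \<Longrightarrow> \<exists>g. homeomorphism UNIV UNIV (G t) g"
    and G0: "G 0 = id" and G1: "G 1 ` K2 = K3"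
    using assms(2) unfolding ambient_isotopic_def by (elim exE conjE) (rule that, assumption, erule bspec, assumption+)
  obtain g where g: "homeomorphism UNIV UNIV (H 1) g" using Hh[of 1] by auto
  have H1c: "continuous_on A (H 1)" for A
    using g by (auto simp: homeomorphism_def intro: continuous_on_subset)
  define J where "J = (\<lambda>t. if t \<le> 1/2 then H (2 * t) else G (2 * t - 1) \<circ> H 1)"
  show ?thesis
    unfolding ambient_isotopic_def
  proof (intro exI[of _ J] conjI ballI)
    have 1: "continuous_on {z \<in> {0..1} \<times> UNIV. fst z \<le> 1/2} ((\<lambda>(t, x). H t x) \<circ> (\<lambda>(t, x). (2 * t, x)))"
    proof (rule continuous_on_compose[OF _ continuous_on_subset[OF Hc]])
      show "continuous_on {z \<in> {0..1} \<times> UNIV. fst z \<le> 1/2} (\<lambda>(t, x). (2 * t :: real, x :: R3))"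
        unfolding case_prod_unfold by (intro continuous_intros)
    qed auto
    have 2: "continuous_on {z \<in> {0..1} \<times> UNIV. 1/2 \<le> fst z} ((\<lambda>(t, x). G t x) \<circ> (\<lambda>(t, x). (2 * t - 1, H 1 x)))"
    proof (rule continuous_on_compose[OF _ continuous_on_subset[OF Gc]])
      show "continuous_on {z \<in> {0..1} \<times> UNIV. 1/2 \<le> fst z} (\<lambda>(t, x). (2 * t - 1 :: real, H 1 x))"
        unfolding case_prod_unfold by (intro continuous_intros continuous_on_compose2[OF H1c[of UNIV]]) auto
    qed auto
    have "continuous_on ({0..1} \<times> UNIV) (\<lambda>z. if fst z \<le> 1/2 then H (2 * fst z) (snd z) else G (2 * fst z - 1) (H 1 (snd z)))"
    proof (rule continuous_on_cases_le)
      show "H (2 * fst z) (snd z) = G (2 * fst z - 1) (H 1 (snd z))" if "fst z = 1 / 2" for z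
      proof -
        have "2 * fst z = 1" "2 * fst z - 1 = 0" using that by simp_all
        then show ?thesis by (metis G0 id_apply)
      qed
    qed (use 1 2 in \<open>auto simp: o_def case_prod_unfold intro!: continuous_intros\<close>)
    moreover have "(\<lambda>(t, x). J t x) = (\<lambda>z. if fst z \<le> 1/2 then H (2 * fst z) (snd z) else G (2 * fst z - 1) (H 1 (snd z)))"
      by (auto simp: J_def case_prod_unfold fun_eq_iff)
    ultimately show "continuous_on ({0..1} \<times> UNIV) (\<lambda>(t, x). J t x)" by simp
    show "J 0 = id" by (simp add: J_def H0)
    show "J 1 ` K1 = K3" using G1 by (simp add: J_def H1[symmetric] image_image)
    fix t :: real assume t: "t \<in> {0..1}"
    show "\<exists>k. homeomorphism UNIV UNIV (J t) k"
    proof (cases "t \<le> 1/2")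
      case True then show ?thesis using Hh[of "2 * t"] t by (auto simp: J_def)
    next
      case False
      then obtain k where "homeomorphism UNIV UNIV (G (2 * t - 1)) k" using Gh[of "2 * t - 1"] t by auto
      then show ?thesis using False homeomorphism_compose[OF g] by (auto simp: J_def)
    qed
  qed
qed

section \<open>Vertical shears, translations and rotations of space\<close>

lemma ambient_isotopic_shear:
  fixes g :: "real \<times> real \<Rightarrow> real"
  assumes g: "continuous_on UNIV g"
  shows "ambient_isotopic K ((\<lambda>(x, y, z). (x, y, z + g (x, y))) ` K)"
proof (rule ambient_isotopicI[where H = "\<lambda>t (x, y, z). (x, y, z + t * g (x, y))"
        and G = "\<lambda>t (x, y, z). (x, y, z - t * g (x, y))"])
  have *: "continuous_on A g" for A using g continuous_on_subset by blast
  show "continuous_on ({0..1} \<times> UNIV) (\<lambda>(t, x). case x of (x, y, z) \<Rightarrow> (x, y, z + t * g (x, y)))"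
    by (auto simp: case_prod_unfold intro!: continuous_intros continuous_on_compose2[OF *])
  show "continuous_on UNIV (\<lambda>(x, y, z). (x, y, z - t * g (x, y)))" for t
    by (auto simp: case_prod_unfold intro!: continuous_intros continuous_on_compose2[OF *])
qed auto

lemma ambient_isotopic_shift:
  "ambient_isotopic K ((\<lambda>(x, y, z). (x + d, y, z)) ` K)"
proof (rule ambient_isotopicI[where H = "\<lambda>t (x, y, z). (x + t * d, y, z)"
        and G = "\<lambda>t (x, y, z). (x - t * d, y, z)"])
qed (auto simp: case_prod_unfold intro!: continuous_intros)

definition rot :: "real \<Rightarrow> real \<times> real \<Rightarrow> real \<times> real" where
  "rot \<alpha> p = (cos \<alpha> * fst p - sin \<alpha> * snd p, sin \<alpha> * fst p + cos \<alpha> * snd p)"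

lemma rot_minus [simp]: "rot (- \<alpha>) (rot \<alpha> p) = p" "rot \<alpha> (rot (- \<alpha>) p) = p"
proof -
  have 1: "sin \<alpha> * (sin \<alpha> * x) + cos \<alpha> * (cos \<alpha> * x) = x" for x
    by (metis (no_types, lifting) distrib_right mult.assoc mult_1 power2_eq_square sin_cos_squared_add)
  show "rot (- \<alpha>) (rot \<alpha> p) = p" "rot \<alpha> (rot (- \<alpha>) p) = p"
    using 1 by (auto simp: rot_def prod_eq_iff algebra_simps)
qed

lemma ambient_isotopic_rot:
  "ambient_isotopic K ((\<lambda>(x, y, z). (fst (rot \<alpha> (x, y)), snd (rot \<alpha> (x, y)), z)) ` K)"
proof (rule ambient_isotopicI[where H = "\<lambda>t (x, y, z). (fst (rot (t * \<alpha>) (x, y)), snd (rot (t * \<alpha>) (x, y)), z)"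
        and G = "\<lambda>t (x, y, z). (fst (rot (- (t * \<alpha>)) (x, y)), snd (rot (- (t * \<alpha>)) (x, y)), z)"])
  show "continuous_on ({0..1} \<times> UNIV)
     (\<lambda>(t, x :: R3). case x of (x, y, z) \<Rightarrow> (fst (rot (t * \<alpha>) (x, y)), snd (rot (t * \<alpha>) (x, y)), z))"
    unfolding case_prod_unfold rot_def fst_conv snd_conv by (intro continuous_intros)
  show "continuous_on UNIV (\<lambda>(x, y, z :: real). (fst (rot (- (t * \<alpha>)) (x, y)), snd (rot (- (t * \<alpha>)) (x, y)), z))" for t
    unfolding case_prod_unfold rot_def fst_conv snd_conv by (intro continuous_intros)
qed (auto simp: case_prod_unfold, auto simp: rot_def case_prod_unfold)

section \<open>From Lipschitz displacements to ambient isotopies\<close>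

text \<open>The extension is the infimum of the cones of slope \<open>L\<close> standing on the
  given values. Points are indexed by \<open>S\<close> through \<open>a\<close>, which may repeat
  points; \<open>lip\<close> forces equal values there.\<close>

lemma mcshane_extension:
  fixes a :: "'s \<Rightarrow> 'm::metric_space" and \<phi> :: "'s \<Rightarrow> real"
  assumes ne: "S \<noteq> {}" and L: "L \<ge> 0"
    and lip: "\<And>s s'. s \<in> S \<Longrightarrow> s' \<in> S \<Longrightarrow> \<bar>\<phi> s - \<phi> s'\<bar> \<le> L * dist (a s) (a s')"
  obtains \<Phi> where "\<And>x y. \<bar>\<Phi> x - \<Phi> y\<bar> \<le> L * dist x y" "\<And>s. s \<in> S \<Longrightarrow> \<Phi> (a s) = \<phi> s"
proof -
  define \<Phi> where "\<Phi> x = (INF s\<in>S. \<phi> s + L * dist x (a s))" for x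
  obtain s0 where s0: "s0 \<in> S" using ne by auto
  \<comment> \<open>The cone at \<open>s0\<close> bounds all the others from below, so every infimum
    is finite.\<close>
  have lb: "\<phi> s0 - L * dist x (a s0) \<le> \<phi> s + L * dist x (a s)" if "s \<in> S" for s x
  proof -
    have "L * dist (a s0) (a s) \<le> L * (dist x (a s0) + dist x (a s))"
      using L by (intro mult_left_mono) (metis dist_commute dist_triangle add.commute)
    then show ?thesis using lip[OF s0 that] by (simp add: algebra_simps abs_le_iff)
  qed
  have bdd: "bdd_below ((\<lambda>s. \<phi> s + L * dist x (a s)) ` S)" for x
    using lb by (intro bdd_belowI2) auto
  have le: "\<Phi> x \<le> \<Phi> y + L * dist x y" for x y
  proof -
    have "\<Phi> x - L * dist x y \<le> \<phi> s + L * dist y (a s)" if "s \<in> S" for s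
    proof -
      have "\<Phi> x \<le> \<phi> s + L * dist x (a s)" unfolding \<Phi>_def by (rule cINF_lower[OF bdd that])
      moreover have "L * dist x (a s) \<le> L * (dist x y + dist y (a s))"
        using L by (intro mult_left_mono dist_triangle)
      ultimately show ?thesis by (simp add: algebra_simps)
    qed
    then have "\<Phi> x - L * dist x y \<le> \<Phi> y" unfolding \<Phi>_def[of y] by (intro cINF_greatest ne)
    then show ?thesis by simp
  qed
  show thesis
  proof
    show "\<bar>\<Phi> x - \<Phi> y\<bar> \<le> L * dist x y" for x y
      using le[of x y] le[of y x] by (simp add: abs_le_iff dist_commute)
    fix s assume s: "s \<in> S"
    show "\<Phi> (a s) = \<phi> s"
    proof (rule antisym)
      show "\<Phi> (a s) \<le> \<phi> s" unfolding \<Phi>_def using cINF_lower[OF bdd s, of "a s"] by simp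
      show "\<phi> s \<le> \<Phi> (a s)" unfolding \<Phi>_def
      proof (rule cINF_greatest[OF ne])
        fix s' assume "s' \<in> S"
        then show "\<phi> s \<le> \<phi> s' + L * dist (a s) (a s')" using lip[OF s, of s'] by (simp add: abs_le_iff)
      qed
    qed
  qed
qed

text \<open>The equation \<open>x + t F x = y\<close> says that \<open>x\<close> is the fixed point
  of the contraction \<open>y - t F x\<close>, so Banach gives the inverse at each time. The
  constant 1/2 makes that inverse 2-Lipschitz.\<close>

lemma ambient_isotopic_perturbation:
  fixes F :: "R3 \<Rightarrow> R3"
  assumes F: "\<And>x y. norm (F x - F y) \<le> 1/2 * norm (x - y)"
  shows "ambient_isotopic K ((\<lambda>x. x + F x) ` K)"
proof -
  have tF: "norm (t *\<^sub>R F x - t *\<^sub>R F y) \<le> 1/2 * norm (x - y)" if "t \<in> {0..1}" for t x y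
  proof -
    have "norm (t *\<^sub>R F x - t *\<^sub>R F y) = t * norm (F x - F y)"
      using that by (simp add: scaleR_diff_right[symmetric])
    also have "\<dots> \<le> 1 * norm (F x - F y)" using that by (intro mult_right_mono) auto
    also have "\<dots> \<le> 1/2 * norm (x - y)" using F by simp
    finally show ?thesis .
  qed
  define G where "G t y = (THE x. y - t *\<^sub>R F x = x)" for t y
  have ex1: "\<exists>!x. y - t *\<^sub>R F x = x" if "t \<in> {0..1}" for t y
  proof -
    have "\<exists>!x\<in>UNIV. y - t *\<^sub>R F x = x"
      by (rule Banach_fix[where c = "1/2"])
         (use tF[OF that] in \<open>auto simp: dist_norm norm_minus_commute complete_UNIV\<close>)
    then show ?thesis by simp
  qed
  have G1: "y - t *\<^sub>R F (G t y) = G t y" if "t \<in> {0..1}" for t y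
    unfolding G_def by (rule theI'[OF ex1[OF that]])
  have G2: "G t (x + t *\<^sub>R F x) = x" if "t \<in> {0..1}" for t x
    unfolding G_def by (rule the1_equality[OF ex1[OF that]]) simp
  have G3: "G t y + t *\<^sub>R F (G t y) = y" if "t \<in> {0..1}" for t y
    using G1[OF that, of y] by (metis diff_add_cancel)
  have Gl: "dist (G t x) (G t y) \<le> 2 * dist x y" if "t \<in> {0..1}" for t x y
  proof -
    have "G t x - G t y = (x - y) - (t *\<^sub>R F (G t x) - t *\<^sub>R F (G t y))"
      using G1[OF that, of x] G1[OF that, of y] by (simp add: algebra_simps)
    then have "norm (G t x - G t y) \<le> norm (x - y) + norm (t *\<^sub>R F (G t x) - t *\<^sub>R F (G t y))"
      using norm_triangle_ineq4 by metis
    then show ?thesis using tF[OF that, of "G t x" "G t y"] by (simp add: dist_norm)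
  qed
  have Fc: "continuous_on A F" for A
  proof (rule continuous_on_subset)
    show "continuous_on UNIV F"
      by (rule lipschitz_on_continuous_on[where L = "1/2"]) (use F in \<open>auto simp: lipschitz_on_def dist_norm\<close>)
  qed simp
  show ?thesis
  proof (rule ambient_isotopicI[where H = "\<lambda>t x. x + t *\<^sub>R F x" and G = G])
    show "continuous_on ({0..1} \<times> UNIV) (\<lambda>(t, x). x + t *\<^sub>R F x)"
      by (auto simp: case_prod_unfold intro!: continuous_intros continuous_on_compose2[OF Fc])
    show "continuous_on UNIV (G t)" if "t \<in> {0..1}" for t
      by (rule lipschitz_on_continuous_on[where L = 2]) (use Gl[OF that] in \<open>auto simp: lipschitz_on_def\<close>)
  qed (use G2 G3 in auto)
qed

text \<open>The three coordinates of the displacement are extended separately. Each may use the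
  slope 1/6, because the three add up to the 1/2 that \<open>ambient_isotopic_perturbation\<close>
  allows.\<close>

lemma ambient_isotopic_displacement:
  fixes a b :: "'s \<Rightarrow> R3"
  assumes lip: "\<And>s s'. s \<in> S \<Longrightarrow> s' \<in> S \<Longrightarrow>
     norm ((b s - a s) - (b s' - a s')) \<le> 1/6 * norm (a s - a s')"
  shows "ambient_isotopic (a ` S) (b ` S)"
proof (cases "S = {}")
  case True then show ?thesis by (simp add: ambient_isotopic_refl)
next
  case False
  have ext: "\<exists>\<Phi>. (\<forall>x y. \<bar>\<Phi> x - \<Phi> y\<bar> \<le> 1/6 * norm (x - y)) \<and> (\<forall>s\<in>S. \<Phi> (a s) = \<pi> (b s - a s))"
    if \<pi>: "\<And>x y. \<bar>\<pi> x - \<pi> y\<bar> \<le> norm (x - y)" for \<pi> :: "R3 \<Rightarrow> real"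
  proof -
    obtain \<Phi> where "\<And>x y. \<bar>\<Phi> x - \<Phi> y\<bar> \<le> 1/6 * dist x y" "\<And>s. s \<in> S \<Longrightarrow> \<Phi> (a s) = \<pi> (b s - a s)"
    proof (rule mcshane_extension[OF False, of "1/6" "\<lambda>s. \<pi> (b s - a s)" a])
      show "\<bar>\<pi> (b s - a s) - \<pi> (b s' - a s')\<bar> \<le> 1/6 * dist (a s) (a s')" if "s \<in> S" "s' \<in> S" for s s'
        using \<pi>[of "b s - a s" "b s' - a s'"] lip[OF that] by (simp add: dist_norm)
    qed auto
    then show ?thesis unfolding dist_norm by blast
  qed
  have le1: "\<bar>fst x - fst y\<bar> \<le> norm (x - y)" for x y :: R3
    using norm_fst_le[of "x - y" ] by (metis fst_diff norm_fst_le prod.collapse real_norm_def)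
  have le2: "norm (snd x - snd y) \<le> norm (x - y)" for x y :: R3
    by (metis norm_snd_le prod.collapse snd_diff)
  have le2a: "\<bar>fst (snd x) - fst (snd y)\<bar> \<le> norm (x - y)" for x y :: R3
    by (metis le2 fst_diff norm_fst_le order_trans prod.collapse real_norm_def)
  have le2b: "\<bar>snd (snd x) - snd (snd y)\<bar> \<le> norm (x - y)" for x y :: R3
    by (metis le2 snd_diff norm_snd_le order_trans prod.collapse real_norm_def)
  obtain F1 where F1: "\<And>x y. \<bar>F1 x - F1 y\<bar> \<le> 1/6 * norm (x - y)" "\<And>s. s \<in> S \<Longrightarrow> F1 (a s) = fst (b s - a s)"
    using ext[OF le1] by blast
  obtain F2 where F2: "\<And>x y. \<bar>F2 x - F2 y\<bar> \<le> 1/6 * norm (x - y)" "\<And>s. s \<in> S \<Longrightarrow> F2 (a s) = fst (snd (b s - a s))"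
    using ext[OF le2a] by blast
  obtain F3 where F3: "\<And>x y. \<bar>F3 x - F3 y\<bar> \<le> 1/6 * norm (x - y)" "\<And>s. s \<in> S \<Longrightarrow> F3 (a s) = snd (snd (b s - a s))"
    using ext[OF le2b] by blast
  define F where "F x = (F1 x, F2 x, F3 x)" for x
  have "norm (F x - F y) \<le> 1/2 * norm (x - y)" for x y
  proof -
    have "norm (F x - F y) \<le> \<bar>F1 x - F1 y\<bar> + norm (F2 x - F2 y, F3 x - F3 y)"
      unfolding F_def using norm_Pair_le[of "F1 x - F1 y" "(F2 x - F2 y, F3 x - F3 y)"] by simp
    also have "\<dots> \<le> \<bar>F1 x - F1 y\<bar> + (\<bar>F2 x - F2 y\<bar> + \<bar>F3 x - F3 y\<bar>)"
      using norm_Pair_le[of "F2 x - F2 y" "F3 x - F3 y"] by simp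
    finally show ?thesis using F1(1)[of x y] F2(1)[of x y] F3(1)[of x y] by simp
  qed
  then have "ambient_isotopic (a ` S) ((\<lambda>x. x + F x) ` a ` S)" by (rule ambient_isotopic_perturbation)
  also have "(\<lambda>x. x + F x) ` a ` S = b ` S"
  proof -
    have "a s + F (a s) = b s" if "s \<in> S" for s
      using that F1(2) F2(2) F3(2) by (simp add: F_def prod_eq_iff)
    then show ?thesis by (auto simp: image_image)
  qed
  finally show ?thesis .
qed

text \<open>Time is cut into steps so short that each is a displacement of slope at most 1/6. The
  hypothesis measures displacement against the distance at the current time, so it applies afresh at
  the start of every step.\<close>

lemma ambient_isotopic_lipschitz_family:
  fixes c :: "real \<Rightarrow> 's \<Rightarrow> R3"
  assumes lip: "\<And>t t' s s'. t \<in> {0..1} \<Longrightarrow> t' \<in> {0..1} \<Longrightarrow> s \<in> S \<Longrightarrow> s' \<in> S \<Longrightarrow>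
     norm ((c t' s - c t s) - (c t' s' - c t s')) \<le> M * \<bar>t' - t\<bar> * norm (c t s - c t s')"
  shows "ambient_isotopic (c 0 ` S) (c 1 ` S)"
proof -
  \<comment> \<open>\<open>N >= 6 |M|\<close> brings the slope of one step, \<open>|M| / N\<close>,
    down to 1/6; the extra 1 keeps \<open>N\<close> positive.\<close>
  obtain N :: nat where N: "real N > 6 * \<bar>M\<bar> + 1" using reals_Archimedean2 by blast
  then have N0: "N > 0" by (cases N) auto
  have "ambient_isotopic (c 0 ` S) (c (i / N) ` S)" if "i \<le> N" for i
    using that
  proof (induction i)
    case 0 then show ?case by (simp add: ambient_isotopic_refl)
  next
    case (Suc i)
    have r: "i / N \<in> {0..1}" "Suc i / N \<in> {0..1}" using Suc.prems N0 by (auto simp: field_simps)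
    have "Suc i / N - i / N = 1 / N" by (simp add: diff_divide_distrib[symmetric])
    moreover have "\<bar>M\<bar> / N \<le> 1/6" using N N0 by (simp add: field_simps)
    ultimately have m: "\<bar>M\<bar> * \<bar>Suc i / N - i / N\<bar> \<le> 1/6" by simp
    have "ambient_isotopic (c (i / N) ` S) (c (Suc i / N) ` S)"
    proof (rule ambient_isotopic_displacement)
      fix s s' assume s: "s \<in> S" "s' \<in> S"
      let ?d = "norm (c (i / N) s - c (i / N) s')"
      have "M * \<bar>Suc i / N - i / N\<bar> * ?d \<le> 1/6 * ?d"
        using order_trans[OF mult_right_mono[OF abs_ge_self] m] by (intro mult_right_mono) simp_all
      then show "norm (c (Suc i / N) s - c (i / N) s - (c (Suc i / N) s' - c (i / N) s')) \<le> 1/6 * ?d"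
        using lip[OF r s] by linarith
    qed
    then show ?case using Suc ambient_isotopic_trans by (meson Suc_leD)
  qed
  from this[of N] show ?thesis using N0 by simp
qed

section \<open>Moving an edge across a triangle\<close>

text \<open>Besides avoiding the triangle away from \<open>a\<close> and \<open>b\<close>, the set may approach it at these two corners
  only at a positive angle.\<close>

definition clear_of :: "'a::real_normed_vector set \<Rightarrow> 'a \<Rightarrow> 'a \<Rightarrow> 'a \<Rightarrow> bool" where
  "clear_of A a b c \<longleftrightarrow>
     (\<exists>\<kappa>>0. \<forall>x\<in>convex hull {a, b, c}. \<forall>y\<in>A. \<kappa> * min (dist x a) (dist x b) \<le> dist x y)"

lemma clear_of_commute: "clear_of A a b c \<longleftrightarrow> clear_of A b a c"
  unfolding clear_of_def by (simp add: min.commute insert_commute)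

lemma clear_of_Un:
  assumes "clear_of A a b c" "clear_of B a b c"
  shows "clear_of (A \<union> B) a b c"
proof -
  obtain k where k: "k > 0" "\<forall>x\<in>convex hull {a, b, c}. \<forall>y\<in>A. k * min (dist x a) (dist x b) \<le> dist x y"
    using assms(1) unfolding clear_of_def by blast
  obtain l where l: "l > 0" "\<forall>x\<in>convex hull {a, b, c}. \<forall>y\<in>B. l * min (dist x a) (dist x b) \<le> dist x y"
    using assms(2) unfolding clear_of_def by blast
  show ?thesis unfolding clear_of_def
  proof (intro exI[of _ "min k l"] conjI ballI)
    fix x y assume x: "x \<in> convex hull {a, b, c}" and y: "y \<in> A \<union> B"
    have "min k l * min (dist x a) (dist x b) \<le> k * min (dist x a) (dist x b)"
         "min k l * min (dist x a) (dist x b) \<le> l * min (dist x a) (dist x b)"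
      by (intro mult_right_mono; simp)+
    then show "min k l * min (dist x a) (dist x b) \<le> dist x y" using k(2) l(2) x y by fastforce
  qed (use k l in auto)
qed

lemma clear_of_empty: "clear_of {} a b c"
  unfolding clear_of_def by (auto intro: exI[of _ 1])

lemma clear_of_UN:
  assumes "finite I" "\<And>i. i \<in> I \<Longrightarrow> clear_of (A i) a b c"
  shows "clear_of (\<Union>i\<in>I. A i) a b c"
  using assms by (induction I rule: finite_induct) (auto simp: clear_of_empty intro: clear_of_Un)

text \<open>Inside the triangle the distance to a corner is at most \<open>D\<close>, so a constant
  gap \<open>d\<close> is also a gap linear in that distance.\<close>

lemma clear_of_disjoint:
  fixes A :: "'a::euclidean_space set"
  assumes "compact A" "A \<inter> convex hull {a, b, c} = {}"
  shows "clear_of A a b c"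
proof -
  let ?T = "convex hull {a, b, c}"
  have T: "compact ?T" by (simp add: compact_convex_hull)
  obtain d where d: "d > 0" "\<forall>x\<in>?T. \<forall>y\<in>A. d \<le> dist x y"
    using separate_compact_closed[OF T compact_imp_closed[OF assms(1)]] assms(2) by blast
  obtain D where D: "\<And>x. x \<in> ?T \<Longrightarrow> dist a x \<le> D"
    using compact_imp_bounded[OF T] bounded_any_center[of ?T a] by auto
  have D0: "D \<ge> 0" using D[of a] by (simp add: hull_inc)
  show ?thesis unfolding clear_of_def
  proof (intro exI[of _ "d / (D + 1)"] conjI ballI)
    fix x y assume x: "x \<in> ?T" and y: "y \<in> A"
    have "d / (D + 1) * min (dist x a) (dist x b) \<le> d / (D + 1) * (D + 1)"
      using D[OF x] d D0 by (intro mult_left_mono) (auto simp: min_le_iff_disj dist_commute)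
    also have "\<dots> \<le> dist x y" using d(2) x y D0 by simp
    finally show "d / (D + 1) * min (dist x a) (dist x b) \<le> dist x y" .
  qed (use d D0 in auto)
qed

text \<open>Here the set may touch the triangle at \<open>a\<close>. Walking from \<open>a\<close>
  into the triangle gains height along \<open>n\<close> at rate at least \<open>e / D\<close>, while
  \<open>A\<close> stays below the level of \<open>a\<close>; so the gap grows linearly with the
  distance from \<open>a\<close>.\<close>

lemma clear_of_halfspace:
  fixes A :: "'a::euclidean_space set"
  assumes "n \<bullet> a < n \<bullet> b" "n \<bullet> a < n \<bullet> c" "\<And>y. y \<in> A \<Longrightarrow> n \<bullet> y \<le> n \<bullet> a"
  shows "clear_of A a b c"
proof -
  define e where "e = min (n \<bullet> (b - a)) (n \<bullet> (c - a))"
  define D where "D = norm (b - a) + norm (c - a)"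
  have e: "e > 0" using assms by (simp add: e_def inner_diff_right)
  have n0: "norm n > 0" using assms(1) by auto
  have "b \<noteq> a" using assms(1) by auto
  then have D: "D > 0" by (simp add: D_def add_pos_nonneg)
  show ?thesis unfolding clear_of_def
  proof (intro exI[of _ "e / (D * norm n)"] conjI ballI)
    fix x y assume x: "x \<in> convex hull {a, b, c}" and y: "y \<in> A"
    from x obtain u v w where uvw: "0 \<le> u" "0 \<le> v" "0 \<le> w" "u + v + w = 1"
      and xe: "x = u *\<^sub>R a + v *\<^sub>R b + w *\<^sub>R c" by (auto simp: convex_hull_3)
    have xa: "x - a = v *\<^sub>R (b - a) + w *\<^sub>R (c - a)"
    proof -
      have u: "u = 1 - v - w" using uvw by simp
      show ?thesis unfolding xe u by (simp add: algebra_simps)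
    qed
    have "norm (x - a) \<le> v * norm (b - a) + w * norm (c - a)"
      unfolding xa using norm_triangle_ineq[of "v *\<^sub>R (b - a)" "w *\<^sub>R (c - a)"] uvw by simp
    also have "\<dots> \<le> v * D + w * D" using uvw by (intro add_mono mult_left_mono) (auto simp: D_def)
    finally have 1: "norm (x - a) \<le> (v + w) * D" by (simp add: algebra_simps)
    have "(v + w) * e \<le> v * (n \<bullet> (b - a)) + w * (n \<bullet> (c - a))"
      unfolding distrib_right using uvw by (intro add_mono mult_left_mono) (auto simp: e_def)
    also have "\<dots> = n \<bullet> (x - a)" unfolding xa by (simp add: inner_add_right)
    also have "\<dots> \<le> n \<bullet> (x - y)" using assms(3)[OF y] by (simp add: inner_diff_right)
    also have "\<dots> \<le> norm n * dist x y" using norm_cauchy_schwarz by (simp add: dist_norm)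
    finally have 2: "(v + w) * e \<le> norm n * dist x y" .
    have "e * min (dist x a) (dist x b) \<le> e * ((v + w) * D)"
      using 1 e by (intro mult_left_mono) (auto simp: dist_norm min_le_iff_disj)
    also have "\<dots> \<le> D * (norm n * dist x y)" using 2 D mult_left_mono[of _ _ D] by (fastforce simp: mult_ac)
    finally show "e / (D * norm n) * min (dist x a) (dist x b) \<le> dist x y"
      using D n0 by (simp add: field_simps)
  qed (use e D n0 in auto)
qed

definition det2 :: "real \<times> real \<Rightarrow> real \<times> real \<Rightarrow> real" where
  "det2 u v = fst u * snd v - snd u * fst v"

definition emb :: "real \<times> real \<Rightarrow> real \<Rightarrow> R3" where
  "emb p z = (fst p, snd p, z)"

definition pr :: "R3 \<Rightarrow> real \<times> real" where
  "pr x = (fst x, fst (snd x))"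

lemma emb_diff: "emb p z - emb q w = emb (p - q) (z - w)"
  by (simp add: emb_def)

lemma norm_emb_le: "norm (emb p z) \<le> norm p + \<bar>z\<bar>"
proof -
  have "emb p z = (fst p, snd p, 0) + (0, 0, z)" by (simp add: emb_def)
  then have "norm (emb p z) \<le> norm (fst p, snd p, 0::real) + norm (0::real, 0::real, z)"
    by (metis norm_triangle_ineq)
  then show ?thesis by (simp add: norm_prod_def)
qed

lemma norm_pr_le: "norm (pr x) \<le> norm x"
  by (auto simp: pr_def norm_prod_def)

lemma norm_le_emb: "norm p \<le> norm (emb p z)"
  using norm_pr_le[of "emb p z"] by (simp add: pr_def emb_def)

lemma abs_det2_le: "\<bar>det2 u v\<bar> \<le> 2 * (norm u * norm v)"
proof -
  have "\<bar>fst u\<bar> \<le> norm u" "\<bar>snd u\<bar> \<le> norm u" "\<bar>fst v\<bar> \<le> norm v" "\<bar>snd v\<bar> \<le> norm v"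
    using norm_fst_le[of "fst u" "snd u"] norm_snd_le[of "snd u" "fst u"]
      norm_fst_le[of "fst v" "snd v"] norm_snd_le[of "snd v" "fst v"] by auto
  then have "\<bar>fst u\<bar> * \<bar>snd v\<bar> \<le> norm u * norm v" "\<bar>snd u\<bar> * \<bar>fst v\<bar> \<le> norm u * norm v"
    by (auto intro!: mult_mono)
  then show ?thesis unfolding det2_def by (simp add: abs_mult[symmetric])
qed

text \<open>The midpoint of the edge is pulled to \<open>c\<close>, and a point with parameter
  \<open>s\<close> moves at speed proportional to \<open>min s (1 - s)\<close>. By
  \<open>clear_of\<close> its distance from \<open>A\<close> is at least of the same order, so the
  Lipschitz quotient stays bounded even at \<open>a\<close> and \<open>b\<close>. The nondegenerate
  projection keeps the bending edge from folding onto itself.\<close>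

lemma triangle_move:
  fixes a b c :: R3
  assumes clear: "clear_of A a b c"
    and nd: "det2 (pr b - pr a) (pr c - pr a) \<noteq> 0"
  shows "ambient_isotopic (A \<union> closed_segment a b) (A \<union> (closed_segment a c \<union> closed_segment c b))"
proof -
  define w where "w = c - (1/2) *\<^sub>R (a + b)"
  \<comment> \<open>A tent with value 1 at 1/2: at time 1 the path reaches \<open>c\<close> halfway
    and runs straight before and after.\<close>
  define \<rho> where "\<rho> s = 2 * min s (1 - s)" for s :: real
  define x where "x t s = a + s *\<^sub>R (b - a) + (t * \<rho> s) *\<^sub>R w" for t s
  define D where "D = \<bar>det2 (pr b - pr a) (pr c - pr a)\<bar>"
  define \<kappa> where "\<kappa> = D / (2 * norm w + 1)"
  have \<kappa>0: "\<kappa> > 0" using nd by (simp add: \<kappa>_def D_def add_nonneg_pos)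
  \<comment> \<open>Taking \<open>det2\<close> with \<open>w\<close> removes the \<open>w\<close>
    component and leaves \<open>\<alpha>\<close> times twice the signed area of the projected
    triangle.\<close>
  have indep: "\<kappa> * \<bar>\<alpha>\<bar> \<le> norm (\<alpha> *\<^sub>R (b - a) + \<beta> *\<^sub>R w)" for \<alpha> \<beta>
  proof -
    let ?X = "\<alpha> *\<^sub>R (b - a) + \<beta> *\<^sub>R w"
    have "det2 (pr ?X) (pr w) = \<alpha> * det2 (pr b - pr a) (pr c - pr a)"
      by (simp add: det2_def pr_def w_def algebra_simps)
    then have "\<bar>\<alpha>\<bar> * D = \<bar>det2 (pr ?X) (pr w)\<bar>" by (simp add: D_def abs_mult)
    also have "\<dots> \<le> 2 * (norm (pr ?X) * norm (pr w))" by (rule abs_det2_le)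
    also have "\<dots> \<le> 2 * (norm ?X * norm w)" using norm_pr_le by (intro mult_left_mono mult_mono) auto
    also have "\<dots> \<le> norm ?X * (2 * norm w + 1)" unfolding distrib_left by simp
    finally have "D * \<bar>\<alpha>\<bar> \<le> norm ?X * (2 * norm w + 1)" by (simp only: mult.commute)
    moreover have "2 * norm w + 1 > 0" by (simp add: add_nonneg_pos)
    ultimately show ?thesis unfolding \<kappa>_def times_divide_eq_left by (simp only: pos_divide_le_eq)
  qed
  have \<rho>lip: "\<bar>\<rho> s - \<rho> s'\<bar> \<le> 2 * \<bar>s - s'\<bar>" for s s' by (simp add: \<rho>_def min_def abs_if)
  have xlow: "\<kappa> * \<bar>s - s'\<bar> \<le> norm (x t s - x t s')" for t s s'
  proof -
    have "x t s - x t s' = (s - s') *\<^sub>R (b - a) + (t * \<rho> s - t * \<rho> s') *\<^sub>R w"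
      by (simp add: x_def algebra_simps)
    then show ?thesis using indep by simp
  qed
  have x0: "x t 0 = a" "x t 1 = b" for t by (auto simp: x_def \<rho>_def)
  have xT: "x t s \<in> convex hull {a, b, c}" if "t \<in> {0..1}" "s \<in> {0..1}" for t s
  proof -
    have \<rho>0: "0 \<le> \<rho> s" using that by (auto simp: \<rho>_def)
    have "t * \<rho> s / 2 \<le> 1 * (\<rho> s / 2)" "0 \<le> t * \<rho> s"
      using that \<rho>0 mult_right_mono[of t 1 "\<rho> s"] by auto
    then have c: "t * \<rho> s / 2 \<le> s" "t * \<rho> s / 2 \<le> 1 - s" "0 \<le> t * \<rho> s"
    proof -
      have "\<rho> s / 2 \<le> s" "\<rho> s / 2 \<le> 1 - s" by (simp_all add: \<rho>_def)
      then show "t * \<rho> s / 2 \<le> s" "t * \<rho> s / 2 \<le> 1 - s"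
        using \<open>t * \<rho> s / 2 \<le> 1 * (\<rho> s / 2)\<close> by linarith+
    qed simp
    have "x t s = (1 - s - t * \<rho> s / 2) *\<^sub>R a + (s - t * \<rho> s / 2) *\<^sub>R b + (t * \<rho> s) *\<^sub>R c"
      by (simp add: x_def w_def algebra_simps)
    then show ?thesis unfolding convex_hull_3
      using c by (intro CollectI exI[of _ "1 - s - t * \<rho> s / 2"] exI[of _ "s - t * \<rho> s / 2"] exI[of _ "t * \<rho> s"]) simp
  qed
  obtain \<mu> where \<mu>: "\<mu> > 0" "\<And>x y. x \<in> convex hull {a, b, c} \<Longrightarrow> y \<in> A \<Longrightarrow> \<mu> * min (dist x a) (dist x b) \<le> dist x y"
    using clear unfolding clear_of_def by blast
  \<comment> \<open>The first summand serves two points of the moving edge, the second a point of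
    the edge against a fixed point of \<open>A\<close>.\<close>
  define M where "M = 2 * norm w / \<kappa> + 2 * norm w / (\<mu> * \<kappa>)"
  have M1: "2 * norm w \<le> M * \<kappa>" using \<kappa>0 \<mu> by (simp add: M_def field_simps)
  have M2: "2 * norm w \<le> M * (\<mu> * \<kappa>)" using \<kappa>0 \<mu> by (simp add: M_def field_simps)
  have M0: "M \<ge> 0" using \<kappa>0 \<mu> by (simp add: M_def)
  \<comment> \<open>The sum type puts the fixed set and the moving edge into one family although
    they share points.\<close>
  define cc :: "real \<Rightarrow> R3 + real \<Rightarrow> R3" where "cc t = case_sum (\<lambda>y. y) (x t)" for t
  define S where "S = Inl ` A \<union> Inr ` {0..1::real}"
  have mixed: "norm (x t' s - x t s) \<le> M * \<bar>t' - t\<bar> * norm (x t s - y)"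
    if "t \<in> {0..1}" "s \<in> {0..1}" "y \<in> A" for t t' s y
  proof -
    have "\<kappa> * min s (1 - s) \<le> min (dist (x t s) a) (dist (x t s) b)"
    proof -
      have "\<kappa> * s \<le> dist (x t s) a" using xlow[of s 0 t] that by (simp add: x0 dist_norm)
      moreover have "\<kappa> * (1 - s) \<le> dist (x t s) b" using xlow[of s 1 t] that by (simp add: x0 dist_norm)
      moreover have "\<kappa> * min s (1 - s) \<le> \<kappa> * s" "\<kappa> * min s (1 - s) \<le> \<kappa> * (1 - s)"
        using \<kappa>0 by (auto intro: mult_left_mono)
      ultimately show ?thesis by simp
    qed
    then have "\<mu> * (\<kappa> * min s (1 - s)) \<le> \<mu> * min (dist (x t s) a) (dist (x t s) b)"
      using \<mu> by (intro mult_left_mono) auto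
    also have "\<dots> \<le> norm (x t s - y)" using \<mu>(2)[OF xT[OF that(1,2)] that(3)] by (simp add: dist_norm)
    finally have low: "\<mu> * (\<kappa> * min s (1 - s)) \<le> norm (x t s - y)" .
    have "x t' s - x t s = ((t' - t) * \<rho> s) *\<^sub>R w" by (simp add: x_def algebra_simps)
    then have "norm (x t' s - x t s) = \<bar>t' - t\<bar> * (min s (1 - s) * (2 * norm w))"
      using that by (simp add: \<rho>_def abs_mult)
    also have "\<dots> \<le> \<bar>t' - t\<bar> * (min s (1 - s) * (M * (\<mu> * \<kappa>)))"
      using M2 that by (intro mult_left_mono) auto
    also have "\<dots> = M * \<bar>t' - t\<bar> * (\<mu> * (\<kappa> * min s (1 - s)))" by simp
    also have "\<dots> \<le> M * \<bar>t' - t\<bar> * norm (x t s - y)" using low M0 by (intro mult_left_mono) auto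
    finally show ?thesis .
  qed
  have "ambient_isotopic (cc 0 ` S) (cc 1 ` S)"
  proof (rule ambient_isotopic_lipschitz_family[where M = M])
    fix t t' :: real and u u' :: "R3 + real"
    assume t: "t \<in> {0..1}" "t' \<in> {0..1}" and u: "u \<in> S" "u' \<in> S"
    consider (ll) y y' where "u = Inl y" "u' = Inl y'"
      | (lr) y s where "u = Inl y" "u' = Inr s" "y \<in> A" "s \<in> {0..1}"
      | (rl) y s where "u = Inr s" "u' = Inl y" "y \<in> A" "s \<in> {0..1}"
      | (rr) s s' where "u = Inr s" "u' = Inr s'"
      using u unfolding S_def by blast
    then show "norm (cc t' u - cc t u - (cc t' u' - cc t u')) \<le> M * \<bar>t' - t\<bar> * norm (cc t u - cc t u')"
    proof cases
      case ll then show ?thesis using M0 by (simp add: cc_def)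
    next
      case lr
      have "norm (x t' s - x t s) \<le> M * \<bar>t' - t\<bar> * norm (x t s - y)" by (rule mixed) (use t lr in auto)
      then show ?thesis using lr by (simp add: cc_def norm_minus_commute)
    next
      case rl
      have "norm (x t' s - x t s) \<le> M * \<bar>t' - t\<bar> * norm (x t s - y)" by (rule mixed) (use t rl in auto)
      then show ?thesis using rl by (simp add: cc_def)
    next
      case rr
      have "x t' s - x t s - (x t' s' - x t s') = ((t' - t) * (\<rho> s - \<rho> s')) *\<^sub>R w"
        by (simp add: x_def algebra_simps)
      then have "norm (x t' s - x t s - (x t' s' - x t s')) = \<bar>t' - t\<bar> * (\<bar>\<rho> s - \<rho> s'\<bar> * norm w)"
        by (simp add: abs_mult)
      also have "\<dots> \<le> \<bar>t' - t\<bar> * ((2 * \<bar>s - s'\<bar>) * norm w)"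
        using \<rho>lip by (intro mult_left_mono mult_right_mono) auto
      also have "\<dots> = \<bar>t' - t\<bar> * (\<bar>s - s'\<bar> * (2 * norm w))" by simp
      also have "\<dots> \<le> \<bar>t' - t\<bar> * (\<bar>s - s'\<bar> * (M * \<kappa>))"
        using M1 by (intro mult_left_mono) auto
      also have "\<dots> = M * \<bar>t' - t\<bar> * (\<kappa> * \<bar>s - s'\<bar>)" by simp
      also have "\<dots> \<le> M * \<bar>t' - t\<bar> * norm (x t s - x t s')" using xlow M0 by (intro mult_left_mono) auto
      finally show ?thesis using rr by (simp add: cc_def)
    qed
  qed
  moreover have "cc 0 ` S = A \<union> closed_segment a b"
  proof -
    have "x 0 ` {0..1} = closed_segment a b"
      unfolding closed_segment_image_interval by (intro image_cong) (auto simp: x_def algebra_simps)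
    then show ?thesis by (simp add: S_def cc_def image_Un image_image)
  qed
  moreover have "cc 1 ` S = A \<union> (closed_segment a c \<union> closed_segment c b)"
  proof -
    have dbl: "(r * 2) *\<^sub>R v = r *\<^sub>R v + r *\<^sub>R v" for r and v :: R3
      by (metis mult_2_right scaleR_left_distrib)
    have e1: "x 1 s = (1 - 2 * s) *\<^sub>R a + (2 * s) *\<^sub>R c" if "s \<le> 1/2" for s
      using that by (simp add: x_def \<rho>_def w_def min_def algebra_simps dbl)
    have e2: "x 1 s = (1 - (2 * s - 1)) *\<^sub>R c + (2 * s - 1) *\<^sub>R b" if "s \<ge> 1/2" for s
    proof -
      have r: "\<rho> s = 2 * (1 - s)" using that by (auto simp: \<rho>_def min_def)
      show ?thesis unfolding x_def w_def r by (simp add: algebra_simps dbl)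
    qed
    have "x 1 ` {0..1/2} = closed_segment a c"
    proof -
      have "x 1 ` {0..1/2} = (\<lambda>u. (1 - u) *\<^sub>R a + u *\<^sub>R c) ` (\<lambda>s. 2 * s) ` {0..1/2}"
        unfolding image_image using e1 by (intro image_cong) auto
      also have "(\<lambda>s. 2 * s) ` {0..1/2::real} = {0..1}" by simp
      finally show ?thesis unfolding closed_segment_image_interval .
    qed
    moreover have "x 1 ` {1/2..1} = closed_segment c b"
    proof -
      have "x 1 ` {1/2..1} = (\<lambda>u. (1 - u) *\<^sub>R c + u *\<^sub>R b) ` (\<lambda>s. 2 * s + (-1)) ` {1/2..1}"
        unfolding image_image using e2 by (intro image_cong) auto
      also have "(\<lambda>s. 2 * s + (-1)) ` {1/2..1::real} = {0..1}"
        by (subst image_affinity_atLeastAtMost) auto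
      finally show ?thesis unfolding closed_segment_image_interval .
    qed
    moreover have "{0..1::real} = {0..1/2} \<union> {1/2..1}" by auto
    ultimately show ?thesis by (simp add: S_def cc_def image_Un image_image)
  qed
  ultimately show ?thesis by simp
qed

section \<open>Lipschitz bounds for pairs of moving arcs\<close>

lemma compact_pos_lower_bound:
  fixes f :: "'a::topological_space \<Rightarrow> real"
  assumes "compact S" "continuous_on S f" "\<And>x. x \<in> S \<Longrightarrow> f x > 0"
  obtains \<delta> where "\<delta> > 0" "\<And>x. x \<in> S \<Longrightarrow> \<delta> \<le> f x"
proof (cases "S = {}")
  case True then show ?thesis using that[of 1] by simp
next
  case False
  then obtain x where "x \<in> S" "\<forall>y\<in>S. f x \<le> f y" using continuous_attains_inf[OF assms(1) _ assms(2)] by blast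
  then show ?thesis using that[of "f x"] assms(3) by blast
qed

lemma compact_upper_bound:
  fixes f :: "'a::topological_space \<Rightarrow> real"
  assumes "compact S" "continuous_on S f"
  obtains R where "\<And>x. x \<in> S \<Longrightarrow> f x \<le> R"
proof (cases "S = {}")
  case True then show ?thesis using that[of 1] by simp
next
  case False
  then obtain x where "x \<in> S" "\<forall>y\<in>S. f y \<le> f x" using continuous_attains_sup[OF assms(1) _ assms(2)] by blast
  then show ?thesis using that[of "f x"] by blast
qed

text \<open>The arc over the segment from \<open>A\<close> to \<open>B\<close> with height \<open>g s (1 - s)\<close>; over a chord of the
  unit circle, \<open>1 - \<bar>p\<bar>\<^sup>2 = s (1 - s) \<bar>A - B\<bar>\<^sup>2\<close>, so this is the shape of the book arcs.\<close>

definition parc :: "real \<times> real \<Rightarrow> real \<times> real \<Rightarrow> real \<Rightarrow> real \<Rightarrow> R3" where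
  "parc A B g s = emb ((1 - s) *\<^sub>R A + s *\<^sub>R B) (s * (1 - s) * g)"

lemma parc_reverse: "parc A B g s = parc B A g (1 - s)"
  by (simp add: parc_def add.commute mult.commute)

lemma parc_change:
  fixes A B A' B' :: "real \<times> real"
  assumes "norm (A' - A) \<le> e" "norm (B' - B) \<le> e" "\<bar>g' - g\<bar> \<le> e" "s \<in> {0..1}"
  shows "norm (parc A' B' g' s - parc A B g s) \<le> 2 * e"
proof -
  have "parc A' B' g' s - parc A B g s = emb ((1 - s) *\<^sub>R (A' - A) + s *\<^sub>R (B' - B)) (s * (1 - s) * (g' - g))"
    by (simp add: parc_def emb_diff algebra_simps)
  then have "norm (parc A' B' g' s - parc A B g s)
      \<le> norm ((1 - s) *\<^sub>R (A' - A) + s *\<^sub>R (B' - B)) + \<bar>s * (1 - s) * (g' - g)\<bar>"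
    using norm_emb_le by metis
  also have "norm ((1 - s) *\<^sub>R (A' - A) + s *\<^sub>R (B' - B)) \<le> (1 - s) * norm (A' - A) + s * norm (B' - B)"
    using assms(4) norm_triangle_ineq[of "(1 - s) *\<^sub>R (A' - A)" "s *\<^sub>R (B' - B)"] by simp
  also have "\<dots> \<le> (1 - s) * e + s * e" using assms by (intro add_mono mult_left_mono) auto
  also have "\<bar>s * (1 - s) * (g' - g)\<bar> \<le> 1 * e"
    using assms unfolding abs_mult by (intro mult_mono) (auto intro: mult_le_one)
  finally show ?thesis by (simp add: algebra_simps)
qed

text \<open>This is the hypothesis of \<open>ambient_isotopic_lipschitz_family\<close> for points on
  two given arcs, so that a knot can be treated pair by pair.\<close>

definition tame :: "(real \<Rightarrow> real \<Rightarrow> R3) \<Rightarrow> (real \<Rightarrow> real \<Rightarrow> R3) \<Rightarrow> bool" where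
  "tame c d \<longleftrightarrow> (\<exists>M. \<forall>t\<in>{0..1}. \<forall>t'\<in>{0..1}. \<forall>s\<in>{0..1}. \<forall>s'\<in>{0..1}.
     norm ((c t' s - c t s) - (d t' s' - d t s')) \<le> M * \<bar>t' - t\<bar> * norm (c t s - d t s'))"

lemma lipschitz_on_norm:
  fixes f :: "real \<Rightarrow> 'a::real_normed_vector"
  assumes "L-lipschitz_on T f" "t \<in> T" "t' \<in> T"
  shows "norm (f t' - f t) \<le> L * \<bar>t' - t\<bar>"
  using lipschitz_onD[OF assms(1,3,2)] by (simp add: dist_norm)

text \<open>Change of displacement and distance are both of order \<open>|s - s'|\<close>; the
  distance is controlled by the least chord length over the compact time interval.\<close>

lemma family_bound_same:
  fixes A B :: "real \<Rightarrow> real \<times> real" and g :: "real \<Rightarrow> real"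
  assumes lip: "L-lipschitz_on {0..1} A" "L-lipschitz_on {0..1} B" "L-lipschitz_on {0..1} g"
    and nd: "\<And>t. t \<in> {0..1} \<Longrightarrow> A t \<noteq> B t"
  shows "tame (\<lambda>t. parc (A t) (B t) (g t)) (\<lambda>t. parc (A t) (B t) (g t))"
proof -
  note A = lipschitz_on_norm[OF lip(1)] and B = lipschitz_on_norm[OF lip(2)]
    and g = lipschitz_on_norm[OF lip(3), unfolded real_norm_def] and L = lipschitz_on_nonneg[OF lip(1)]
    and cA = lipschitz_on_continuous_on[OF lip(1)] and cB = lipschitz_on_continuous_on[OF lip(2)]
  obtain \<delta> where \<delta>: "\<delta> > 0" "\<And>t. t \<in> {0..1} \<Longrightarrow> \<delta> \<le> norm (B t - A t)"
    by (rule compact_pos_lower_bound[of "{0..1}" "\<lambda>t. norm (B t - A t)"])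
       (use nd in \<open>auto intro!: continuous_intros cA cB, metis atLeastAtMost_iff\<close>)
  show ?thesis unfolding tame_def
  proof (intro exI[of _ "3 * L / \<delta>"] ballI)
    fix t t' s s' :: real assume r: "t \<in> {0..1}" "t' \<in> {0..1}" "s \<in> {0..1}" "s' \<in> {0..1}"
    let ?e = "L * \<bar>t' - t\<bar>"
    let ?d = "(parc (A t') (B t') (g t') s - parc (A t) (B t) (g t) s) - (parc (A t') (B t') (g t') s' - parc (A t) (B t) (g t) s')"
    let ?c = "parc (A t) (B t) (g t) s - parc (A t) (B t) (g t) s'"
    have e: "?e \<ge> 0" using L by simp
    have "?d
       = emb ((s - s') *\<^sub>R ((B t' - B t) - (A t' - A t))) ((s - s') * (1 - s - s') * (g t' - g t))"
      by (simp add: parc_def emb_diff algebra_simps)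
    then have "norm ?d
       \<le> norm ((s - s') *\<^sub>R ((B t' - B t) - (A t' - A t))) + \<bar>(s - s') * (1 - s - s') * (g t' - g t)\<bar>"
      using norm_emb_le by metis
    also have "norm ((s - s') *\<^sub>R ((B t' - B t) - (A t' - A t))) \<le> \<bar>s - s'\<bar> * (?e + ?e)"
      unfolding norm_scaleR by (intro mult_left_mono order_trans[OF norm_triangle_ineq4] add_mono A B r) auto
    also have "\<bar>(s - s') * (1 - s - s') * (g t' - g t)\<bar> \<le> \<bar>s - s'\<bar> * 1 * ?e"
      unfolding abs_mult using g[OF r(1,2)] r by (intro mult_mono) auto
    finally have 1: "norm ?d
       \<le> 3 * ?e * \<bar>s - s'\<bar>" by (simp add: algebra_simps)
    have "?c = emb ((s - s') *\<^sub>R (B t - A t)) (s * (1 - s) * g t - s' * (1 - s') * g t)"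
      by (simp add: parc_def emb_diff algebra_simps)
    then have "\<bar>s - s'\<bar> * norm (B t - A t) \<le> norm ?c"
      using norm_le_emb by (metis norm_scaleR)
    then have 2: "\<bar>s - s'\<bar> * \<delta> \<le> norm ?c"
      using \<delta>(2)[OF r(1)] by (meson abs_ge_zero mult_left_mono order_trans)
    have "3 * ?e * \<bar>s - s'\<bar> = 3 * L / \<delta> * \<bar>t' - t\<bar> * (\<bar>s - s'\<bar> * \<delta>)" using \<delta> by simp
    also have "\<dots> \<le> 3 * L / \<delta> * \<bar>t' - t\<bar> * norm ?c"
      using 2 L \<delta> by (intro mult_left_mono) auto
    finally show "norm ?d
      \<le> 3 * L / \<delta> * \<bar>t' - t\<bar> * norm ?c"
      using 1 by linarith
  qed
qed

text \<open>Points on two rays from a common vertex are far apart in proportion to their distances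
  from it. Determinants of the difference with \<open>v\<close> and with \<open>u\<close> recover
  \<open>\<sigma>\<close> and \<open>\<sigma>'\<close> separately.\<close>

lemma corner_lower_bound:
  fixes u v :: "real \<times> real"
  assumes "\<delta> \<le> \<bar>det2 u v\<bar>" "norm u \<le> R" "norm v \<le> R" "\<sigma> \<ge> 0" "\<sigma>' \<ge> 0"
  shows "(\<sigma> + \<sigma>') * \<delta> \<le> 4 * R * norm (\<sigma> *\<^sub>R u - \<sigma>' *\<^sub>R v)"
proof -
  let ?x = "\<sigma> *\<^sub>R u - \<sigma>' *\<^sub>R v"
  have "det2 ?x v = \<sigma> * det2 u v" "det2 ?x u = \<sigma>' * det2 u v"
    by (simp_all add: det2_def algebra_simps)
  then have "\<sigma> * \<bar>det2 u v\<bar> = \<bar>det2 ?x v\<bar>" "\<sigma>' * \<bar>det2 u v\<bar> = \<bar>det2 ?x u\<bar>"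
    using assms by (simp_all add: abs_mult)
  moreover have "\<bar>det2 ?x v\<bar> \<le> 2 * (norm ?x * R)" "\<bar>det2 ?x u\<bar> \<le> 2 * (norm ?x * R)"
    using assms by (intro order_trans[OF abs_det2_le] mult_left_mono; simp)+
  ultimately have "(\<sigma> + \<sigma>') * \<bar>det2 u v\<bar> \<le> 4 * R * norm ?x" by (simp add: algebra_simps)
  moreover have "(\<sigma> + \<sigma>') * \<delta> \<le> (\<sigma> + \<sigma>') * \<bar>det2 u v\<bar>" using assms by (intro mult_left_mono) auto
  ultimately show ?thesis by linarith
qed

text \<open>Both arcs start at \<open>V\<close>, whose own motion cancels in the difference. What
  remains is of order \<open>s + s'\<close>, and so is the distance, by the uniform lower bound for
  the angle.\<close>

lemma family_bound_corner:
  fixes V P Q :: "real \<Rightarrow> real \<times> real" and g h :: "real \<Rightarrow> real"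
  assumes lip: "L-lipschitz_on {0..1} V" "L-lipschitz_on {0..1} P" "L-lipschitz_on {0..1} Q"
      "L-lipschitz_on {0..1} g" "L-lipschitz_on {0..1} h"
    and nd: "\<And>t. t \<in> {0..1} \<Longrightarrow> det2 (P t - V t) (Q t - V t) \<noteq> 0"
  shows "tame (\<lambda>t. parc (V t) (P t) (g t)) (\<lambda>t. parc (V t) (Q t) (h t))"
proof -
  note V = lipschitz_on_norm[OF lip(1)] and P = lipschitz_on_norm[OF lip(2)] and Q = lipschitz_on_norm[OF lip(3)]
    and g = lipschitz_on_norm[OF lip(4), unfolded real_norm_def]
    and h = lipschitz_on_norm[OF lip(5), unfolded real_norm_def]
    and L = lipschitz_on_nonneg[OF lip(1)] and cont = lip(1-3)[THEN lipschitz_on_continuous_on]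
  obtain \<delta> where \<delta>: "\<delta> > 0" "\<And>t. t \<in> {0..1} \<Longrightarrow> \<delta> \<le> \<bar>det2 (P t - V t) (Q t - V t)\<bar>"
    by (rule compact_pos_lower_bound[of "{0..1}" "\<lambda>t. \<bar>det2 (P t - V t) (Q t - V t)\<bar>"])
       (use nd in \<open>auto simp: det2_def intro!: continuous_intros cont\<close>)
  obtain R1 where R1: "\<And>t. t \<in> {0..1} \<Longrightarrow> norm (P t - V t) \<le> R1"
    by (rule compact_upper_bound[of "{0..1}" "\<lambda>t. norm (P t - V t)"]) (auto intro!: continuous_intros cont)
  obtain R2 where R2: "\<And>t. t \<in> {0..1} \<Longrightarrow> norm (Q t - V t) \<le> R2"
    by (rule compact_upper_bound[of "{0..1}" "\<lambda>t. norm (Q t - V t)"]) (auto intro!: continuous_intros cont)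
  define R where "R = max R1 R2"
  have R0: "R \<ge> 0" using order_trans[OF norm_ge_zero R1[of 0]] by (simp add: R_def le_max_iff_disj)
  show ?thesis unfolding tame_def
  proof (intro exI[of _ "12 * L * R / \<delta>"] ballI)
    fix t t' s s' :: real assume r: "t \<in> {0..1}" "t' \<in> {0..1}" "s \<in> {0..1}" "s' \<in> {0..1}"
    let ?e = "L * \<bar>t' - t\<bar>"
    let ?d = "(parc (V t') (P t') (g t') s - parc (V t) (P t) (g t) s) - (parc (V t') (Q t') (h t') s' - parc (V t) (Q t) (h t) s')"
    let ?c = "parc (V t) (P t) (g t) s - parc (V t) (Q t) (h t) s'"
    have e: "?e \<ge> 0" using L by simp
    have "?d = emb (s *\<^sub>R ((P t' - P t) - (V t' - V t)) - s' *\<^sub>R ((Q t' - Q t) - (V t' - V t)))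
                   (s * (1 - s) * (g t' - g t) - s' * (1 - s') * (h t' - h t))"
      by (simp add: parc_def emb_diff algebra_simps)
    then have "norm ?d \<le> norm (s *\<^sub>R ((P t' - P t) - (V t' - V t)) - s' *\<^sub>R ((Q t' - Q t) - (V t' - V t)))
         + \<bar>s * (1 - s) * (g t' - g t) - s' * (1 - s') * (h t' - h t)\<bar>"
      using norm_emb_le by metis
    also have "norm (s *\<^sub>R ((P t' - P t) - (V t' - V t)) - s' *\<^sub>R ((Q t' - Q t) - (V t' - V t)))
        \<le> s * (?e + ?e) + s' * (?e + ?e)"
      by (rule order_trans[OF norm_triangle_ineq4])
         (use r V[OF r(1,2)] P[OF r(1,2)] Q[OF r(1,2)] in \<open>auto intro!: add_mono mult_left_mono order_trans[OF norm_triangle_ineq4]\<close>)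
    also have "\<bar>s * (1 - s) * (g t' - g t) - s' * (1 - s') * (h t' - h t)\<bar> \<le> s * 1 * ?e + s' * 1 * ?e"
      by (rule order_trans[OF abs_triangle_ineq4], unfold abs_mult)
         (use r g[OF r(1,2)] h[OF r(1,2)] in \<open>auto simp: mult_left_le intro!: add_mono mult_mono\<close>)
    finally have 1: "norm ?d \<le> 3 * ?e * (s + s')" by (simp add: algebra_simps)
    have "?c = emb (s *\<^sub>R (P t - V t) - s' *\<^sub>R (Q t - V t)) (s * (1 - s) * g t - s' * (1 - s') * h t)"
      by (simp add: parc_def emb_diff algebra_simps)
    then have "norm (s *\<^sub>R (P t - V t) - s' *\<^sub>R (Q t - V t)) \<le> norm ?c"
      using norm_le_emb by metis
    moreover have "(s + s') * \<delta> \<le> 4 * R * norm (s *\<^sub>R (P t - V t) - s' *\<^sub>R (Q t - V t))"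
      by (rule corner_lower_bound) (use \<delta> R1[OF r(1)] R2[OF r(1)] r in \<open>auto simp: R_def\<close>)
    ultimately have 2: "(s + s') * \<delta> \<le> 4 * R * norm ?c"
      using R0 by (meson mult_left_mono order_trans mult_nonneg_nonneg zero_le_numeral)
    have "3 * ?e * (s + s') = 3 * L / \<delta> * \<bar>t' - t\<bar> * ((s + s') * \<delta>)" using \<delta> by simp
    also have "\<dots> \<le> 3 * L / \<delta> * \<bar>t' - t\<bar> * (4 * R * norm ?c)"
      using 2 L \<delta> by (intro mult_left_mono) auto
    finally show "norm ?d \<le> 12 * L * R / \<delta> * \<bar>t' - t\<bar> * norm ?c" using 1 by (simp add: algebra_simps)
  qed
qed

text \<open>Disjointness at every time gives, by compactness in \<open>(t, s, s')\<close>, one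
  positive gap, so any Lipschitz motion has a bounded quotient.\<close>

lemma family_bound_disjoint:
  fixes A B C D :: "real \<Rightarrow> real \<times> real" and g h :: "real \<Rightarrow> real"
  assumes lip: "L-lipschitz_on {0..1} A" "L-lipschitz_on {0..1} B" "L-lipschitz_on {0..1} C"
      "L-lipschitz_on {0..1} D" "L-lipschitz_on {0..1} g" "L-lipschitz_on {0..1} h"
    and ne: "\<And>t s s'. t \<in> {0..1} \<Longrightarrow> s \<in> {0..1} \<Longrightarrow> s' \<in> {0..1} \<Longrightarrow> parc (A t) (B t) (g t) s \<noteq> parc (C t) (D t) (h t) s'"
  shows "tame (\<lambda>t. parc (A t) (B t) (g t)) (\<lambda>t. parc (C t) (D t) (h t))"
proof -
  note n = lip(1-4)[THEN lipschitz_on_norm] and gh = lip(5,6)[THEN lipschitz_on_norm, unfolded real_norm_def]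
    and L = lipschitz_on_nonneg[OF lip(1)] and cont = lip[THEN lipschitz_on_continuous_on]
  let ?S = "{0..1::real} \<times> {0..1::real} \<times> {0..1::real}"
  have cc: "continuous_on ?S (\<lambda>x. f (fst x))" if "continuous_on {0..1} f" for f :: "real \<Rightarrow> 'z::topological_space"
    by (rule continuous_on_compose2[OF that]) (auto intro!: continuous_intros)
  have c: "continuous_on ?S (\<lambda>x. norm (parc (A (fst x)) (B (fst x)) (g (fst x)) (fst (snd x)) - parc (C (fst x)) (D (fst x)) (h (fst x)) (snd (snd x))))"
    unfolding parc_def emb_def by (intro continuous_intros cc cont)
  obtain \<delta> where \<delta>: "\<delta> > 0"
    "\<And>x. x \<in> ?S \<Longrightarrow> \<delta> \<le> norm (parc (A (fst x)) (B (fst x)) (g (fst x)) (fst (snd x)) - parc (C (fst x)) (D (fst x)) (h (fst x)) (snd (snd x)))"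
    by (rule compact_pos_lower_bound[OF _ c]) (use ne in \<open>auto intro!: compact_Times\<close>)
  show ?thesis unfolding tame_def
  proof (intro exI[of _ "4 * L / \<delta>"] ballI)
    fix t t' s s' :: real assume r: "t \<in> {0..1}" "t' \<in> {0..1}" "s \<in> {0..1}" "s' \<in> {0..1}"
    let ?e = "L * \<bar>t' - t\<bar>"
    let ?d = "(parc (A t') (B t') (g t') s - parc (A t) (B t) (g t) s) - (parc (C t') (D t') (h t') s' - parc (C t) (D t) (h t) s')"
    let ?c = "parc (A t) (B t) (g t) s - parc (C t) (D t) (h t) s'"
    have "norm ?d \<le> 2 * ?e + 2 * ?e"
      by (intro order_trans[OF norm_triangle_ineq4] add_mono parc_change n gh r)
    also have "\<dots> = 4 * L / \<delta> * \<bar>t' - t\<bar> * \<delta>" using \<delta> by simp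
    also have "\<dots> \<le> 4 * L / \<delta> * \<bar>t' - t\<bar> * norm ?c"
      using \<delta>(2)[of "(t, s, s')"] r \<delta>(1) L by (intro mult_left_mono) auto
    finally show "norm ?d \<le> 4 * L / \<delta> * \<bar>t' - t\<bar> * norm ?c" .
  qed
qed

section \<open>Families of chords of the unit circle\<close>

text \<open>Each pair of arcs falls under one of the three bounds above and has its own constant;
  finitely many pairs have a common one, here the sum of absolute values.\<close>

lemma parc_family_isotopic:
  fixes A B :: "real \<Rightarrow> 'k \<Rightarrow> real \<times> real" and g :: "real \<Rightarrow> 'k \<Rightarrow> real"
  assumes I: "finite I"
    and lip: "\<And>k. k \<in> I \<Longrightarrow> L-lipschitz_on {0..1} (\<lambda>t. A t k)" "\<And>k. k \<in> I \<Longrightarrow> L-lipschitz_on {0..1} (\<lambda>t. B t k)"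
      "\<And>k. k \<in> I \<Longrightarrow> L-lipschitz_on {0..1} (\<lambda>t. g t k)"
    and nd: "\<And>k t. k \<in> I \<Longrightarrow> t \<in> {0..1} \<Longrightarrow> A t k \<noteq> B t k"
    and pairs: "\<And>k l. k \<in> I \<Longrightarrow> l \<in> I \<Longrightarrow> k \<noteq> l \<Longrightarrow>
       (\<forall>t\<in>{0..1}. B t k = A t l \<and> det2 (A t k - B t k) (B t l - B t k) \<noteq> 0) \<or>
       (\<forall>t\<in>{0..1}. B t l = A t k \<and> det2 (A t l - B t l) (B t k - B t l) \<noteq> 0) \<or>
       (\<forall>t\<in>{0..1}. \<forall>s\<in>{0..1}. \<forall>s'\<in>{0..1}. parc (A t k) (B t k) (g t k) s \<noteq> parc (A t l) (B t l) (g t l) s')"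
  shows "ambient_isotopic (\<Union>k\<in>I. parc (A 0 k) (B 0 k) (g 0 k) ` {0..1})
                          (\<Union>k\<in>I. parc (A 1 k) (B 1 k) (g 1 k) ` {0..1})"
proof -
  define c where "c t k s = parc (A t k) (B t k) (g t k) s" for t k s
  define bd where "bd k l M \<longleftrightarrow> (\<forall>t\<in>{0..1}. \<forall>t'\<in>{0..1}. \<forall>s\<in>{0..1}. \<forall>s'\<in>{0..1}.
     norm ((c t' k s - c t k s) - (c t' l s' - c t l s')) \<le> M * \<bar>t' - t\<bar> * norm (c t k s - c t l s'))" for k l M
  have bd_sym: "bd k l M" if "bd l k M" for k l M
    unfolding bd_def
  proof (intro ballI)
    fix t t' s s' :: real assume r: "t \<in> {0..1}" "t' \<in> {0..1}" "s \<in> {0..1}" "s' \<in> {0..1}"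
    then have "norm ((c t' l s' - c t l s') - (c t' k s - c t k s)) \<le> M * \<bar>t' - t\<bar> * norm (c t l s' - c t k s)"
      using that unfolding bd_def by blast
    then show "norm ((c t' k s - c t k s) - (c t' l s' - c t l s')) \<le> M * \<bar>t' - t\<bar> * norm (c t k s - c t l s')"
      by (simp only: norm_minus_commute)
  qed
  have corner: "\<exists>M. bd k l M" if kl: "k \<in> I" "l \<in> I"
    and e: "\<forall>t\<in>{0..1}. B t k = A t l \<and> det2 (A t k - B t k) (B t l - B t k) \<noteq> 0" for k l
  proof -
    \<comment> \<open>Arc \<open>k\<close> is traversed backwards, so that both arcs start at their
      common vertex.\<close>
    have "tame (\<lambda>t. parc (B t k) (A t k) (g t k)) (\<lambda>t. parc (B t k) (B t l) (g t l))"
    proof (rule family_bound_corner[where L = L])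
      show "det2 (A t k - B t k) (B t l - B t k) \<noteq> 0" if "t \<in> {0..1}" for t using e that by blast
    qed (use kl lip in auto)
    then obtain M where M: "norm ((parc (B t' k) (A t' k) (g t' k) s - parc (B t k) (A t k) (g t k) s)
          - (parc (B t' k) (B t' l) (g t' l) s' - parc (B t k) (B t l) (g t l) s'))
      \<le> M * \<bar>t' - t\<bar> * norm (parc (B t k) (A t k) (g t k) s - parc (B t k) (B t l) (g t l) s')"
      if "t \<in> {0..1}" "t' \<in> {0..1}" "s \<in> {0..1}" "s' \<in> {0..1}" for t t' s s' unfolding tame_def by blast
    have "bd k l M" unfolding bd_def
    proof (intro ballI)
      fix t t' s s' :: real assume r: "t \<in> {0..1}" "t' \<in> {0..1}" "s \<in> {0..1}" "s' \<in> {0..1}"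
      have "B t k = A t l" "B t' k = A t' l" using e r by auto
      then show "norm ((c t' k s - c t k s) - (c t' l s' - c t l s')) \<le> M * \<bar>t' - t\<bar> * norm (c t k s - c t l s')"
        using M[OF r(1,2), of "1 - s" s'] r unfolding c_def parc_reverse[of "A t k"] parc_reverse[of "A t' k"] by simp
    qed
    then show ?thesis by blast
  qed
  have ex: "\<exists>M. bd k l M" if kl: "k \<in> I" "l \<in> I" for k l
  proof (cases "k = l")
    case True
    have "tame (\<lambda>t. c t l) (\<lambda>t. c t l)" unfolding c_def
      by (rule family_bound_same[where L = L]) (use kl lip nd in blast)+
    then show ?thesis unfolding tame_def bd_def True .
  next
    case False
    consider "\<forall>t\<in>{0..1}. B t k = A t l \<and> det2 (A t k - B t k) (B t l - B t k) \<noteq> 0"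
      | "\<forall>t\<in>{0..1}. B t l = A t k \<and> det2 (A t l - B t l) (B t k - B t l) \<noteq> 0"
      | "\<forall>t\<in>{0..1}. \<forall>s\<in>{0..1}. \<forall>s'\<in>{0..1}. parc (A t k) (B t k) (g t k) s \<noteq> parc (A t l) (B t l) (g t l) s'"
      using pairs[OF kl False] by blast
    then show ?thesis
    proof cases
      case 1 then show ?thesis using corner kl by blast
    next
      case 2 then show ?thesis using corner[of l k] kl bd_sym by blast
    next
      case 3
      have "tame (\<lambda>t. c t k) (\<lambda>t. c t l)" unfolding c_def
        by (rule family_bound_disjoint[where L = L]) (use kl lip 3 in blast)+
      then show ?thesis unfolding tame_def bd_def .
    qed
  qed
  then obtain M where M: "\<And>k l. k \<in> I \<Longrightarrow> l \<in> I \<Longrightarrow> bd k l (M k l)" by metis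
  define MM where "MM = (\<Sum>k\<in>I. \<Sum>l\<in>I. \<bar>M k l\<bar>)"
  have le: "M k l \<le> MM" if "k \<in> I" "l \<in> I" for k l
  proof -
    have "\<bar>M k l\<bar> \<le> (\<Sum>l\<in>I. \<bar>M k l\<bar>)" using that I by (intro member_le_sum) auto
    also have "\<dots> \<le> MM" unfolding MM_def using that I
      by (intro member_le_sum[of k I "\<lambda>k. \<Sum>l\<in>I. \<bar>M k l\<bar>"]) (auto intro: sum_nonneg)
    finally show ?thesis by simp
  qed
  have "ambient_isotopic ((\<lambda>(k, s). c 0 k s) ` (I \<times> {0..1})) ((\<lambda>(k, s). c 1 k s) ` (I \<times> {0..1}))"
  proof (rule ambient_isotopic_lipschitz_family[where M = MM and c = "\<lambda>t (k, s). c t k s"])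
    fix t t' :: real and x y :: "'k \<times> real"
    assume t: "t \<in> {0..1}" "t' \<in> {0..1}" and "x \<in> I \<times> {0..1}" "y \<in> I \<times> {0..1}"
    then obtain k s l s' where x: "x = (k, s)" "y = (l, s')" "k \<in> I" "l \<in> I" "s \<in> {0..1}" "s' \<in> {0..1}" by auto
    have "norm ((c t' k s - c t k s) - (c t' l s' - c t l s')) \<le> M k l * \<bar>t' - t\<bar> * norm (c t k s - c t l s')"
      using M[OF x(3,4)] t x unfolding bd_def by blast
    also have "\<dots> \<le> MM * \<bar>t' - t\<bar> * norm (c t k s - c t l s')"
      using le x by (intro mult_right_mono) auto
    finally show "norm (((case x of (k, s) \<Rightarrow> c t' k s) - (case x of (k, s) \<Rightarrow> c t k s)) - ((case y of (k, s) \<Rightarrow> c t' k s) - (case y of (k, s) \<Rightarrow> c t k s)))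
      \<le> MM * \<bar>t' - t\<bar> * norm ((case x of (k, s) \<Rightarrow> c t k s) - (case y of (k, s) \<Rightarrow> c t k s))"
      using x by simp
  qed
  moreover have "(\<lambda>(k, s). c t k s) ` (I \<times> {0..1}) = (\<Union>k\<in>I. parc (A t k) (B t k) (g t k) ` {0..1})" for t
    by (force simp: c_def)
  ultimately show ?thesis by simp
qed

section \<open>Cyclic order and orientation on the unit circle\<close>

definition cpt :: "real \<Rightarrow> real \<times> real" where
  "cpt \<alpha> = (cos \<alpha>, sin \<alpha>)"

text \<open>Twice the signed area of the triangle \<open>p q r\<close>.\<close>

definition orient :: "real \<times> real \<Rightarrow> real \<times> real \<Rightarrow> real \<times> real \<Rightarrow> real" where
  "orient p q r = det2 (q - p) (r - p)"

abbreviation orient_at :: "(nat \<Rightarrow> real) \<Rightarrow> nat \<Rightarrow> nat \<Rightarrow> nat \<Rightarrow> real" where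
  "orient_at \<theta> i j k \<equiv> orient (cpt (\<theta> i)) (cpt (\<theta> j)) (cpt (\<theta> k))"

lemma orient_rotate: "orient q r p = orient p q r"
  and orient_swap: "orient q p r = - orient p q r"
  by (simp_all add: orient_def det2_def algebra_simps)

lemma orient_same [simp]: "orient p q p = 0" "orient p q q = 0" "orient p p q = 0"
  by (simp_all add: orient_def det2_def)

lemma orient_segment:
  "orient p q ((1 - u) *\<^sub>R r + u *\<^sub>R s) = (1 - u) * orient p q r + u * orient p q s"
  by (simp add: orient_def det2_def algebra_simps)

text \<open>A chord is twice the sine of half its angle difference times a unit vector perpendicular
  to its mean direction. The area thus becomes a product of three half-angle sines, and only the
  cyclic order decides its sign.\<close>

lemma orient_cpt:
  "orient (cpt \<alpha>) (cpt \<beta>) (cpt \<gamma>) = 4 * sin ((\<beta> - \<alpha>) / 2) * sin ((\<gamma> - \<beta>) / 2) * sin ((\<gamma> - \<alpha>) / 2)"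
proof -
  have d: "cpt y - cpt x = (2 * sin ((y - x) / 2)) *\<^sub>R (- sin ((x + y) / 2), cos ((x + y) / 2))" for x y
  proof -
    have "sin ((x - y) / 2) = - sin ((y - x) / 2)" by (metis minus_diff_eq minus_divide_left sin_minus)
    then show ?thesis by (simp add: cpt_def cos_diff_cos sin_diff_sin add.commute)
  qed
  have "orient (cpt \<alpha>) (cpt \<beta>) (cpt \<gamma>) = 4 * sin ((\<beta> - \<alpha>) / 2) * sin ((\<gamma> - \<alpha>) / 2)
     * (sin ((\<alpha> + \<gamma>) / 2) * cos ((\<alpha> + \<beta>) / 2) - cos ((\<alpha> + \<gamma>) / 2) * sin ((\<alpha> + \<beta>) / 2))"
    unfolding orient_def det2_def d by (simp add: algebra_simps)
  also have "sin ((\<alpha> + \<gamma>) / 2) * cos ((\<alpha> + \<beta>) / 2) - cos ((\<alpha> + \<gamma>) / 2) * sin ((\<alpha> + \<beta>) / 2) = sin ((\<alpha> + \<gamma>) / 2 - (\<alpha> + \<beta>) / 2)"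
    by (simp add: sin_diff)
  also have "(\<alpha> + \<gamma>) / 2 - (\<alpha> + \<beta>) / 2 = (\<gamma> - \<beta>) / 2" by (simp add: field_simps)
  finally show ?thesis by simp
qed

lemma orient_cpt_pos:
  assumes "\<alpha> < \<beta>" "\<beta> < \<gamma>" "\<gamma> < \<alpha> + 2 * pi"
  shows "orient (cpt \<alpha>) (cpt \<beta>) (cpt \<gamma>) > 0"
  unfolding orient_cpt using assms by (intro mult_pos_pos sin_gt_zero) auto

abbreviation chord_arc :: "(nat \<Rightarrow> real) \<Rightarrow> real \<Rightarrow> nat \<Rightarrow> nat \<Rightarrow> R3 set" where
  "chord_arc \<theta> h a b \<equiv> lift h ` closed_segment (cpt (\<theta> a)) (cpt (\<theta> b))"

text \<open>The factor \<open>2 - 2 * cos (\<alpha> - \<beta>)\<close> is the squared length of the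
  chord.\<close>

lemma lift_chord:
  "lift h ` closed_segment (cpt \<alpha>) (cpt \<beta>) = parc (cpt \<alpha>) (cpt \<beta>) (h * (2 - 2 * cos (\<alpha> - \<beta>))) ` {0..1}"
proof -
  have "lift h ((1 - s) *\<^sub>R cpt \<alpha> + s *\<^sub>R cpt \<beta>) = parc (cpt \<alpha>) (cpt \<beta>) (h * (2 - 2 * cos (\<alpha> - \<beta>))) s" for s
  proof -
    have c: "(cos x)\<^sup>2 = 1 - (sin x)\<^sup>2" for x :: real by (simp add: cos_squared_eq)
    have "1 - ((1 - s) * cos \<alpha> + s * cos \<beta>)\<^sup>2 - ((1 - s) * sin \<alpha> + s * sin \<beta>)\<^sup>2
        = s * (1 - s) * (2 - 2 * (cos \<alpha> * cos \<beta> + sin \<alpha> * sin \<beta>))"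
      unfolding power2_sum power_mult_distrib c by (simp add: algebra_simps power2_eq_square)
    then show ?thesis by (simp add: lift_def parc_def emb_def cpt_def cos_diff)
  qed
  then show ?thesis unfolding closed_segment_image_interval image_image by (intro image_cong) auto
qed

lemma abs_cos_diff_le: "\<bar>cos x - cos y\<bar> \<le> \<bar>x - y :: real\<bar>"
proof -
  have "\<bar>cos x - cos y\<bar> = 2 * (\<bar>sin ((x + y) / 2)\<bar> * \<bar>sin ((y - x) / 2)\<bar>)"
    by (simp add: cos_diff_cos abs_mult)
  also have "\<dots> \<le> 2 * (1 * \<bar>(y - x) / 2\<bar>)"
    by (intro mult_left_mono mult_mono abs_sin_x_le_abs_x abs_sin_le_one) auto
  finally show ?thesis by simp
qed

lemma abs_sin_diff_le: "\<bar>sin x - sin y\<bar> \<le> \<bar>x - y :: real\<bar>"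
  using abs_cos_diff_le[of "pi/2 - x" "pi/2 - y"] by (simp add: cos_sin_eq[symmetric] sin_cos_eq abs_minus_commute)

lemma norm_cpt_diff_le: "norm (cpt x - cpt y) \<le> 2 * \<bar>x - y\<bar>"
  using norm_Pair_le[of "cos x - cos y" "sin x - sin y"] abs_cos_diff_le[of x y] abs_sin_diff_le[of x y]
  by (simp add: cpt_def)

text \<open>For two chords with four distinct end points: the chords do not cross.\<close>

definition separated :: "nat \<Rightarrow> nat \<Rightarrow> nat \<Rightarrow> nat \<Rightarrow> bool" where
  "separated a b c d \<longleftrightarrow> (min a b < c \<and> c < max a b \<longleftrightarrow> min a b < d \<and> d < max a b)"

text \<open>Angles are kept instead of points because the condition is convex in them: linear
  interpolation preserves it and the vertices stay on the circle.\<close>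

definition convex_order :: "nat set \<Rightarrow> (nat \<Rightarrow> real) \<Rightarrow> bool" where
  "convex_order V \<theta> \<longleftrightarrow> (\<forall>i\<in>V. \<forall>j\<in>V. i < j \<longrightarrow> \<theta> i < \<theta> j \<and> \<theta> j < \<theta> i + 2 * pi)"

lemma convex_order_pos:
  assumes "convex_order V \<theta>" "i \<in> V" "j \<in> V" "k \<in> V" "i < j" "j < k"
  shows "orient_at \<theta> i j k > 0"
  using assms by (intro orient_cpt_pos) (auto simp: convex_order_def)

lemma convex_order_nonzero:
  assumes "convex_order V \<theta>" "i \<in> V" "j \<in> V" "k \<in> V" "i \<noteq> j" "j \<noteq> k" "i \<noteq> k"
  shows "orient_at \<theta> i j k \<noteq> 0"
proof -
  note pos = convex_order_pos[OF assms(1)]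
  have perm: "orient_at \<theta> i k j = - orient_at \<theta> i j k" "orient_at \<theta> j i k = - orient_at \<theta> i j k"
    "orient_at \<theta> j k i = orient_at \<theta> i j k" "orient_at \<theta> k i j = orient_at \<theta> i j k"
    "orient_at \<theta> k j i = - orient_at \<theta> i j k"
    by (simp_all add: orient_def det2_def algebra_simps)
  consider "i < j" "j < k" | "i < k" "k < j" | "j < i" "i < k" | "j < k" "k < i" | "k < i" "i < j" | "k < j" "j < i"
    using assms(5-7) by linarith
  then show ?thesis
  proof cases
    case 1 then show ?thesis using pos[of i j k] assms(2-4) by simp
  next
    case 2 then show ?thesis using pos[of i k j] assms(2-4) by (simp only: perm) simp
  next
    case 3 then show ?thesis using pos[of j i k] assms(2-4) by (simp only: perm) simp
  next
    case 4 then show ?thesis using pos[of j k i] assms(2-4) by (simp only: perm) simp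
  next
    case 5 then show ?thesis using pos[of k i j] assms(2-4) by (simp only: perm) simp
  next
    case 6 then show ?thesis using pos[of k j i] assms(2-4) by (simp only: perm) simp
  qed
qed

lemma convex_order_inj:
  assumes "convex_order V \<theta>" "i \<in> V" "j \<in> V" "i \<noteq> j"
  shows "cpt (\<theta> i) \<noteq> cpt (\<theta> j)"
proof -
  have *: "cpt (\<theta> i) \<noteq> cpt (\<theta> j)" if "i < j" "i \<in> V" "j \<in> V" for i j
  proof
    assume "cpt (\<theta> i) = cpt (\<theta> j)"
    then have "cos (\<theta> j - \<theta> i) = 1" by (simp add: cpt_def cos_diff)
    moreover have "cos d = 1 - 2 * (sin (d / 2))\<^sup>2" for d :: real
      using cos_double_sin[of "d / 2"] by simp
    from this[of "\<theta> j - \<theta> i"] calculation have "(sin ((\<theta> j - \<theta> i) / 2))\<^sup>2 = 0" by linarith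
    moreover have "0 < \<theta> j - \<theta> i" "\<theta> j - \<theta> i < 2 * pi" using assms(1) that by (force simp: convex_order_def)+
    then have "sin ((\<theta> j - \<theta> i) / 2) > 0" by (intro sin_gt_zero) auto
    ultimately show False by simp
  qed
  show ?thesis using *[of i j] *[of j i] assms by (metis linorder_neqE_nat)
qed

text \<open>The bridge from labels to geometry: the vertices numbered between \<open>a\<close> and
  \<open>b\<close> are those to the right of the directed chord.\<close>

lemma orient_separated:
  assumes "convex_order V \<theta>" "{a, b, c} \<subseteq> V" "a < b" "c \<noteq> a" "c \<noteq> b"
  shows "(a < c \<and> c < b) = (orient_at \<theta> a b c < 0)"
proof -
  consider "c < a" | "a < c" "c < b" | "b < c" using assms by linarith
  then show ?thesis
  proof cases
    case 1
    then have "orient_at \<theta> c a b > 0" using assms convex_order_pos by auto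
    then show ?thesis using 1 by (simp add: orient_rotate)
  next
    case 2
    then have "orient_at \<theta> a c b > 0" using assms convex_order_pos by auto
    then show ?thesis using 2 by (metis neg_0_less_iff_less orient_rotate orient_swap minus_minus)
  next
    case 3
    then have "orient_at \<theta> a b c > 0" using assms convex_order_pos by auto
    then show ?thesis using 3 by simp
  qed
qed

lemma chords_disjoint:
  assumes "orient p q r < 0 \<longleftrightarrow> orient p q s < 0" "orient p q r \<noteq> 0" "orient p q s \<noteq> 0"
  shows "closed_segment p q \<inter> closed_segment r s = {}"
proof -
  have False if x: "x \<in> closed_segment p q" and x': "x \<in> closed_segment r s" for x
  proof -
    obtain u where u: "x = (1 - u) *\<^sub>R p + u *\<^sub>R q" "0 \<le> u" "u \<le> 1" using x unfolding closed_segment_def by blast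
    obtain v where v: "x = (1 - v) *\<^sub>R r + v *\<^sub>R s" "0 \<le> v" "v \<le> 1" using x' unfolding closed_segment_def by blast
    have 0: "orient p q x = 0" unfolding u orient_segment by simp
    have e: "orient p q x = (1 - v) * orient p q r + v * orient p q s" unfolding v orient_segment ..
    consider "orient p q r < 0" "orient p q s < 0" | "orient p q r > 0" "orient p q s > 0" using assms by linarith
    then show False
    proof cases
      case 1
      have "(1 - v) * orient p q r + v * orient p q s < 0"
        using convex_bound_lt[OF 1, of "1 - v" v] v by simp
      then show False using 0 e by simp
    next
      case 2
      then have "(1 - v) * (- orient p q r) + v * (- orient p q s) < 0"
        using convex_bound_lt[of "- orient p q r" 0 "- orient p q s" "1 - v" v] v by simp
      then show False using 0 e by simp
    qed
  qed
  then show ?thesis by blast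
qed


lemma norm_cpt [simp]: "norm (cpt \<alpha>) = 1"
  by (simp add: cpt_def norm_prod_def)

text \<open>Strict convexity of the ball: the functional \<open>x\<close> takes values below 1 at
  all points of the ball other than \<open>x\<close> itself, hence on the whole hull if
  \<open>x\<close> is not in \<open>S\<close>.\<close>

lemma hull_sphere:
  fixes x :: "'a::real_inner"
  assumes "x \<in> convex hull S" "norm x = 1" "\<And>s. s \<in> S \<Longrightarrow> norm s \<le> 1"
  shows "x \<in> S"
proof (rule ccontr)
  assume "x \<notin> S"
  have "x \<bullet> s < 1" if "s \<in> S" for s
  proof -
    have "x \<noteq> s" using that \<open>x \<notin> S\<close> by auto
    then have "0 < (x - s) \<bullet> (x - s)" by simp
    also have "\<dots> = (norm x)\<^sup>2 - 2 * (x \<bullet> s) + (norm s)\<^sup>2"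
      by (simp add: power2_norm_eq_inner inner_diff_left inner_diff_right inner_commute)
    also have "\<dots> \<le> 2 - 2 * (x \<bullet> s)"
      using assms(2) assms(3)[OF that] by (simp add: power_le_one)
    finally show ?thesis by simp
  qed
  then have "convex hull S \<subseteq> {y. x \<bullet> y < 1}"
    by (intro hull_minimal convex_halfspace_lt) auto
  then have "x \<bullet> x < 1" using assms(1) by auto
  then show False using assms(2) by (simp add: norm_eq_sqrt_inner)
qed

lemma norm_prod_eq_1: "norm p = 1 \<longleftrightarrow> (fst p)\<^sup>2 + (snd p)\<^sup>2 = 1" for p :: "real \<times> real"
  by (simp add: norm_prod_def)

lemma chord_sphere:
  assumes "p \<in> closed_segment (cpt \<alpha>) (cpt \<beta>)" "norm p = 1"
  shows "p = cpt \<alpha> \<or> p = cpt \<beta>"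
proof -
  have "p \<in> {cpt \<alpha>, cpt \<beta>}"
    by (rule hull_sphere) (use assms in \<open>auto simp: segment_convex_hull\<close>)
  then show ?thesis by simp
qed

lemma lift_eq_iff: "lift h p = lift k q \<longleftrightarrow> p = q \<and> (h = k \<or> norm p = 1)"
proof -
  have "h * (1 - (fst p)\<^sup>2 - (snd p)\<^sup>2) = k * (1 - (fst p)\<^sup>2 - (snd p)\<^sup>2) \<longleftrightarrow>
        h = k \<or> (fst p)\<^sup>2 + (snd p)\<^sup>2 = 1"
    by auto
  then show ?thesis by (auto simp: lift_def prod_eq_iff norm_prod_eq_1)
qed

lemma convex_order_interpolate:
  assumes "convex_order V \<theta>0" "convex_order V \<theta>1" "t \<in> {0..1}"
  shows "convex_order V (\<lambda>i. (1 - t) * \<theta>0 i + t * \<theta>1 i)"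
  unfolding convex_order_def
proof (intro ballI impI)
  fix i j assume ij: "i \<in> V" "j \<in> V" "i < j"
  have a: "\<theta>0 i - \<theta>0 j < 0" "\<theta>1 i - \<theta>1 j < 0" "\<theta>0 j - \<theta>0 i < 2 * pi" "\<theta>1 j - \<theta>1 i < 2 * pi"
    using assms(1,2) ij by (force simp: convex_order_def)+
  have "(1 - t) * (\<theta>0 i - \<theta>0 j) + t * (\<theta>1 i - \<theta>1 j) < 0"
       "(1 - t) * (\<theta>0 j - \<theta>0 i) + t * (\<theta>1 j - \<theta>1 i) < 2 * pi"
    using assms(3) by (intro convex_bound_lt a; simp)+
  then show "(1 - t) * \<theta>0 i + t * \<theta>1 i < (1 - t) * \<theta>0 j + t * \<theta>1 j \<and>
             (1 - t) * \<theta>0 j + t * \<theta>1 j < (1 - t) * \<theta>0 i + t * \<theta>1 i + 2 * pi"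
    by (simp add: algebra_simps)
qed

text \<open>A common point has one projection. Either the chords themselves are disjoint, or the
  sheets differ and meet only over the circle, where a chord has just its ends.\<close>

lemma lifted_chords_disjoint:
  assumes ord: "convex_order V \<theta>" and V: "{a, b, c, d} \<subseteq> V"
    and ne: "a \<noteq> b" "c \<noteq> d" "c \<noteq> a" "c \<noteq> b" "d \<noteq> a" "d \<noteq> b"
    and sep: "separated a b c d \<or> h \<noteq> k"
  shows "chord_arc \<theta> h a b \<inter>
         chord_arc \<theta> k c d = {}"
proof -
  have False if x: "x \<in> chord_arc \<theta> h a b"
    "x \<in> chord_arc \<theta> k c d" for x
  proof -
    obtain p q where pq: "p \<in> closed_segment (cpt (\<theta> a)) (cpt (\<theta> b))"
      "q \<in> closed_segment (cpt (\<theta> c)) (cpt (\<theta> d))" "x = lift h p" "x = lift k q" using x by auto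
    then have e: "p = q" "h = k \<or> norm p = 1" by (metis lift_eq_iff)+
    show False
    proof (cases "separated a b c d")
      case True
      define a' b' where "a' = min a b" and "b' = max a b"
      have ab: "a' < b'" "{a', b'} = {a, b}" using ne by (auto simp: a'_def b'_def min_def max_def)
      then have seg: "closed_segment (cpt (\<theta> a)) (cpt (\<theta> b)) = closed_segment (cpt (\<theta> a')) (cpt (\<theta> b'))"
        using closed_segment_commute by (metis doubleton_eq_iff)
      have m: "a' \<in> V" "b' \<in> V" "a' \<noteq> c" "b' \<noteq> c" "a' \<noteq> d" "b' \<noteq> d"
        using ab V ne by (auto simp: a'_def b'_def min_def max_def)
      have "(a' < c \<and> c < b') = (a' < d \<and> d < b')" using True by (simp add: separated_def a'_def b'_def)
      then have "closed_segment (cpt (\<theta> a')) (cpt (\<theta> b')) \<inter> closed_segment (cpt (\<theta> c)) (cpt (\<theta> d)) = {}"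
        using orient_separated[OF ord, of a' b' c] orient_separated[OF ord, of a' b' d] m ab V
          convex_order_nonzero[OF ord, of a' b' c] convex_order_nonzero[OF ord, of a' b' d]
        by (intro chords_disjoint) auto
      then show False using pq e seg by auto
    next
      case False
      then have "norm p = 1" using sep e by auto
      then have "p = cpt (\<theta> a) \<or> p = cpt (\<theta> b)" "p = cpt (\<theta> c) \<or> p = cpt (\<theta> d)"
        using pq e chord_sphere by blast+
      then show False using convex_order_inj[OF ord] V ne by (metis insert_subset)
    qed
  qed
  then show ?thesis by blast
qed

text \<open>Angles and heights are interpolated linearly. Cyclic order and strict height
  inequalities survive convex combination, so noncrossing pairs stay noncrossing and crossing pairs
  stay in different sheets at all times.\<close>

lemma book_isotopic:
  fixes E :: "(nat \<times> nat) set"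
  assumes V: "finite V" and E: "E \<subseteq> V \<times> V"
    and ord: "convex_order V \<theta>0" "convex_order V \<theta>1"
    and loop: "\<And>a b. (a, b) \<in> E \<Longrightarrow> a \<noteq> b"
    and pairs: "\<And>a b c d. (a, b) \<in> E \<Longrightarrow> (c, d) \<in> E \<Longrightarrow> (a, b) \<noteq> (c, d) \<Longrightarrow>
       b = c \<and> a \<noteq> d \<or> d = a \<and> c \<noteq> b \<or>
       c \<noteq> a \<and> c \<noteq> b \<and> d \<noteq> a \<and> d \<noteq> b \<and>
         (separated a b c d \<or> h0 (a, b) < h0 (c, d) \<and> h1 (a, b) < h1 (c, d) \<or>
          h0 (c, d) < h0 (a, b) \<and> h1 (c, d) < h1 (a, b))"
  shows "ambient_isotopic
     (\<Union>(a, b)\<in>E. lift (h0 (a, b)) ` closed_segment (cpt (\<theta>0 a)) (cpt (\<theta>0 b)))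
     (\<Union>(a, b)\<in>E. lift (h1 (a, b)) ` closed_segment (cpt (\<theta>1 a)) (cpt (\<theta>1 b)))"
proof -
  define \<theta> where "\<theta> t i = (1 - t) * \<theta>0 i + t * \<theta>1 i" for t i
  define h where "h t e = (1 - t) * h0 e + t * h1 e" for t e
  define W where "W t e = 2 - 2 * cos (\<theta> t (fst e) - \<theta> t (snd e))" for t e
  define D where "D = (\<Sum>i\<in>V. \<bar>\<theta>1 i - \<theta>0 i\<bar>)"
  define H where "H = (\<Sum>e\<in>E. \<bar>h0 e\<bar> + \<bar>h1 e\<bar>)"
  have finE: "finite E" using V E finite_subset by blast
  have D: "\<bar>\<theta>1 i - \<theta>0 i\<bar> \<le> D" if "i \<in> V" for i
    unfolding D_def using that V by (intro member_le_sum) auto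
  have H: "\<bar>h0 e\<bar> + \<bar>h1 e\<bar> \<le> H" if "e \<in> E" for e
    unfolding H_def using that finE by (intro member_le_sum[of e E "\<lambda>e. \<bar>h0 e\<bar> + \<bar>h1 e\<bar>"]) auto
  have D0: "D \<ge> 0" and H0: "H \<ge> 0" by (auto simp: D_def H_def intro!: sum_nonneg)
  have \<theta>lip: "\<bar>\<theta> t' i - \<theta> t i\<bar> \<le> D * \<bar>t' - t\<bar>" if "i \<in> V" for t t' i
  proof -
    have "\<theta> t' i - \<theta> t i = (\<theta>1 i - \<theta>0 i) * (t' - t)" by (simp add: \<theta>_def algebra_simps)
    then show ?thesis using D[OF that] by (simp add: abs_mult mult_right_mono)
  qed
  have hlip: "\<bar>h t' e - h t e\<bar> \<le> H * \<bar>t' - t\<bar>" if "e \<in> E" for t t' e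
  proof -
    have "h t' e - h t e = (h1 e - h0 e) * (t' - t)" by (simp add: h_def algebra_simps)
    moreover have "\<bar>h1 e - h0 e\<bar> \<le> H" using H[OF that] by linarith
    ultimately show ?thesis by (simp add: abs_mult mult_right_mono)
  qed
  have hbd: "\<bar>h t e\<bar> \<le> H" if "e \<in> E" "t \<in> {0..1}" for t e
  proof -
    have "\<bar>h t e\<bar> \<le> (1 - t) * \<bar>h0 e\<bar> + t * \<bar>h1 e\<bar>"
      unfolding h_def using that(2) by (intro order_trans[OF abs_triangle_ineq]) (simp add: abs_mult)
    also have "\<dots> \<le> 1 * \<bar>h0 e\<bar> + 1 * \<bar>h1 e\<bar>" using that(2) by (intro add_mono mult_right_mono) auto
    finally show ?thesis using H[OF that(1)] by simp
  qed
  have Wlip: "\<bar>W t' e - W t e\<bar> \<le> 4 * D * \<bar>t' - t\<bar>" if "e \<in> E" for t t' e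
  proof -
    have m: "fst e \<in> V" "snd e \<in> V" using that E by auto
    have "W t' e - W t e = - 2 * (cos (\<theta> t' (fst e) - \<theta> t' (snd e)) - cos (\<theta> t (fst e) - \<theta> t (snd e)))"
      by (simp add: W_def)
    then have "\<bar>W t' e - W t e\<bar> \<le> 2 * \<bar>(\<theta> t' (fst e) - \<theta> t' (snd e)) - (\<theta> t (fst e) - \<theta> t (snd e))\<bar>"
      using abs_cos_diff_le[of "\<theta> t' (fst e) - \<theta> t' (snd e)" "\<theta> t (fst e) - \<theta> t (snd e)"]
      by (simp only: abs_mult) simp
    moreover have "w \<le> 4 * e" if "w \<le> 2 * \<bar>(a - b) - (c - d)\<bar>" "\<bar>a - c\<bar> \<le> e" "\<bar>b - d\<bar> \<le> e"
      for a b c d e w :: real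
    proof -
      have "(a - b) - (c - d) = (a - c) - (b - d)" by simp
      then have "\<bar>(a - b) - (c - d)\<bar> \<le> \<bar>a - c\<bar> + \<bar>b - d\<bar>" by (metis abs_triangle_ineq4)
      then show ?thesis using that by argo
    qed
    ultimately show ?thesis unfolding mult.assoc using \<theta>lip[OF m(1)] \<theta>lip[OF m(2)] by blast
  qed
  have Wbd: "\<bar>W t e\<bar> \<le> 4" for t e
    using cos_ge_minus_one[of "\<theta> t (fst e) - \<theta> t (snd e)"] cos_le_one[of "\<theta> t (fst e) - \<theta> t (snd e)"]
    by (simp add: W_def del: cos_ge_minus_one cos_le_one)
  have ordt: "convex_order V (\<theta> t)" if "t \<in> {0..1}" for t
    unfolding \<theta>_def by (rule convex_order_interpolate[OF ord that])
  have chord: "lift (h t e) ` closed_segment (cpt (\<theta> t (fst e))) (cpt (\<theta> t (snd e)))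
      = parc (cpt (\<theta> t (fst e))) (cpt (\<theta> t (snd e))) (h t e * W t e) ` {0..1}" for t e
    unfolding W_def by (rule lift_chord)
  \<comment> \<open>\<open>2 * D\<close> bounds the speed of the vertices. The rest bounds the speed
    of the product of \<open>h\<close> and \<open>W\<close>: \<open>H\<close> and 4 bound the
    factors, \<open>H\<close> and \<open>4 * D\<close> their speeds.\<close>
  define L where "L = 2 * D + 4 * (H * D) + 4 * H"
  have L1: "2 * D * x \<le> L * x" if "x \<ge> 0" for x
    unfolding L_def using that D0 H0 by (intro mult_right_mono) auto
  have "ambient_isotopic
     (\<Union>e\<in>E. parc (cpt (\<theta> 0 (fst e))) (cpt (\<theta> 0 (snd e))) (h 0 e * W 0 e) ` {0..1})
     (\<Union>e\<in>E. parc (cpt (\<theta> 1 (fst e))) (cpt (\<theta> 1 (snd e))) (h 1 e * W 1 e) ` {0..1})"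
  proof (rule parc_family_isotopic[where A = "\<lambda>t e. cpt (\<theta> t (fst e))" and B = "\<lambda>t e. cpt (\<theta> t (snd e))"
        and g = "\<lambda>t e. h t e * W t e" and L = L, OF finE])
    fix e assume e: "e \<in> E"
    have L0: "L \<ge> 0" using D0 H0 by (simp add: L_def)
    have m: "fst e \<in> V" "snd e \<in> V" using e E by auto
    have *: "norm (cpt (\<theta> t' i) - cpt (\<theta> t i)) \<le> L * \<bar>t' - t\<bar>" if "i \<in> V" for i t t'
      using norm_cpt_diff_le[of "\<theta> t' i" "\<theta> t i"] \<theta>lip[OF that, of t' t]
        L1[of "\<bar>t' - t\<bar>", OF abs_ge_zero] unfolding mult.assoc by argo
    show "L-lipschitz_on {0..1} (\<lambda>t. cpt (\<theta> t (fst e)))" "L-lipschitz_on {0..1} (\<lambda>t. cpt (\<theta> t (snd e)))"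
      using * m L0 by (auto intro!: lipschitz_onI simp: dist_norm norm_minus_commute abs_minus_commute)
    show "L-lipschitz_on {0..1} (\<lambda>t. h t e * W t e)"
    proof (rule lipschitz_onI[OF _ L0])
      fix t' t assume t: "t' \<in> {0..1::real}" "t \<in> {0..1::real}"
    have "h t' e * W t' e - h t e * W t e = h t' e * (W t' e - W t e) + (h t' e - h t e) * W t e"
      by (simp add: algebra_simps)
    then have "\<bar>h t' e * W t' e - h t e * W t e\<bar> \<le> \<bar>h t' e\<bar> * \<bar>W t' e - W t e\<bar> + \<bar>h t' e - h t e\<bar> * \<bar>W t e\<bar>"
      by (metis abs_mult abs_triangle_ineq)
    also have "\<dots> \<le> H * (4 * D * \<bar>t' - t\<bar>) + (H * \<bar>t' - t\<bar>) * 4"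
      using e t H0 by (intro add_mono mult_mono hbd Wlip hlip Wbd) auto
    also have "\<dots> \<le> L * \<bar>t' - t\<bar>" using D0 H0 by (simp add: L_def algebra_simps)
    finally show "dist (h t' e * W t' e) (h t e * W t e) \<le> L * dist t' t" by (simp add: dist_real_def)
    qed
  next
    fix e t assume e: "e \<in> E" and t: "t \<in> {0..1::real}"
    show "cpt (\<theta> t (fst e)) \<noteq> cpt (\<theta> t (snd e))"
      using convex_order_inj[OF ordt[OF t]] e E loop by (metis mem_Sigma_iff prod.collapse subsetD)
  next
    fix e e' assume e: "e \<in> E" "e' \<in> E" "e \<noteq> e'"
    obtain a b c d where ab: "e = (a, b)" "e' = (c, d)" by (metis surj_pair)
    have m: "a \<in> V" "b \<in> V" "c \<in> V" "d \<in> V" using e E ab by auto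
    have lp: "a \<noteq> b" "c \<noteq> d" using loop e ab by auto
    have det: "det2 (cpt (\<theta> t i) - cpt (\<theta> t j)) (cpt (\<theta> t k) - cpt (\<theta> t j)) \<noteq> 0"
      if "t \<in> {0..1}" "{i, j, k} \<subseteq> V" "i \<noteq> j" "j \<noteq> k" "i \<noteq> k" for t i j k
      using convex_order_nonzero[OF ordt[OF that(1)], of j i k] that by (auto simp: orient_def)
    consider "b = c \<and> a \<noteq> d" | "d = a \<and> c \<noteq> b"
      | "c \<noteq> a \<and> c \<noteq> b \<and> d \<noteq> a \<and> d \<noteq> b"
        "separated a b c d \<or> h0 (a, b) < h0 (c, d) \<and> h1 (a, b) < h1 (c, d) \<or>
          h0 (c, d) < h0 (a, b) \<and> h1 (c, d) < h1 (a, b)"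
      using pairs[of a b c d] e ab by blast
    then show "(\<forall>t\<in>{0..1}. cpt (\<theta> t (snd e)) = cpt (\<theta> t (fst e')) \<and>
         det2 (cpt (\<theta> t (fst e)) - cpt (\<theta> t (snd e))) (cpt (\<theta> t (snd e')) - cpt (\<theta> t (snd e))) \<noteq> 0) \<or>
       (\<forall>t\<in>{0..1}. cpt (\<theta> t (snd e')) = cpt (\<theta> t (fst e)) \<and>
         det2 (cpt (\<theta> t (fst e')) - cpt (\<theta> t (snd e'))) (cpt (\<theta> t (snd e)) - cpt (\<theta> t (snd e'))) \<noteq> 0) \<or>
       (\<forall>t\<in>{0..1}. \<forall>s\<in>{0..1}. \<forall>s'\<in>{0..1}.
          parc (cpt (\<theta> t (fst e))) (cpt (\<theta> t (snd e))) (h t e * W t e) s \<noteq>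
          parc (cpt (\<theta> t (fst e'))) (cpt (\<theta> t (snd e'))) (h t e' * W t e') s')"
    proof cases
      case 1
      then show ?thesis using m lp ab by (intro disjI1 ballI conjI det) auto
    next
      case 2
      then show ?thesis using m lp ab by (intro disjI2 disjI1 ballI conjI det) auto
    next
      case 3
      have "lift (h t e) ` closed_segment (cpt (\<theta> t a)) (cpt (\<theta> t b)) \<inter>
            lift (h t e') ` closed_segment (cpt (\<theta> t c)) (cpt (\<theta> t d)) = {}" if t: "t \<in> {0..1}" for t
      proof (rule lifted_chords_disjoint[OF ordt[OF t]])
        have *: "(1 - t) * x + t * y < (1 - t) * x' + t * y'" if "x < x'" "y < y'" for x y x' y'
          using convex_bound_lt[of "x - x'" 0 "y - y'" "1 - t" t] that t by (simp add: algebra_simps)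
        show "separated a b c d \<or> h t e \<noteq> h t e'"
          using 3(2) * unfolding h_def ab by (metis less_irrefl)
      qed (use m lp 3 in auto)
      then have "parc (cpt (\<theta> t (fst e))) (cpt (\<theta> t (snd e))) (h t e * W t e) ` {0..1} \<inter>
          parc (cpt (\<theta> t (fst e'))) (cpt (\<theta> t (snd e'))) (h t e' * W t e') ` {0..1} = {}" if "t \<in> {0..1}" for t
        unfolding chord[symmetric] using that ab by simp
      then show ?thesis by (intro disjI2 ballI) blast
    qed
  qed
  then show ?thesis
    unfolding chord[symmetric] by (simp add: \<theta>_def h_def case_prod_unfold)
qed

section \<open>Book polygons\<close>

lemma pr_emb [simp]: "pr (emb p z) = p"
  by (simp add: pr_def emb_def)

lemma pr_lift [simp]: "pr (lift h p) = p"
  by (simp add: pr_def lift_def)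

lemma linear_pr: "linear pr"
  by (rule linearI) (auto simp: pr_def)

lemma continuous_on_pr [continuous_intros]: "continuous_on S f \<Longrightarrow> continuous_on S (\<lambda>x. pr (f x))"
  unfolding pr_def by (intro continuous_intros)

lemma pr_hull: "x \<in> convex hull {emb a \<alpha>, emb b \<beta>, emb c \<gamma>} \<Longrightarrow> pr x \<in> convex hull {a, b, c}"
  using convex_hull_linear_image[OF linear_pr, of "{emb a \<alpha>, emb b \<beta>, emb c \<gamma>}"] by auto

lemma continuous_on_lift: "continuous_on S (lift h)"
  unfolding lift_def by (intro continuous_intros)

lemma compact_arc: "compact (lift h ` closed_segment p q)"
  by (intro compact_continuous_image continuous_on_lift compact_segment)

lemma flat_arc: "lift 0 ` closed_segment p q = closed_segment (emb p 0) (emb q 0)"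
proof -
  have "lift 0 ((1 - u) *\<^sub>R p + u *\<^sub>R q) = (1 - u) *\<^sub>R emb p 0 + u *\<^sub>R emb q 0" for u
    by (simp add: lift_def emb_def)
  then show ?thesis unfolding closed_segment_image_interval by (simp add: image_image)
qed

lemma orient_arc:
  assumes "y \<in> lift h ` closed_segment p q"
  shows "orient p q (pr y) = 0"
proof -
  obtain u where "pr y = (1 - u) *\<^sub>R p + u *\<^sub>R q" using assms by (auto simp: closed_segment_def)
  then show ?thesis by (simp add: orient_segment)
qed

lemma orient_inner: "orient p q (pr y) = (- snd (q - p), fst (q - p), 0) \<bullet> (y - emb p \<zeta>)"
  by (cases y) (simp add: orient_def det2_def pr_def emb_def algebra_simps)

text \<open>The vertical plane containing the arc serves as the boundary of the half space; the sign
  condition puts the rest of the triangle strictly on one side of it.\<close>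

lemma clear_of_arc_corner:
  assumes "orient a s b * orient a s c > 0"
  shows "clear_of (lift h ` closed_segment a s) (emb a \<alpha>) (emb b \<beta>) (emb c \<gamma>)"
proof -
  let ?n = "(- snd (s - a), fst (s - a), 0) :: R3"
  have e: "?n \<bullet> x = ?n \<bullet> emb a \<alpha> + orient a s (pr x)" for x
    unfolding orient_inner[of _ _ _ \<alpha>] inner_diff_right by simp
  have e': "- ?n \<bullet> x = - ?n \<bullet> emb a \<alpha> - orient a s (pr x)" for x
    unfolding inner_minus_left using e[of x] by linarith
  consider "orient a s b > 0" "orient a s c > 0" | "orient a s b < 0" "orient a s c < 0"
    using assms by (auto simp: zero_less_mult_iff)
  then show ?thesis
  proof cases
    case 1
    show ?thesis
    proof (rule clear_of_halfspace[where n = ?n])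
      show "?n \<bullet> emb a \<alpha> < ?n \<bullet> emb b \<beta>" "?n \<bullet> emb a \<alpha> < ?n \<bullet> emb c \<gamma>"
        using 1 e[of "emb b \<beta>"] e[of "emb c \<gamma>"] by simp_all
      show "?n \<bullet> y \<le> ?n \<bullet> emb a \<alpha>" if "y \<in> lift h ` closed_segment a s" for y
        using e[of y] orient_arc[OF that] by simp
    qed
  next
    case 2
    show ?thesis
    proof (rule clear_of_halfspace[where n = "- ?n"])
      show "- ?n \<bullet> emb a \<alpha> < - ?n \<bullet> emb b \<beta>" "- ?n \<bullet> emb a \<alpha> < - ?n \<bullet> emb c \<gamma>"
        using 2 e'[of "emb b \<beta>"] e'[of "emb c \<gamma>"] by (simp_all only: pr_emb)
      show "- ?n \<bullet> y \<le> - ?n \<bullet> emb a \<alpha>" if "y \<in> lift h ` closed_segment a s" for y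
        using e'[of y] orient_arc[OF that] by linarith
    qed
  qed
qed

lemma orient_hull_pos:
  assumes "x \<in> convex hull {a, b, c}" "orient r s a > 0" "orient r s b > 0" "orient r s c > 0"
  shows "orient r s x > 0"
proof -
  let ?n = "(- snd (s - r), fst (s - r))"
  have e: "orient r s y = ?n \<bullet> y - ?n \<bullet> r" for y
    by (cases y) (simp add: orient_def det2_def inner_prod_def algebra_simps)
  have "convex hull {a, b, c} \<subseteq> {y. ?n \<bullet> y > ?n \<bullet> r}"
  proof (rule hull_minimal)
    show "{a, b, c} \<subseteq> {y. ?n \<bullet> y > ?n \<bullet> r}" using assms(2-4) by (simp add: e)
  qed (rule convex_halfspace_gt)
  then show ?thesis using assms(1) by (auto simp: e)
qed

lemma clear_of_arc_line:
  assumes "orient r s a > 0" "orient r s b > 0" "orient r s c > 0"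
  shows "clear_of (lift h ` closed_segment r s) (emb a \<alpha>) (emb b \<beta>) (emb c \<gamma>)"
proof (rule clear_of_disjoint[OF compact_arc])
  have "False" if "x \<in> lift h ` closed_segment r s" "x \<in> convex hull {emb a \<alpha>, emb b \<beta>, emb c \<gamma>}" for x
    using orient_arc[OF that(1)] orient_hull_pos[OF pr_hull[OF that(2)] assms] by simp
  then show "lift h ` closed_segment r s \<inter> convex hull {emb a \<alpha>, emb b \<beta>, emb c \<gamma>} = {}" by blast
qed

lemma clear_of_arc_line_neg:
  assumes "orient r s a < 0" "orient r s b < 0" "orient r s c < 0"
  shows "clear_of (lift h ` closed_segment r s) (emb a \<alpha>) (emb b \<beta>) (emb c \<gamma>)"
  using clear_of_arc_line[of s r a b c h \<alpha> \<beta> \<gamma>] assms orient_swap[of s r]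
  by (simp add: closed_segment_commute)

lemma norm_segment_eq_1:
  fixes p :: "real \<times> real"
  assumes "p \<in> closed_segment r s" "norm p = 1" "norm r = 1" "norm s = 1"
  shows "p = r \<or> p = s"
proof -
  have "p \<in> {r, s}" by (rule hull_sphere) (use assms in \<open>auto simp: segment_convex_hull\<close>)
  then show ?thesis by simp
qed

text \<open>A raised arc meets the plane of the circle only in its two end points.\<close>

lemma clear_of_arc_raised:
  assumes "h \<noteq> 0" "norm r = 1" "norm s = 1" "norm a \<le> 1" "norm b \<le> 1" "norm c \<le> 1"
    and "r \<notin> {a, b, c}" "s \<notin> {a, b, c}"
  shows "clear_of (lift h ` closed_segment r s) (emb a 0) (emb b 0) (emb c 0)"
proof (rule clear_of_disjoint[OF compact_arc])
  have "False" if x: "x \<in> lift h ` closed_segment r s" "x \<in> convex hull {emb a 0, emb b 0, emb c 0}" for x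
  proof -
    obtain p where p: "p \<in> closed_segment r s" "x = lift h p" using x by auto
    have "convex hull {emb a 0, emb b 0, emb c 0} \<subseteq> {y. (0, 0, 1) \<bullet> y = 0}"
    proof (rule hull_minimal)
      show "convex {y :: R3. (0, 0, 1) \<bullet> y = 0}" by (rule convex_hyperplane)
    qed (auto simp: emb_def)
    then have "(0, 0, 1) \<bullet> x = 0" using x by blast
    then have n: "norm p = 1" using p assms(1) by (auto simp: lift_def norm_prod_eq_1)
    have "p \<in> convex hull {a, b, c}" using pr_hull[OF x(2)] p by simp
    then have "p \<in> {a, b, c}" by (rule hull_sphere[OF _ n]) (use assms in auto)
    moreover have "p = r \<or> p = s" using norm_segment_eq_1 p n assms by blast
    ultimately show False using assms by blast
  qed
  then show "lift h ` closed_segment r s \<inter> convex hull {emb a 0, emb b 0, emb c 0} = {}" by blast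
qed

lemma separated_orient:
  assumes "convex_order V \<theta>" "{r, s, a, b} \<subseteq> V" "r \<noteq> s" "a \<noteq> r" "a \<noteq> s" "b \<noteq> r" "b \<noteq> s" "separated r s a b"
  shows "orient_at \<theta> r s a * orient_at \<theta> r s b > 0"
proof -
  have *: "orient_at \<theta> r s a * orient_at \<theta> r s b > 0"
    if "r < s" "separated r s a b" "{r, s, a, b} \<subseteq> V" "a \<noteq> r" "a \<noteq> s" "b \<noteq> r" "b \<noteq> s" for r s
  proof -
    have "(orient_at \<theta> r s a < 0) = (orient_at \<theta> r s b < 0)"
      using orient_separated[OF assms(1), of r s a] orient_separated[OF assms(1), of r s b] that
      by (simp add: separated_def min_def max_def)
    moreover have "orient_at \<theta> r s a \<noteq> 0" "orient_at \<theta> r s b \<noteq> 0"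
      using convex_order_nonzero[OF assms(1)] that by auto
    ultimately show ?thesis by (auto simp: zero_less_mult_iff)
  qed
  show ?thesis
  proof (cases "r < s")
    case True then show ?thesis using * assms by blast
  next
    case False
    then have "orient_at \<theta> s r a * orient_at \<theta> s r b > 0"
    proof (intro *)
      show "s < r" using False assms(3) by simp
      show "separated s r a b" using assms(8) by (simp add: separated_def min.commute[of s] max.commute[of s])
    qed (use assms in auto)
    then show ?thesis by (simp add: orient_swap[of "cpt (\<theta> s)"])
  qed
qed

text \<open>An arc away from the corners is harmless if it leaves the plane of the triangle or if
  its line misses the triangle. An arc ending at \<open>a\<close> or \<open>b\<close> needs the
  other two corners on one side of its line. No arc may end at \<open>c\<close>, the vertex to be
  removed.\<close>

lemma clear_of_book_arc:
  assumes ord: "convex_order V \<theta>" and V: "{a, b, c, r, s} \<subseteq> V" and rs: "r \<noteq> s"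
    and cond: "r \<notin> {a, b, c} \<and> s \<notin> {a, b, c} \<and> (h \<noteq> 0 \<or> separated r s a b \<and> separated r s a c) \<or>
      r = a \<and> a \<notin> {b, c} \<and> s \<notin> {b, c} \<and> separated r s b c \<or> s = a \<and> a \<notin> {b, c} \<and> r \<notin> {b, c} \<and> separated r s b c \<or>
      r = b \<and> b \<notin> {a, c} \<and> s \<notin> {a, c} \<and> separated r s a c \<or> s = b \<and> b \<notin> {a, c} \<and> r \<notin> {a, c} \<and> separated r s a c"
  shows "clear_of (chord_arc \<theta> h r s)
    (emb (cpt (\<theta> a)) 0) (emb (cpt (\<theta> b)) 0) (emb (cpt (\<theta> c)) 0)"
proof -
  have corner: "clear_of (chord_arc \<theta> h r s)
      (emb (cpt (\<theta> a)) 0) (emb (cpt (\<theta> b)) 0) (emb (cpt (\<theta> c)) 0)"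
    if "{a, b, c, r, s} \<subseteq> V" "r = a \<or> s = a" "r \<noteq> s" "a \<notin> {b, c}" "r \<notin> {b, c}" "s \<notin> {b, c}" "separated r s b c" for a b r s
  proof -
    have "orient_at \<theta> r s b * orient_at \<theta> r s c > 0"
      by (rule separated_orient[OF ord]) (use that in auto)
    moreover have "orient_at \<theta> s r b * orient_at \<theta> s r c =
       orient_at \<theta> r s b * orient_at \<theta> r s c"
      by (simp add: orient_swap[of "cpt (\<theta> s)"])
    ultimately show ?thesis
      using that(2) clear_of_arc_corner[of "cpt (\<theta> r)" "cpt (\<theta> s)" "cpt (\<theta> b)" "cpt (\<theta> c)"]
        clear_of_arc_corner[of "cpt (\<theta> s)" "cpt (\<theta> r)" "cpt (\<theta> b)" "cpt (\<theta> c)"]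
        closed_segment_commute[of "cpt (\<theta> s)" "cpt (\<theta> r)"] by metis
  qed
  show ?thesis
    using cond
  proof (elim disjE conjE)
    assume off: "r \<notin> {a, b, c}" "s \<notin> {a, b, c}" and raised: "h \<noteq> 0"
    have "cpt (\<theta> r) \<notin> {cpt (\<theta> a), cpt (\<theta> b), cpt (\<theta> c)}" "cpt (\<theta> s) \<notin> {cpt (\<theta> a), cpt (\<theta> b), cpt (\<theta> c)}"
      using convex_order_inj[OF ord] off V by auto
    then show ?thesis using raised by (intro clear_of_arc_raised) auto
  next
    assume off: "r \<notin> {a, b, c}" "s \<notin> {a, b, c}" and sep: "separated r s a b" "separated r s a c"
    have "orient_at \<theta> r s a * orient_at \<theta> r s b > 0"
         "orient_at \<theta> r s a * orient_at \<theta> r s c > 0"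
      using off sep V rs by (auto intro!: separated_orient[OF ord])
    then consider "orient_at \<theta> r s a > 0" "orient_at \<theta> r s b > 0"
        "orient_at \<theta> r s c > 0"
      | "orient_at \<theta> r s a < 0" "orient_at \<theta> r s b < 0"
        "orient_at \<theta> r s c < 0"
      by (auto simp: zero_less_mult_iff)
    then show ?thesis by cases (rule clear_of_arc_line clear_of_arc_line_neg; assumption)+
  next
    assume "r = a" "a \<notin> {b, c}" "s \<notin> {b, c}" "separated r s b c"
    then show ?thesis using V rs by (intro corner) simp_all
  next
    assume "s = a" "a \<notin> {b, c}" "r \<notin> {b, c}" "separated r s b c"
    then show ?thesis using V rs by (intro corner) simp_all
  next
    assume "r = b" "b \<notin> {a, c}" "s \<notin> {a, c}" "separated r s a c"
    then show ?thesis using V rs by (subst clear_of_commute, intro corner) simp_all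
  next
    assume "s = b" "b \<notin> {a, c}" "r \<notin> {a, c}" "separated r s a c"
    then show ?thesis using V rs by (subst clear_of_commute, intro corner) simp_all
  qed
qed

definition book :: "(nat \<Rightarrow> real) \<Rightarrow> (nat \<times> nat \<Rightarrow> real) \<Rightarrow> (nat \<times> nat) set \<Rightarrow> R3 set" where
  "book \<theta> h E = (\<Union>(a, b)\<in>E. chord_arc \<theta> (h (a, b)) a b)"

lemma book_Un: "book \<theta> h (E \<union> F) = book \<theta> h E \<union> book \<theta> h F"
  by (simp add: book_def)

lemma book_insert: "book \<theta> h (insert (a, b) E) = chord_arc \<theta> (h (a, b)) a b \<union> book \<theta> h E"
  by (simp add: book_def)

lemma book_empty [simp]: "book \<theta> h {} = {}"
  by (simp add: book_def)

lemma book_cong: "(\<And>e. e \<in> E \<Longrightarrow> h e = h' e) \<Longrightarrow> book \<theta> h E = book \<theta> h' E"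
  unfolding book_def by (intro SUP_cong) auto

lemma book_flat: "h (a, b) = 0 \<Longrightarrow> book \<theta> h {(a, b)} = closed_segment (emb (cpt (\<theta> a)) 0) (emb (cpt (\<theta> b)) 0)"
  by (simp add: book_def flat_arc)

lemma clear_of_book:
  assumes "finite E" "\<And>r s. (r, s) \<in> E \<Longrightarrow> clear_of (chord_arc \<theta> (h (r, s)) r s) a b c"
  shows "clear_of (book \<theta> h E) a b c"
  unfolding book_def using assms by (intro clear_of_UN) auto

lemma book_remove_vertex:
  assumes ord: "convex_order V \<theta>" and V: "finite V" "E \<subseteq> V \<times> V" "{a, b, c} \<subseteq> V" "a \<noteq> b" "b \<noteq> c" "a \<noteq> c"
    and flat: "h (a, c) = 0" "h (c, b) = 0" "h (a, b) = 0"
    and E: "\<And>r s. (r, s) \<in> E \<Longrightarrow> r \<noteq> s \<and>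
      (r \<notin> {a, b, c} \<and> s \<notin> {a, b, c} \<and> (h (r, s) \<noteq> 0 \<or> separated r s a b \<and> separated r s a c) \<or>
       r = a \<and> s \<notin> {b, c} \<and> separated r s b c \<or> s = a \<and> r \<notin> {b, c} \<and> separated r s b c \<or>
       r = b \<and> s \<notin> {a, c} \<and> separated r s a c \<or> s = b \<and> r \<notin> {a, c} \<and> separated r s a c)"
  shows "ambient_isotopic (book \<theta> h (E \<union> {(a, c), (c, b)})) (book \<theta> h (E \<union> {(a, b)}))"
proof -
  have "finite E" using V finite_subset by blast
  then have "clear_of (book \<theta> h E) (emb (cpt (\<theta> a)) 0) (emb (cpt (\<theta> b)) 0) (emb (cpt (\<theta> c)) 0)"
  proof (rule clear_of_book)
    fix r s assume rs: "(r, s) \<in> E"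
    show "clear_of (chord_arc \<theta> (h (r, s)) r s) (emb (cpt (\<theta> a)) 0) (emb (cpt (\<theta> b)) 0) (emb (cpt (\<theta> c)) 0)"
      using E[OF rs] V rs by (intro clear_of_book_arc[OF ord]) auto
  qed
  moreover have "det2 (pr (emb (cpt (\<theta> b)) 0) - pr (emb (cpt (\<theta> a)) 0)) (pr (emb (cpt (\<theta> c)) 0) - pr (emb (cpt (\<theta> a)) 0)) \<noteq> 0"
    using convex_order_nonzero[OF ord, of a b c] V by (simp add: orient_def)
  ultimately have "ambient_isotopic (book \<theta> h E \<union> closed_segment (emb (cpt (\<theta> a)) 0) (emb (cpt (\<theta> b)) 0))
     (book \<theta> h E \<union> (closed_segment (emb (cpt (\<theta> a)) 0) (emb (cpt (\<theta> c)) 0) \<union> closed_segment (emb (cpt (\<theta> c)) 0) (emb (cpt (\<theta> b)) 0)))"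
    by (rule triangle_move)
  moreover have "book \<theta> h (E \<union> {(a, b)}) = book \<theta> h E \<union> closed_segment (emb (cpt (\<theta> a)) 0) (emb (cpt (\<theta> b)) 0)"
    unfolding book_Un using flat by (simp add: book_flat)
  moreover have "book \<theta> h (E \<union> {(a, c), (c, b)}) = book \<theta> h E \<union>
      (closed_segment (emb (cpt (\<theta> a)) 0) (emb (cpt (\<theta> c)) 0) \<union> closed_segment (emb (cpt (\<theta> c)) 0) (emb (cpt (\<theta> b)) 0))"
    unfolding book_Un using flat by (simp add: book_insert flat_arc)
  ultimately show ?thesis by (simp only: ambient_isotopic_sym)
qed

definition left_edges :: "(nat \<times> nat) set" where
  "left_edges = {(1, 3), (3, 5), (5, 7), (2, 4), (4, 6), (6, 1)}"

definition right_edges :: "(nat \<times> nat) set" where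
  "right_edges = {(9, 11), (11, 13), (13, 8), (8, 10), (10, 12), (12, 14)}"

text \<open>The vertices 15, ..., \<open>n\<close> are removed in this order by triangles that all
  have the corner 14. Raised edges cannot enter the plane of these triangles, so only the flat edges
  {7,9} and the rest of the chain need a separation argument.\<close>

lemma book_remove_chain:
  fixes n :: nat
  assumes n: "n \<ge> 14" and ord: "convex_order {1..n} \<theta>"
    and raised: "\<And>e. e \<in> left_edges \<union> right_edges \<Longrightarrow> h e \<noteq> 0"
    and flat: "\<And>e. e \<notin> left_edges \<union> right_edges \<Longrightarrow> h e = 0"
  shows "ambient_isotopic (book \<theta> h (left_edges \<union> right_edges \<union> {(7, 9)} \<union> (\<lambda>i. (i, Suc i)) ` {14..<n} \<union> {(n, 2)}))
                          (book \<theta> h (left_edges \<union> right_edges \<union> {(7, 9)} \<union> {(14, 2)}))"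
proof (cases "n = 14")
  case True
  then show ?thesis by (simp add: ambient_isotopic_refl)
next
  case False
  then have n15: "n \<ge> 15" using n by simp
  define B where "B = left_edges \<union> right_edges \<union> {(7, 9)}"
  \<comment> \<open>The edges that do not start at 14 once the vertices 15, ...,
    \<open>j - 1\<close> are gone; the edge \<open>(14, j)\<close> is added separately.\<close>
  define C where "C j = B \<union> (\<lambda>i. (i, Suc i)) ` {j..<n} \<union> {(n, 2)}" for j
  have Bh: "h (r, s) \<noteq> 0 \<or> (r, s) = (7, 9)" if "(r, s) \<in> B" for r s using raised that by (auto simp: B_def)
  have BV: "B \<subseteq> {1..n} \<times> {1..n}" using n by (auto simp: B_def left_edges_def right_edges_def)
  have B14: "1 \<le> r \<and> r \<le> 14 \<and> 1 \<le> s \<and> s \<le> 14 \<and> r \<noteq> s \<and> r \<noteq> 14 \<and> (s = 14 \<longrightarrow> r = 12) \<and> s \<noteq> 2 \<and> (r = 2 \<longrightarrow> s = 4)"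
    if "(r, s) \<in> B" for r s
    using that by (auto simp: B_def left_edges_def right_edges_def)
  have h0: "h (i, j) = 0" if "i \<ge> 14" for i j
    using that by (intro flat) (auto simp: left_edges_def right_edges_def)
  have move: "ambient_isotopic (book \<theta> h (C j \<union> {(14, j)})) (book \<theta> h (C (Suc j) \<union> {(14, Suc j)}))" if j: "15 \<le> j" "j < n" for j
  proof -
    have "ambient_isotopic (book \<theta> h (C (Suc j) \<union> {(14, j), (j, Suc j)})) (book \<theta> h (C (Suc j) \<union> {(14, Suc j)}))"
    proof (rule book_remove_vertex[OF ord])
      show "C (Suc j) \<subseteq> {1..n} \<times> {1..n}" using BV n by (auto simp: C_def)
      fix r s assume rs: "(r, s) \<in> C (Suc j)"
      then consider "(r, s) \<in> B" | i where "Suc j \<le> i" "i < n" "r = i" "s = Suc i" | "r = n" "s = 2"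
        by (auto simp: C_def)
      then show "r \<noteq> s \<and>
      (r \<notin> {14, Suc j, j} \<and> s \<notin> {14, Suc j, j} \<and> (h (r, s) \<noteq> 0 \<or> separated r s 14 (Suc j) \<and> separated r s 14 j) \<or>
       r = 14 \<and> s \<notin> {Suc j, j} \<and> separated r s (Suc j) j \<or> s = 14 \<and> r \<notin> {Suc j, j} \<and> separated r s (Suc j) j \<or>
       r = Suc j \<and> s \<notin> {14, j} \<and> separated r s 14 j \<or> s = Suc j \<and> r \<notin> {14, j} \<and> separated r s 14 j)"
      proof cases
        case 1
        show ?thesis
        proof (cases "s = 14")
          case True
          then have "r = 12" using B14[OF 1] by simp
          then show ?thesis using True j by (simp add: separated_def)
        next
          case False
          then have "r < 14" "s < 14" "r \<noteq> s" using B14[OF 1] by auto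
          moreover have "h (r, s) \<noteq> 0 \<or> separated r s 14 (Suc j) \<and> separated r s 14 j"
            using Bh[OF 1] j by (auto simp: separated_def)
          ultimately show ?thesis using j by simp
        qed
      next
        case 2
        then show ?thesis using j by (auto simp: separated_def)
      next
        case 3
        then show ?thesis using j by (auto simp: separated_def)
      qed
    qed (use j n h0 in auto)
    moreover have "C (Suc j) \<union> {(14, j), (j, Suc j)} = C j \<union> {(14, j)}"
    proof -
      have "{j..<n} = insert j {Suc j..<n}" using j by auto
      then show ?thesis by (auto simp: C_def)
    qed
    ultimately show ?thesis by simp
  qed
  have "ambient_isotopic (book \<theta> h (C 15 \<union> {(14, 15)})) (book \<theta> h (C j \<union> {(14, j)}))" if "15 \<le> j" "j \<le> n" for j
    using that
  proof (induction j rule: dec_induct)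
    case base show ?case by (rule ambient_isotopic_refl)
  next
    case (step j)
    show ?case by (rule ambient_isotopic_trans[OF step.IH move]) (use step in simp_all)
  qed
  from this[of n] have 1: "ambient_isotopic (book \<theta> h (C 15 \<union> {(14, 15)})) (book \<theta> h (C n \<union> {(14, n)}))"
    using n15 by simp
  \<comment> \<open>The last triangle has the corner 2 in place of a successor of \<open>n\<close>,
    hence the separate treatment.\<close>
  have 2: "ambient_isotopic (book \<theta> h (B \<union> {(14, n), (n, 2)})) (book \<theta> h (B \<union> {(14, 2)}))"
  proof (rule book_remove_vertex[OF ord])
    fix r s assume rs: "(r, s) \<in> B"
    show "r \<noteq> s \<and>
      (r \<notin> {14, 2, n} \<and> s \<notin> {14, 2, n} \<and> (h (r, s) \<noteq> 0 \<or> separated r s 14 2 \<and> separated r s 14 n) \<or>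
       r = 14 \<and> s \<notin> {2, n} \<and> separated r s 2 n \<or> s = 14 \<and> r \<notin> {2, n} \<and> separated r s 2 n \<or>
       r = 2 \<and> s \<notin> {14, n} \<and> separated r s 14 n \<or> s = 2 \<and> r \<notin> {14, n} \<and> separated r s 14 n)"
    proof (cases "s = 14 \<or> r = 2")
      case True
      then consider "r = 12" "s = 14" | "r = 2" "s = 4" using B14[OF rs] by auto
      then show ?thesis
      proof cases
        case 1
        have "separated 12 14 2 n" using n15 by (simp add: separated_def)
        then show ?thesis using 1 n15 by simp
      next
        case 2
        have "separated 2 4 14 n" using n15 by (simp add: separated_def)
        then show ?thesis using 2 n15 by simp
      qed
    next
      case False
      then have "r < 14" "s < 14" "r \<noteq> s" "r \<noteq> 2" "s \<noteq> 2" using B14[OF rs] by auto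
      moreover have "h (r, s) \<noteq> 0 \<or> separated r s 14 2 \<and> separated r s 14 n"
        using Bh[OF rs] n15 by (auto simp: separated_def)
      ultimately show ?thesis using n15 by simp
    qed
  qed (use n15 BV h0 in auto)
  have "C 15 \<union> {(14, 15)} = B \<union> (\<lambda>i. (i, Suc i)) ` {14..<n} \<union> {(n, 2)}"
  proof -
    have "{14..<n} = insert 14 {15..<n}" using n15 by auto
    then show ?thesis by (auto simp: C_def)
  qed
  moreover have "C n \<union> {(14, n)} = B \<union> {(14, n), (n, 2)}" by (auto simp: C_def)
  ultimately show ?thesis using ambient_isotopic_trans[OF 1] 2 by (simp add: B_def)
qed

section \<open>Cutting a book polygon into two\<close>

text \<open>Rotation by \<open>- \<alpha>\<close> and translation by \<open>- d\<close>. It carries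
  the vertical plane with unit normal at angle \<open>\<alpha>\<close> and distance \<open>d\<close>
  to the plane \<open>x = 0\<close> on which connected sums are defined.\<close>

definition rigid :: "real \<Rightarrow> real \<Rightarrow> R3 \<Rightarrow> R3" where
  "rigid \<alpha> d x = (cos \<alpha> * fst x + sin \<alpha> * fst (snd x) - d, cos \<alpha> * fst (snd x) - sin \<alpha> * fst x, snd (snd x))"

lemma ambient_isotopic_rigid: "ambient_isotopic K (rigid \<alpha> d ` K)"
proof -
  have "rigid \<alpha> d ` K = (\<lambda>(x, y, z). (x + - d, y, z)) ` (\<lambda>(x, y, z). (fst (rot (- \<alpha>) (x, y)), snd (rot (- \<alpha>) (x, y)), z)) ` K"
    unfolding image_image case_prod_unfold rigid_def rot_def by simp
  then show ?thesis
    using ambient_isotopic_trans[OF ambient_isotopic_rot[of K "- \<alpha>"] ambient_isotopic_shift[of _ "- d"]] by simp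
qed

lemma rigid_segment: "closed_segment (rigid \<alpha> d p) (rigid \<alpha> d q) = rigid \<alpha> d ` closed_segment p q"
proof -
  have "rigid \<alpha> d ((1 - u) *\<^sub>R p + u *\<^sub>R q) = (1 - u) *\<^sub>R rigid \<alpha> d p + u *\<^sub>R rigid \<alpha> d q" for u
    by (simp add: rigid_def algebra_simps prod_eq_iff)
  then show ?thesis unfolding closed_segment_image_interval by (simp add: image_image)
qed

lemma inj_rigid: "inj (rigid \<alpha> d)"
proof (rule injI)
  fix x y assume e: "rigid \<alpha> d x = rigid \<alpha> d y"
  then have "rot (- \<alpha>) (pr x) = rot (- \<alpha>) (pr y)" by (simp add: rigid_def rot_def pr_def)
  then have "pr x = pr y" by (metis rot_minus(2))
  then show "x = y" using e by (simp add: rigid_def pr_def prod_eq_iff)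
qed

lemma connected_sum_cutI:
  fixes \<alpha> d :: real
  defines "l \<equiv> \<lambda>x :: R3. cos \<alpha> * fst x + sin \<alpha> * fst (snd x) - d"
  assumes K: "ambient_isotopic K0 K"
    and pq: "p \<noteq> q" "K \<inter> {x. l x = 0} = {p, q}"
    and pieces: "ambient_isotopic (K \<inter> {x. l x \<le> 0} \<union> closed_segment p q) K1"
      "ambient_isotopic (K \<inter> {x. l x \<ge> 0} \<union> closed_segment p q) K2"
  shows "isotopic_to_connected_sum K0 K1 K2"
proof -
  let ?M = "rigid \<alpha> d"
  have l: "fst (?M x) = l x" for x by (simp add: rigid_def l_def)
  have im: "?M ` K \<inter> {x. P (fst x)} = ?M ` (K \<inter> {x. P (l x)})" for P by (auto simp: l)
  have piece: "ambient_isotopic (?M ` X \<union> closed_segment (?M p) (?M q)) Y" if "ambient_isotopic (X \<union> closed_segment p q) Y" for X Y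
    using ambient_isotopic_trans[OF ambient_isotopic_sym[OF ambient_isotopic_rigid] that, of \<alpha> d]
    unfolding rigid_segment image_Un .
  show ?thesis unfolding isotopic_to_connected_sum_def
  proof (intro exI conjI)
    show "ambient_isotopic K0 (?M ` K)" using ambient_isotopic_trans[OF K ambient_isotopic_rigid] .
    show "?M p \<noteq> ?M q" using pq inj_rigid by (metis injD)
    show "?M ` K \<inter> {x. fst x = 0} = {?M p, ?M q}" unfolding im[of "\<lambda>r. r = 0"] pq by simp
    show "ambient_isotopic (?M ` K \<inter> {x. fst x \<le> 0} \<union> closed_segment (?M p) (?M q)) K1"
      unfolding im[of "\<lambda>r. r \<le> 0"] by (rule piece[OF pieces(1)])
    show "ambient_isotopic (?M ` K \<inter> {x. 0 \<le> fst x} \<union> closed_segment (?M p) (?M q)) K2"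
      unfolding im[of "\<lambda>r. 0 \<le> r"] by (rule piece[OF pieces(2)])
  qed
qed

lemma segment_cut:
  fixes l :: "'a::real_vector \<Rightarrow> real"
  assumes l: "\<And>u. l ((1 - u) *\<^sub>R a + u *\<^sub>R b) = (1 - u) * l a + u * l b"
    and s: "l a < 0" "l b > 0"
  obtains \<nu> p where "0 < \<nu>" "\<nu> < 1" "p = (1 - \<nu>) *\<^sub>R a + \<nu> *\<^sub>R b" "l p = 0"
    "closed_segment a b \<inter> {x. l x \<le> 0} = closed_segment a p"
    "closed_segment a b \<inter> {x. l x \<ge> 0} = closed_segment p b"
    "closed_segment a b \<inter> {x. l x = 0} = {p}"
proof -
  define \<nu> where "\<nu> = - l a / (l b - l a)"
  define x where "x u = (1 - u) *\<^sub>R a + u *\<^sub>R b" for u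
  have \<nu>: "0 < \<nu>" "\<nu> < 1" using s by (auto simp: \<nu>_def field_simps)
  have D: "l b - l a > 0" using s by simp
  have lx: "l (x u) = (l b - l a) * (u - \<nu>)" for u
  proof -
    have "l (x u) = (1 - u) * l a + u * l b" unfolding x_def by (rule l)
    moreover have "(l b - l a) * \<nu> = - l a" using D by (simp add: \<nu>_def)
    ultimately show ?thesis unfolding right_diff_distrib[of _ u] by (simp add: algebra_simps)
  qed
  have seg: "closed_segment a b = x ` {0..1}" by (simp add: closed_segment_image_interval x_def)
  have le: "l (x u) \<le> 0 \<longleftrightarrow> u \<le> \<nu>" "l (x u) \<ge> 0 \<longleftrightarrow> u \<ge> \<nu>" "l (x u) = 0 \<longleftrightarrow> u = \<nu>" for u
    unfolding lx using D by (auto simp: mult_le_0_iff zero_le_mult_iff)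
  have s1: "closed_segment a (x \<nu>) = x ` {0..\<nu>}"
  proof -
    have "(1 - v) *\<^sub>R a + v *\<^sub>R x \<nu> = x (\<nu> * v)" for v by (simp add: x_def algebra_simps)
    then have "closed_segment a (x \<nu>) = x ` (\<lambda>v. \<nu> * v) ` {0..1}"
      unfolding closed_segment_image_interval by (simp add: image_image)
    then show ?thesis using \<nu> by (simp add: image_mult_atLeastAtMost)
  qed
  have s2: "closed_segment (x \<nu>) b = x ` {\<nu>..1}"
  proof -
    have "(1 - v) *\<^sub>R x \<nu> + v *\<^sub>R b = x ((1 - \<nu>) * v + \<nu>)" for v by (simp add: x_def algebra_simps)
    then have "closed_segment (x \<nu>) b = x ` (\<lambda>v. (1 - \<nu>) * v + \<nu>) ` {0..1}"
      unfolding closed_segment_image_interval by (simp add: image_image)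
    then show ?thesis using \<nu> by (subst (asm) image_affinity_atLeastAtMost) auto
  qed
  show thesis
  proof (rule that[OF \<nu> refl])
    show "l ((1 - \<nu>) *\<^sub>R a + \<nu> *\<^sub>R b) = 0" using le(3)[of \<nu>] by (simp add: x_def)
    show "closed_segment a b \<inter> {x. l x \<le> 0} = closed_segment a ((1 - \<nu>) *\<^sub>R a + \<nu> *\<^sub>R b)"
      using s1 \<nu> le(1) unfolding x_def[symmetric] seg by auto
    show "closed_segment a b \<inter> {x. 0 \<le> l x} = closed_segment ((1 - \<nu>) *\<^sub>R a + \<nu> *\<^sub>R b) b"
      using s2 \<nu> le(2) unfolding x_def[symmetric] seg by auto
    show "closed_segment a b \<inter> {x. l x = 0} = {(1 - \<nu>) *\<^sub>R a + \<nu> *\<^sub>R b}"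
      using \<nu> le(3) unfolding x_def[symmetric] seg by auto
  qed
qed

text \<open>The closed piece runs through \<open>a\<close>, \<open>P\<close>, \<open>Q\<close>,
  \<open>b\<close>. The triangle \<open>a Q P\<close> removes \<open>P\<close>, then
  \<open>a b Q\<close> removes \<open>Q\<close>. Among the raised edges only those from
  \<open>a'\<close> to \<open>a\<close> and from \<open>b\<close> to \<open>b'\<close> touch these
  triangles, and the orientations say that the triangles lie on one side of them.\<close>

lemma book_close_up:
  assumes ord: "convex_order V \<theta>" and V: "finite V" "E \<subseteq> V \<times> V" "{a, b, a', b'} \<subseteq> V"
    and ne: "a \<noteq> b" "a' \<noteq> b" "b' \<noteq> a"
    and E: "\<And>r s. (r, s) \<in> E \<Longrightarrow> h (r, s) \<noteq> 0 \<and> (r \<notin> {a, b} \<and> s \<notin> {a, b} \<or> r = a' \<and> s = a \<or> r = b \<and> s = b')"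
    and PQ: "norm P \<le> 1" "norm Q \<le> 1" "\<And>i. i \<in> V \<Longrightarrow> cpt (\<theta> i) \<noteq> P \<and> cpt (\<theta> i) \<noteq> Q"
    and oA: "orient (cpt (\<theta> a')) (cpt (\<theta> a)) P > 0" "orient (cpt (\<theta> a')) (cpt (\<theta> a)) Q > 0"
      "orient (cpt (\<theta> a')) (cpt (\<theta> a)) (cpt (\<theta> b)) > 0"
    and oB: "orient (cpt (\<theta> b)) (cpt (\<theta> b')) (cpt (\<theta> a)) > 0" "orient (cpt (\<theta> b)) (cpt (\<theta> b')) Q > 0"
    and oQ: "orient Q (cpt (\<theta> b)) (cpt (\<theta> a)) > 0" "orient Q (cpt (\<theta> b)) P > 0" "orient (cpt (\<theta> a)) P Q > 0"
  shows "ambient_isotopic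
    (book \<theta> h E \<union> closed_segment (emb (cpt (\<theta> a)) 0) (emb P 0) \<union> closed_segment (emb Q 0) (emb (cpt (\<theta> b)) 0)
      \<union> closed_segment (emb P 0) (emb Q 0))
    (book \<theta> h E \<union> closed_segment (emb (cpt (\<theta> a)) 0) (emb (cpt (\<theta> b)) 0))"
proof -
  let ?v = "\<lambda>i. cpt (\<theta> i)"
  let ?A = "emb (?v a) 0" and ?B = "emb (?v b) 0" and ?P = "emb P 0" and ?Q = "emb Q 0"
  have fin: "finite E" using V finite_subset by blast
  have inj: "?v i \<noteq> ?v j" if "i \<in> V" "j \<in> V" "i \<noteq> j" for i j using convex_order_inj[OF ord] that by blast
  have 1: "clear_of (book \<theta> h E) ?A ?Q ?P"
  proof (rule clear_of_book[OF fin])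
    fix r s assume rs: "(r, s) \<in> E"
    then have m: "r \<in> V" "s \<in> V" using V by auto
    show "clear_of (lift (h (r, s)) ` closed_segment (?v r) (?v s)) ?A ?Q ?P"
    proof (cases "s = a")
      case True
      then have "r = a'" using E[OF rs] ne by auto
      then have "orient (?v s) (?v r) Q * orient (?v s) (?v r) P > 0"
        using oA True by (simp add: orient_swap[of "?v a" "?v a'"])
      then have "clear_of (lift (h (r, s)) ` closed_segment (?v s) (?v r)) (emb (?v s) 0) ?Q ?P"
        by (rule clear_of_arc_corner)
      then show ?thesis using True by (simp add: closed_segment_commute)
    next
      case False
      then have "r \<noteq> a" using E[OF rs] ne by auto
      then show ?thesis using E[OF rs] PQ m False inj V
        by (intro clear_of_arc_raised) auto
    qed
  qed
  have 2: "clear_of (book \<theta> h E) ?A ?B ?Q"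
  proof (rule clear_of_book[OF fin])
    fix r s assume rs: "(r, s) \<in> E"
    then have m: "r \<in> V" "s \<in> V" using V by auto
    from E[OF rs] consider "r = a'" "s = a" | "r = b" "s = b'" | "r \<notin> {a, b}" "s \<notin> {a, b}" by blast
    then show "clear_of (lift (h (r, s)) ` closed_segment (?v r) (?v s)) ?A ?B ?Q"
    proof cases
      case 1
      then have "orient (?v s) (?v r) (?v b) * orient (?v s) (?v r) Q > 0"
        using oA by (simp add: orient_swap[of "?v a" "?v a'"])
      then have "clear_of (lift (h (r, s)) ` closed_segment (?v s) (?v r)) (emb (?v s) 0) ?B ?Q"
        by (rule clear_of_arc_corner)
      then show ?thesis using 1 by (simp add: closed_segment_commute)
    next
      case 2
      then have "orient (?v r) (?v s) (?v a) * orient (?v r) (?v s) Q > 0" using oB by simp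
      then have "clear_of (lift (h (r, s)) ` closed_segment (?v r) (?v s)) (emb (?v r) 0) ?A ?Q"
        by (rule clear_of_arc_corner)
      then show ?thesis using 2 clear_of_commute by blast
    next
      case 3
      then show ?thesis using E[OF rs] PQ m inj V by (intro clear_of_arc_raised) auto
    qed
  qed
  have "clear_of (lift 0 ` closed_segment Q (?v b)) ?Q ?A ?P"
    using oQ by (intro clear_of_arc_corner) simp
  then have "clear_of (book \<theta> h E \<union> closed_segment ?Q ?B) ?A ?Q ?P"
    unfolding flat_arc using 1 clear_of_commute clear_of_Un by blast
  moreover have "det2 (pr ?Q - pr ?A) (pr ?P - pr ?A) \<noteq> 0"
    using oQ(3) orient_swap[of P "?v a" Q] orient_rotate[of Q P "?v a"] orient_rotate[of "?v a" Q P]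
    by (simp add: orient_def det2_def algebra_simps)
  ultimately have 3: "ambient_isotopic ((book \<theta> h E \<union> closed_segment ?Q ?B) \<union> closed_segment ?A ?Q)
     ((book \<theta> h E \<union> closed_segment ?Q ?B) \<union> (closed_segment ?A ?P \<union> closed_segment ?P ?Q))"
    by (rule triangle_move)
  have "det2 (pr ?B - pr ?A) (pr ?Q - pr ?A) \<noteq> 0"
    using oQ(1) by (simp add: orient_def det2_def algebra_simps)
  then have 4: "ambient_isotopic (book \<theta> h E \<union> closed_segment ?A ?B) (book \<theta> h E \<union> (closed_segment ?A ?Q \<union> closed_segment ?Q ?B))"
    by (rule triangle_move[OF 2])
  have "book \<theta> h E \<union> (closed_segment ?A ?Q \<union> closed_segment ?Q ?B) = (book \<theta> h E \<union> closed_segment ?Q ?B) \<union> closed_segment ?A ?Q"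
    by blast
  note ambient_isotopic_sym[OF ambient_isotopic_trans[OF 4[unfolded this] 3]]
  moreover have "(book \<theta> h E \<union> closed_segment ?Q ?B) \<union> (closed_segment ?A ?P \<union> closed_segment ?P ?Q) =
      book \<theta> h E \<union> closed_segment ?A ?P \<union> closed_segment ?Q ?B \<union> closed_segment ?P ?Q"
    by blast
  ultimately show ?thesis by (simp only:)
qed

lemma cos_less_cos:
  assumes "0 \<le> x" "x < y" "y < 2 * pi - x"
  shows "cos y < cos x"
proof (cases "y \<le> pi")
  case True then show ?thesis using assms by (intro cos_monotone_0_pi) auto
next
  case False
  have "cos (2 * pi - y) < cos x" using assms False by (intro cos_monotone_0_pi) auto
  then show ?thesis by (simp add: cos_diff)
qed

lemma convex_order_regular:
  assumes "0 < \<delta>" "real n * \<delta> \<le> 2 * pi"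
  shows "convex_order {1..n} (\<lambda>i. real i * \<delta>)"
  unfolding convex_order_def
proof (intro ballI impI conjI)
  fix i j assume ij: "i \<in> {1..n}" "j \<in> {1..n}" "i < j"
  show "real i * \<delta> < real j * \<delta>" using ij assms by simp
  have "real j * \<delta> \<le> real n * \<delta>" using ij assms by (intro mult_right_mono) auto
  moreover have "real i * \<delta> > 0" using ij assms by simp
  ultimately show "real j * \<delta> < real i * \<delta> + 2 * pi" using assms by linarith
qed

lemma book_cut:
  fixes n :: nat
  assumes n: "n \<ge> 14"
    and raised: "\<And>e. e \<in> left_edges \<union> right_edges \<Longrightarrow> h e \<noteq> 0"
    and flat: "h (7, 9) = 0" "h (14, 2) = 0" "h (7, 2) = 0" "h (14, 9) = 0"
  defines "\<theta> \<equiv> \<lambda>i. real i * (2 * pi / real n)"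
  assumes K: "ambient_isotopic K (book \<theta> h (left_edges \<union> right_edges \<union> {(7, 9), (14, 2)}))"
    and K1: "ambient_isotopic (book \<theta> h (left_edges \<union> {(7, 2)})) K1"
    and K2: "ambient_isotopic (book \<theta> h (right_edges \<union> {(14, 9)})) K2"
  shows "isotopic_to_connected_sum K K1 K2"
proof -
  define \<delta> where "\<delta> = 2 * pi / real n"
  have \<delta>: "\<delta> > 0" "14 * \<delta> \<le> 2 * pi" using n by (auto simp: \<delta>_def field_simps)
  have \<theta>: "\<theta> i = real i * \<delta>" for i by (simp add: \<theta>_def \<delta>_def)
  have ord: "convex_order {1..14} \<theta>"
    using convex_order_regular[of \<delta> 14] \<delta> by (simp add: \<theta>[abs_def])
  let ?v = "\<lambda>i. cpt (\<theta> i)"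
  have o: "orient (?v i) (?v j) (?v k) > 0" if "1 \<le> i" "i < j" "j < k" "k \<le> 14" for i j k
    using convex_order_pos[OF ord] that by auto
  \<comment> \<open>Vertex 11 is the middle of 8, ..., 14, and 7/2 lies between 3 and 4 steps:
    \<open>m\<close> is positive at the vertices at most three steps from 11 and negative at 1, ...,
    7.\<close>
  define m where "m p = cos (11 * \<delta>) * fst p + sin (11 * \<delta>) * snd p - cos (7 / 2 * \<delta>)" for p
  define l where "l x = cos (11 * \<delta>) * fst x + sin (11 * \<delta>) * fst (snd x) - cos (7 / 2 * \<delta>)" for x :: R3
  have lm: "l x = m (pr x)" for x by (simp add: l_def m_def pr_def)
  have maff: "m ((1 - u) *\<^sub>R p + u *\<^sub>R q) = (1 - u) * m p + u * m q" for u p q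
    by (simp add: m_def algebra_simps)
  have mv: "m (?v i) = cos (11 * \<delta> - real i * \<delta>) - cos (7 / 2 * \<delta>)" for i
    by (simp add: m_def cpt_def \<theta> cos_diff)
  have neg: "m (?v i) < 0" if "1 \<le> i" "i \<le> 7" for i
  proof -
    have "real i * \<delta> \<le> 7 * \<delta>" "1 * \<delta> \<le> real i * \<delta>" using that \<delta> by (intro mult_right_mono; simp)+
    then have "cos (11 * \<delta> - real i * \<delta>) < cos (7 / 2 * \<delta>)" using \<delta> by (intro cos_less_cos) linarith+
    then show ?thesis by (simp add: mv)
  qed
  have pos: "m (?v i) > 0" if "8 \<le> i" "i \<le> 14" for i
  proof -
    have "real i * \<delta> \<le> 14 * \<delta>" "8 * \<delta> \<le> real i * \<delta>" using that \<delta> by (intro mult_right_mono; simp)+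
    then have "cos (7 / 2 * \<delta>) < cos \<bar>11 * \<delta> - real i * \<delta>\<bar>" using \<delta> by (intro cos_less_cos) linarith+
    then show ?thesis by (simp add: mv)
  qed
  have arc_side: "m a < 0 \<Longrightarrow> m b < 0 \<Longrightarrow> x \<in> lift k ` closed_segment a b \<Longrightarrow> l x < 0"
    "m a > 0 \<Longrightarrow> m b > 0 \<Longrightarrow> x \<in> lift k ` closed_segment a b \<Longrightarrow> l x > 0" for a b x k
  proof -
    assume x: "x \<in> lift k ` closed_segment a b"
    then obtain u where u: "0 \<le> u" "u \<le> 1" "pr x = (1 - u) *\<^sub>R a + u *\<^sub>R b" by (auto simp: closed_segment_def)
    { assume "m a < 0" "m b < 0"
      then have "(1 - u) * m a + u * m b < 0" using u by (intro convex_bound_lt) auto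
      then show "l x < 0" by (simp add: lm u maff) }
    { assume "m a > 0" "m b > 0"
      then have "(1 - u) * (- m a) + u * (- m b) < 0" using u by (intro convex_bound_lt) auto
      then show "l x > 0" by (simp add: lm u maff) }
  qed
  define L where "L = book \<theta> h left_edges"
  define R where "R = book \<theta> h right_edges"
  have Ls: "l x < 0" if "x \<in> L" for x
  proof -
    obtain a b where ab: "(a, b) \<in> left_edges" "x \<in> lift (h (a, b)) ` closed_segment (?v a) (?v b)"
      using \<open>x \<in> L\<close> unfolding L_def book_def by blast
    then have "1 \<le> a" "a \<le> 7" "1 \<le> b" "b \<le> 7" by (auto simp: left_edges_def)
    then show ?thesis using arc_side(1)[OF neg neg ab(2)] by simp
  qed
  have Rs: "l x > 0" if "x \<in> R" for x
  proof -
    obtain a b where ab: "(a, b) \<in> right_edges" "x \<in> lift (h (a, b)) ` closed_segment (?v a) (?v b)"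
      using \<open>x \<in> R\<close> unfolding R_def book_def by blast
    then have "8 \<le> a" "a \<le> 14" "8 \<le> b" "b \<le> 14" by (auto simp: right_edges_def)
    then show ?thesis using arc_side(2)[OF pos pos ab(2)] by simp
  qed
  let ?e = "\<lambda>p. emb p 0"
  have laff: "l ((1 - u) *\<^sub>R x + u *\<^sub>R y) = (1 - u) * l x + u * l y" for u x y
    by (simp add: l_def algebra_simps)
  have le: "l (?e p) = m p" for p by (simp add: lm)
  have ecomb: "(1 - u) *\<^sub>R ?e p + u *\<^sub>R ?e q = ?e ((1 - u) *\<^sub>R p + u *\<^sub>R q)" for u p q by (simp add: emb_def)
  obtain \<nu> p where p: "0 < \<nu>" "\<nu> < 1" "p = (1 - \<nu>) *\<^sub>R ?e (?v 7) + \<nu> *\<^sub>R ?e (?v 9)" "l p = 0"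
    "closed_segment (?e (?v 7)) (?e (?v 9)) \<inter> {x. l x \<le> 0} = closed_segment (?e (?v 7)) p"
    "closed_segment (?e (?v 7)) (?e (?v 9)) \<inter> {x. l x \<ge> 0} = closed_segment p (?e (?v 9))"
    "closed_segment (?e (?v 7)) (?e (?v 9)) \<inter> {x. l x = 0} = {p}"
    by (rule segment_cut[of l "?e (?v 7)" "?e (?v 9)", OF laff]) (use neg[of 7] pos[of 9] in \<open>auto simp: le\<close>)
  obtain \<mu>' q where q: "0 < \<mu>'" "\<mu>' < 1" "q = (1 - \<mu>') *\<^sub>R ?e (?v 2) + \<mu>' *\<^sub>R ?e (?v 14)" "l q = 0"
    "closed_segment (?e (?v 2)) (?e (?v 14)) \<inter> {x. l x \<le> 0} = closed_segment (?e (?v 2)) q"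
    "closed_segment (?e (?v 2)) (?e (?v 14)) \<inter> {x. l x \<ge> 0} = closed_segment q (?e (?v 14))"
    "closed_segment (?e (?v 2)) (?e (?v 14)) \<inter> {x. l x = 0} = {q}"
    by (rule segment_cut[of l "?e (?v 2)" "?e (?v 14)", OF laff]) (use neg[of 2] pos[of 14] in \<open>auto simp: le\<close>)
  \<comment> \<open>The edge was cut as running from 2 to 14, because \<open>segment_cut\<close>
    wants the negative end first; this turns the parameter round to the direction from 14 to
    2.\<close>
  define \<mu> where "\<mu> = 1 - \<mu>'"
  have \<mu>: "0 < \<mu>" "\<mu> < 1" using q by (auto simp: \<mu>_def)
  define P where "P = (1 - \<nu>) *\<^sub>R ?v 7 + \<nu> *\<^sub>R ?v 9"
  define Q where "Q = (1 - \<mu>) *\<^sub>R ?v 14 + \<mu> *\<^sub>R ?v 2"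
  have pP: "p = ?e P" unfolding P_def p(3) ecomb ..
  have qQ: "q = ?e Q" unfolding Q_def q(3) ecomb \<mu>_def by (simp add: add.commute)
  have mPQ: "m P = 0" "m Q = 0" using p(4) q(4) by (auto simp: pP qQ le)
  have vPQ: "?v i \<noteq> P \<and> ?v i \<noteq> Q" if "i \<in> {1..14}" for i
    using neg[of i] pos[of i] mPQ that by (cases "i \<le> 7") auto
  have nrm: "norm P \<le> 1" "norm Q \<le> 1"
    unfolding P_def Q_def using p(1,2) \<mu>
    by (intro order_trans[OF norm_triangle_ineq]; simp)+
  have E: "book \<theta> h (left_edges \<union> right_edges \<union> {(7, 9), (14, 2)}) =
      L \<union> R \<union> closed_segment (?e (?v 7)) (?e (?v 9)) \<union> closed_segment (?e (?v 2)) (?e (?v 14))"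
    unfolding book_Un L_def R_def using flat
    by (simp add: book_insert flat_arc closed_segment_commute[of "?e (?v 2)"] Un_assoc)
  let ?K = "L \<union> R \<union> closed_segment (?e (?v 7)) (?e (?v 9)) \<union> closed_segment (?e (?v 2)) (?e (?v 14))"
  have oP: "orient x y P = (1 - \<nu>) * orient x y (?v 7) + \<nu> * orient x y (?v 9)" for x y
    unfolding P_def by (rule orient_segment)
  have oQ: "orient x y Q = (1 - \<mu>) * orient x y (?v 14) + \<mu> * orient x y (?v 2)" for x y
    unfolding Q_def by (rule orient_segment)
  have o': "orient (?v j) (?v k) (?v i) > 0" "orient (?v k) (?v i) (?v j) > 0" if "1 \<le> i" "i < j" "j < k" "k \<le> 14" for i j k
    using o[OF that] by (metis orient_rotate)+
  have pos2: "0 < (1 - u) * x + u * y" if "0 < u" "u < 1" "x > 0" "y > 0" for u x y :: real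
    using that by (simp add: add_pos_pos)
  have o79Q: "orient (?v 7) (?v 9) Q > 0" unfolding oQ using \<mu> by (intro pos2 o o') auto
  have o142P: "orient (?v 14) (?v 2) P > 0" unfolding oP using p by (intro pos2 o o') auto
  have o27Q: "orient (?v 2) (?v 7) Q > 0" unfolding oQ using \<mu> o[of 2 7 14] by simp
  have o914P: "orient (?v 9) (?v 14) P > 0" unfolding oP using p o'[of 7 9 14] by simp
  have o2PQ: "orient (?v 2) P Q > 0"
    unfolding oQ using \<mu> o142P by (simp add: orient_rotate[of "?v 2" P "?v 14"])
  have o9QP: "orient (?v 9) Q P > 0"
    unfolding oP using p o79Q by (simp add: orient_rotate[of "?v 9" Q "?v 7"])
  have o7PQ: "orient (?v 7) P Q > 0"
  proof -
    have "orient Q (?v 7) P > 0" unfolding oP using p o79Q by (simp add: orient_rotate[of "?v 7" "?v 9" Q])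
    then show ?thesis by (simp add: orient_rotate)
  qed
  have o14QP: "orient (?v 14) Q P > 0"
  proof -
    have "orient P (?v 14) Q > 0" unfolding oQ using \<mu> o142P by (simp add: orient_rotate[of "?v 14" "?v 2" P])
    then show ?thesis by (simp add: orient_rotate)
  qed
  show ?thesis
  proof (rule connected_sum_cutI[where \<alpha> = "11 * \<delta>" and d = "cos (7 / 2 * \<delta>)", OF K, of "?e P" "?e Q"], unfold l_def[symmetric] E)
    show "?e P \<noteq> ?e Q"
    proof
      assume "?e P = ?e Q"
      then have "P = Q" by (simp add: emb_def prod_eq_iff)
      then show False using o7PQ by simp
    qed
    show "?K \<inter> {x. l x = 0} = {?e P, ?e Q}"
      using Ls Rs p(7) q(7) unfolding pP qQ by (fastforce simp: Int_Un_distrib2)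
    have cl: "?K \<inter> {x. l x \<le> 0}
       = L \<union> closed_segment (?e (?v 7)) (?e P) \<union> closed_segment (?e Q) (?e (?v 2))"
    proof -
      have "L \<inter> {x. l x \<le> 0} = L" "R \<inter> {x. l x \<le> 0} = {}" using Ls Rs by force+
      then show ?thesis using p(5) q(5) unfolding pP qQ Int_Un_distrib2 by (simp add: closed_segment_commute)
    qed
    have "ambient_isotopic (L \<union> closed_segment (?e (?v 7)) (?e P) \<union> closed_segment (?e Q) (?e (?v 2)) \<union> closed_segment (?e P) (?e Q))
        (L \<union> closed_segment (?e (?v 7)) (?e (?v 2)))"
      unfolding L_def
    \<comment> \<open>The raised edges at the two loose ends 7 and 2 are \<open>(5, 7)\<close> and
      \<open>(2, 4)\<close>.\<close>
    proof (rule book_close_up[OF ord, where a' = 5 and b' = 4])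
      show "h (r, s) \<noteq> 0 \<and> (r \<notin> {7, 2} \<and> s \<notin> {7, 2} \<or> r = 5 \<and> s = 7 \<or> r = 2 \<and> s = 4)" if "(r, s) \<in> left_edges" for r s
        using raised[of "(r, s)"] that by (auto simp: left_edges_def)
      show "orient (?v 5) (?v 7) P > 0" unfolding oP using p o[of 5 7 9] by simp
      show "orient (?v 5) (?v 7) Q > 0" unfolding oQ using \<mu> by (intro pos2 o o') auto
      show "orient (?v 2) (?v 4) Q > 0" unfolding oQ using \<mu> o[of 2 4 14] by simp
      show "orient Q (?v 2) (?v 7) > 0" using o27Q by (simp add: orient_rotate)
      show "orient Q (?v 2) P > 0" using o2PQ by (simp add: orient_rotate)
    qed (use nrm vPQ o o' o7PQ in \<open>auto simp: left_edges_def\<close>)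
    also have "L \<union> closed_segment (?e (?v 7)) (?e (?v 2)) = book \<theta> h (left_edges \<union> {(7, 2)})"
      unfolding L_def book_Un using flat by (simp add: book_flat)
    also note K1
    finally show "ambient_isotopic (?K \<inter> {x. l x \<le> 0} \<union> closed_segment (?e P) (?e Q)) K1"
      unfolding cl .
    have cr: "?K \<inter> {x. l x \<ge> 0}
       = R \<union> closed_segment (?e (?v 14)) (?e Q) \<union> closed_segment (?e P) (?e (?v 9))"
    proof -
      have "R \<inter> {x. l x \<ge> 0} = R" "L \<inter> {x. l x \<ge> 0} = {}" using Ls Rs by force+
      then show ?thesis using p(6) q(6) unfolding pP qQ Int_Un_distrib2 by (simp add: closed_segment_commute Un_ac)
    qed
    have "ambient_isotopic (R \<union> closed_segment (?e (?v 14)) (?e Q) \<union> closed_segment (?e P) (?e (?v 9)) \<union> closed_segment (?e Q) (?e P))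
        (R \<union> closed_segment (?e (?v 14)) (?e (?v 9)))"
      unfolding R_def
    \<comment> \<open>The right half closes up from 14 to 9, so the two cut points exchange their
      roles.\<close>
    proof (rule book_close_up[OF ord, where a' = 12 and b' = 11])
      show "h (r, s) \<noteq> 0 \<and> (r \<notin> {14, 9} \<and> s \<notin> {14, 9} \<or> r = 12 \<and> s = 14 \<or> r = 9 \<and> s = 11)" if "(r, s) \<in> right_edges" for r s
        using raised[of "(r, s)"] that by (auto simp: right_edges_def)
      show "orient (?v 12) (?v 14) Q > 0" unfolding oQ using \<mu> o'[of 2 12 14] by simp
      show "orient (?v 12) (?v 14) P > 0" unfolding oP using p by (intro pos2 o o') auto
      show "orient (?v 9) (?v 11) P > 0" unfolding oP using p o'[of 7 9 11] by simp
      show "orient P (?v 9) (?v 14) > 0" using o914P by (simp add: orient_rotate)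
      show "orient P (?v 9) Q > 0" using o9QP by (simp add: orient_rotate)
    qed (use nrm vPQ o o' o14QP in \<open>auto simp: right_edges_def\<close>)
    also have "R \<union> closed_segment (?e (?v 14)) (?e (?v 9)) = book \<theta> h (right_edges \<union> {(14, 9)})"
      unfolding R_def book_Un using flat by (simp add: book_flat)
    also note K2
    finally show "ambient_isotopic (?K \<inter> {x. l x \<ge> 0} \<union> closed_segment (?e P) (?e Q)) K2"
      unfolding cr closed_segment_commute[of "?e P" "?e Q"] .
  qed
qed

section \<open>Star heptagons\<close>

text \<open>The wanted vertical displacement over \<open>C\<close> and the displacement 0 over the
  shadow of \<open>A\<close> agree where both apply. Tietze extends them to the plane, and the
  resulting shear fixes \<open>A\<close>.\<close>

lemma ambient_isotopic_graph_change:
  fixes \<zeta>1 \<zeta>2 :: "real \<times> real \<Rightarrow> real"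
  assumes A: "compact A" and C: "compact C"
    and \<zeta>: "continuous_on C \<zeta>1" "continuous_on C \<zeta>2"
    and eq: "\<And>p. p \<in> C \<Longrightarrow> p \<in> pr ` A \<Longrightarrow> \<zeta>1 p = \<zeta>2 p"
  shows "ambient_isotopic (A \<union> (\<lambda>p. emb p (\<zeta>1 p)) ` C) (A \<union> (\<lambda>p. emb p (\<zeta>2 p)) ` C)"
proof -
  have prA: "compact (pr ` A)"
    by (intro compact_continuous_image A) (auto intro!: continuous_intros)
  have cl: "closed (pr ` A)" "closed C" using prA C compact_imp_closed by auto
  define g where "g p = (if p \<in> C then \<zeta>2 p - \<zeta>1 p else 0)" for p
  have "continuous_on (C \<union> pr ` A) g"
    unfolding g_def using eq by (intro continuous_on_cases cl continuous_intros \<zeta>) auto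
  then obtain G where G: "continuous_on UNIV G" "\<And>p. p \<in> C \<union> pr ` A \<Longrightarrow> G p = g p"
    using Tietze_unbounded[of "C \<union> pr ` A" g UNIV] cl by (auto simp: closed_Un)
  let ?S = "\<lambda>(x, y, z). (x, y, z + G (x, y))"
  have 1: "?S x = x" if "x \<in> A" for x
  proof -
    have "G (pr x) = 0" using G(2)[of "pr x"] eq[of "pr x"] that by (auto simp: g_def)
    then show ?thesis by (cases x) (simp add: pr_def)
  qed
  have 2: "?S (emb p (\<zeta>1 p)) = emb p (\<zeta>2 p)" if "p \<in> C" for p
    using G(2)[of p] that by (simp add: g_def emb_def)
  have "?S ` A = (\<lambda>x. x) ` A" by (intro image_cong refl 1)
  moreover have "?S ` (\<lambda>p. emb p (\<zeta>1 p)) ` C = (\<lambda>p. emb p (\<zeta>2 p)) ` C"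
    unfolding image_image by (intro image_cong refl 2)
  ultimately have "?S ` (A \<union> (\<lambda>p. emb p (\<zeta>1 p)) ` C) = A \<union> (\<lambda>p. emb p (\<zeta>2 p)) ` C"
    by (simp only: image_Un image_ident)
  then show ?thesis using ambient_isotopic_shear[OF G(1), of "A \<union> (\<lambda>p. emb p (\<zeta>1 p)) ` C"] by simp
qed

lemma rot_cpt: "rot \<alpha> (cpt x) = cpt (x + \<alpha>)"
  by (simp add: rot_def cpt_def cos_add sin_add algebra_simps)

lemma book_rotate: "ambient_isotopic (book \<theta> h E) (book (\<lambda>i. \<theta> i + \<alpha>) h E)"
proof -
  let ?R = "\<lambda>(x, y, z). (fst (rot \<alpha> (x, y)), snd (rot \<alpha> (x, y)), z) :: R3"
  have n: "(fst (rot \<alpha> p))\<^sup>2 + (snd (rot \<alpha> p))\<^sup>2 = (fst p)\<^sup>2 + (snd p)\<^sup>2" for p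
  proof -
    have "(fst (rot \<alpha> p))\<^sup>2 + (snd (rot \<alpha> p))\<^sup>2 = ((sin \<alpha>)\<^sup>2 + (cos \<alpha>)\<^sup>2) * ((fst p)\<^sup>2 + (snd p)\<^sup>2)"
      unfolding rot_def fst_conv snd_conv by algebra
    then show ?thesis by simp
  qed
  have R: "?R (lift k p) = lift k (rot \<alpha> p)" for k p
    using n[of p] by (simp add: lift_def diff_diff_eq)
  have rs: "rot \<alpha> ((1 - u) *\<^sub>R p + u *\<^sub>R q) = (1 - u) *\<^sub>R rot \<alpha> p + u *\<^sub>R rot \<alpha> q" for u p q
    by (simp add: rot_def algebra_simps)
  have arc: "?R ` lift k ` closed_segment (cpt a) (cpt b) = lift k ` closed_segment (cpt (a + \<alpha>)) (cpt (b + \<alpha>))" for k a b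
    unfolding closed_segment_image_interval image_image R rs rot_cpt ..
  have "?R ` book \<theta> h E = book (\<lambda>i. \<theta> i + \<alpha>) h E"
    unfolding book_def image_UN case_prod_beta arc[unfolded case_prod_beta] ..
  then show ?thesis using ambient_isotopic_rot[of "book \<theta> h E" \<alpha>] by simp
qed

lemma book_reindex: "book \<theta> h ((\<lambda>(a, b). (\<sigma> a, \<sigma> b)) ` E) = book (\<theta> \<circ> \<sigma>) (\<lambda>(a, b). h (\<sigma> a, \<sigma> b)) E"
  unfolding book_def by (auto simp: case_prod_unfold)

lemma book_cong_angle:
  assumes "\<And>a b. (a, b) \<in> E \<Longrightarrow> cpt (\<theta> a) = cpt (\<theta>' a) \<and> cpt (\<theta> b) = cpt (\<theta>' b) \<and> h (a, b) = h' (a, b)"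
  shows "book \<theta> h E = book \<theta>' h' E"
  unfolding book_def using assms by (intro SUP_cong refl) auto

definition star_edges :: "(nat \<times> nat) set" where
  "star_edges = {(1, 3), (2, 4), (3, 5), (4, 6), (5, 7), (6, 1), (7, 2)}"

text \<open>\<open>k i\<close> is the height of the edge leaving vertex \<open>i\<close> of the star heptagon; this edge crosses
  exactly the edges leaving \<open>next7 i\<close> and the vertex before \<open>i\<close>.\<close>

definition next7 :: "nat \<Rightarrow> nat" where
  "next7 i = (if i = 7 then 1 else i + 1)"

definition star :: "real \<Rightarrow> (nat \<Rightarrow> real) \<Rightarrow> R3 set" where
  "star \<delta> k = book (\<lambda>i. real i * \<delta>) (\<lambda>e. k (fst e)) star_edges"

lemma next7_simps [simp]:
  "next7 1 = 2" "next7 (Suc 0) = 2" "next7 2 = 3" "next7 3 = 4" "next7 4 = 5" "next7 5 = 6" "next7 6 = 7" "next7 7 = 1"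
  by (simp_all add: next7_def)

text \<open>Crossing \<open>i\<close> is the one between the edges leaving \<open>i\<close> and
  \<open>next7 i\<close>; \<open>S\<close> collects those where the former passes
  underneath.\<close>

definition crossing_signs :: "(nat \<Rightarrow> real) \<Rightarrow> nat set \<Rightarrow> bool" where
  "crossing_signs k S \<longleftrightarrow> (\<forall>i\<in>{1, 2, 3, 4, 5, 6, 7}. if i \<in> S then k i < k (next7 i) else k (next7 i) < k i)"

lemma star_cong:
  assumes "\<And>i. i \<in> {1, 2, 3, 4, 5, 6, 7} \<Longrightarrow> k i = k' i"
  shows "star \<delta> k = star \<delta> k'"
  unfolding star_def
proof (rule book_cong)
  fix e assume "e \<in> star_edges"
  then have "fst e \<in> {1, 2, 3, 4, 5, 6, 7}" unfolding star_edges_def by (elim insertE emptyE) simp_all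
  then show "k (fst e) = k' (fst e)" by (rule assms)
qed

text \<open>The seven crossings are exactly those recorded by \<open>S\<close>, so the height orders
  agree and \<open>book_isotopic\<close> applies. Two step angles are allowed so that seven vertices
  crowded on part of the circle can be spread to a regular heptagon.\<close>

lemma star_isotopic:
  assumes \<delta>: "0 < \<delta>" "\<delta> \<le> 2 * pi / 7" "0 < \<delta>'" "\<delta>' \<le> 2 * pi / 7"
    and k: "crossing_signs k S" "crossing_signs k' S"
  shows "ambient_isotopic (star \<delta> k) (star \<delta>' k')"
proof -
  have s: "k i < k (next7 i) \<and> k' i < k' (next7 i) \<or> k (next7 i) < k i \<and> k' (next7 i) < k' i"
    if "i \<in> {1, 2, 3, 4, 5, 6, 7}" for i
    using k that unfolding crossing_signs_def by (metis (full_types))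
  have s': "k 1 < k 2 \<and> k' 1 < k' 2 \<or> k 2 < k 1 \<and> k' 2 < k' 1" "k 2 < k 3 \<and> k' 2 < k' 3 \<or> k 3 < k 2 \<and> k' 3 < k' 2"
    "k 3 < k 4 \<and> k' 3 < k' 4 \<or> k 4 < k 3 \<and> k' 4 < k' 3" "k 4 < k 5 \<and> k' 4 < k' 5 \<or> k 5 < k 4 \<and> k' 5 < k' 4"
    "k 5 < k 6 \<and> k' 5 < k' 6 \<or> k 6 < k 5 \<and> k' 6 < k' 5" "k 6 < k 7 \<and> k' 6 < k' 7 \<or> k 7 < k 6 \<and> k' 7 < k' 6"
    "k 7 < k 1 \<and> k' 7 < k' 1 \<or> k 1 < k 7 \<and> k' 1 < k' 7"
    using s[of 1] s[of 2] s[of 3] s[of 4] s[of 5] s[of 6] s[of 7] by auto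
  have o: "convex_order {1..7} (\<lambda>i. real i * d)" if "0 < d" "d \<le> 2 * pi / 7" for d
    using convex_order_regular[of d 7] that by simp
  show ?thesis unfolding star_def book_def
  proof (rule book_isotopic[OF finite_atLeastAtMost _ o[OF \<delta>(1,2)] o[OF \<delta>(3,4)]])
    show "star_edges \<subseteq> {1..7} \<times> {1..7}" by (simp add: star_edges_def)
    fix a b c d assume "(a, b) \<in> star_edges" "(c, d) \<in> star_edges" "(a, b) \<noteq> (c, d)"
    then show "b = c \<and> a \<noteq> d \<or> d = a \<and> c \<noteq> b \<or>
       c \<noteq> a \<and> c \<noteq> b \<and> d \<noteq> a \<and> d \<noteq> b \<and>
         (separated a b c d \<or> k (fst (a, b)) < k (fst (c, d)) \<and> k' (fst (a, b)) < k' (fst (c, d)) \<or>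
          k (fst (c, d)) < k (fst (a, b)) \<and> k' (fst (c, d)) < k' (fst (a, b)))"
      unfolding star_edges_def using s' by (elim insertE emptyE) (simp_all add: separated_def, blast+)
  qed (auto simp: star_edges_def)
qed

lemma cpt_periodic: "cpt (x + 2 * pi) = cpt x"
  by (simp add: cpt_def)

text \<open>Turning the regular heptagon back by one step and renaming the vertices reproduces the
  same edges with shifted heights.\<close>

lemma star_rotate: "ambient_isotopic (star (2 * pi / 7) k) (star (2 * pi / 7) (k \<circ> next7))"
proof -
  let ?\<delta> = "2 * pi / 7"
  let ?\<theta> = "\<lambda>i. real i * ?\<delta>"
  have im: "(\<lambda>(a, b). (next7 a, next7 b)) ` star_edges = star_edges"
    by (auto simp: star_edges_def)
  have "ambient_isotopic (star ?\<delta> k) (book (\<lambda>i. ?\<theta> i + (- ?\<delta>)) (\<lambda>e. k (fst e)) star_edges)"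
    unfolding star_def by (rule book_rotate)
  also have "\<dots> = book ((\<lambda>i. ?\<theta> i + (- ?\<delta>)) \<circ> next7) (\<lambda>(a, b). k (fst (next7 a, next7 b))) star_edges"
    using book_reindex[of "\<lambda>i. ?\<theta> i + (- ?\<delta>)" "\<lambda>e. k (fst e)" next7 star_edges] unfolding im .
  also have "\<dots> = star ?\<delta> (k \<circ> next7)"
    unfolding star_def
  proof (rule book_cong_angle)
    fix a b assume ab: "(a, b) \<in> star_edges"
    have *: "cpt (((\<lambda>i. ?\<theta> i + (- ?\<delta>)) \<circ> next7) i) = cpt (?\<theta> i)" for i
    proof (cases "i = 7")
      \<comment> \<open>\<open>next7\<close> sends 7 to 1, which turns to angle 0, whereas vertex 7
        has angle \<open>2 * pi\<close>: the same point of the circle.\<close>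
      case True
      then have "((\<lambda>i. ?\<theta> i + (- ?\<delta>)) \<circ> next7) i = 0" "?\<theta> i = 0 + 2 * pi" by simp_all
      then show ?thesis using cpt_periodic[of 0] by simp
    next
      case False
      then have "((\<lambda>i. ?\<theta> i + (- ?\<delta>)) \<circ> next7) i = ?\<theta> i" by (simp add: next7_def algebra_simps)
      then show ?thesis by (simp only:)
    qed
    then show "cpt (((\<lambda>i. ?\<theta> i + (- ?\<delta>)) \<circ> next7) a) = cpt (?\<theta> a) \<and>
      cpt (((\<lambda>i. ?\<theta> i + (- ?\<delta>)) \<circ> next7) b) = cpt (?\<theta> b) \<and>
      (case (a, b) of (a, b) \<Rightarrow> k (fst (next7 a, next7 b))) = (k \<circ> next7) (fst (a, b))" by simp
  qed
  finally show ?thesis .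
qed

section \<open>Lifting the edge {7,2} past the edges at vertex 1\<close>

text \<open>All sheets are multiples of the same paraboloid, so this map raises every sheet height
  by \<open>c\<close>.\<close>

definition shear :: "real \<Rightarrow> R3 \<Rightarrow> R3" where
  "shear c = (\<lambda>(x, y, z). (x, y, z + c * (1 - x\<^sup>2 - y\<^sup>2)))"

lemma ambient_isotopic_paraboloid: "ambient_isotopic K (shear c ` K)"
proof -
  have "continuous_on UNIV (\<lambda>p :: real \<times> real. c * (1 - (fst p)\<^sup>2 - (snd p)\<^sup>2))"
    by (intro continuous_intros)
  from ambient_isotopic_shear[OF this, of K] show ?thesis by (simp add: shear_def)
qed

lemma shear_lift: "shear c ` lift h ` S = lift (h + c) ` S"
  unfolding image_image by (simp add: shear_def lift_def algebra_simps)

lemma shear_book: "shear c ` book \<theta> h E = book \<theta> (\<lambda>e. h e + c) E"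
  unfolding book_def image_UN by (intro SUP_cong refl) (simp add: case_prod_unfold shear_lift)

lemma inner_cpt: "cpt x \<bullet> cpt y = cos (x - y)"
  by (simp add: cpt_def cos_diff)

lemma norm_chord_le: "p \<in> closed_segment (cpt x) (cpt y) \<Longrightarrow> norm p \<le> 1"
  using closed_segment_subset[of "cpt x" "cball 0 1" "cpt y"] by auto

lemma norm_le_1_iff: "norm p \<le> 1 \<longleftrightarrow> (fst p)\<^sup>2 + (snd p)\<^sup>2 \<le> 1" for p :: "real \<times> real"
  by (simp add: norm_prod_def)


text \<open>The base \<open>{7, 2}\<close>, which crosses the two edges at vertex \<open>1\<close>, is swept to a path through a point \<open>w\<close>
  beyond vertex \<open>1\<close>. The function \<open>l\<close> vanishes on the line of the base, so the swept triangle lies in the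
  tilted plane \<open>z = - \<epsilon> l\<close>, on the other side of \<open>z = 0\<close> than the two edges.\<close>

lemma star_lower_chain:
  fixes k :: "nat \<Rightarrow> real" and \<epsilon> :: real
  assumes k: "k 7 = 0" "\<epsilon> * k 1 > 0" "\<epsilon> * k 6 > 0" and \<epsilon>: "\<epsilon> \<noteq> 0"
  defines "\<beta> \<equiv> 2 * pi / 7"
  defines "w \<equiv> 2 *\<^sub>R cpt \<beta>" and "l \<equiv> \<lambda>p. cpt \<beta> \<bullet> p - cos \<beta>"
  defines "C \<equiv> closed_segment (cpt (7 * \<beta>)) w \<union> closed_segment w (cpt (2 * \<beta>))"
  shows "ambient_isotopic (star \<beta> k)
    (book (\<lambda>i. real i * \<beta>) (\<lambda>e. k (fst e)) left_edges \<union> (\<lambda>p. emb p (- \<epsilon> * l p)) ` C)"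
proof -
  let ?v = "\<lambda>i :: nat. cpt (real i * \<beta>)"
  let ?A = "book (\<lambda>i. real i * \<beta>) (\<lambda>e. k (fst e)) left_edges"
  let ?z = "\<lambda>p. emb p (- \<epsilon> * l p)"
  let ?c = "?z w"
  have \<beta>: "0 < \<beta>" "7 * \<beta> = 2 * pi" "\<beta> < pi / 2" by (auto simp: \<beta>_def)
  have cb: "0 < cos \<beta>" "cos \<beta> < 1" "0 < sin \<beta>"
    using \<beta> cos_less_cos[of 0 \<beta>] by (auto intro!: cos_gt_zero sin_gt_zero)
  have v7: "?v 7 = cpt (7 * \<beta>)" and v2: "?v 2 = cpt (2 * \<beta>)" by simp_all
  have lv: "l (?v i) = cos (real i * \<beta> - \<beta>) - cos \<beta>" for i
    unfolding l_def inner_cpt by (metis cos_minus minus_diff_eq)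
  have laff: "l ((1 - u) *\<^sub>R p + u *\<^sub>R q) = (1 - u) * l p + u * l q" for u p q
    by (simp add: l_def inner_add_right algebra_simps)
  have l7: "l (?v 7) = 0"
    using lv[of 7] cos_diff[of "2 * pi" \<beta>] \<beta>(2) by simp
  have l2: "l (?v 2) = 0" using lv[of 2] by simp
  have l1: "l (?v 1) > 0" using cb lv[of 1] by simp
  have lw: "l w > 0" using cb by (simp add: l_def w_def inner_cpt)
  have lneg: "l (?v i) < 0" if "3 \<le> i" "i \<le> 6" for i
  proof -
    have "real i * \<beta> \<le> 6 * \<beta>" "3 * \<beta> \<le> real i * \<beta>" using that \<beta> by (intro mult_right_mono; simp)+
    then have "cos (real i * \<beta> - \<beta>) < cos \<beta>" using \<beta> by (intro cos_less_cos) linarith+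
    then show ?thesis unfolding lv by simp
  qed
  have z7: "?z (?v 7) = emb (?v 7) 0" and z2: "?z (?v 2) = emb (?v 2) 0" unfolding l7 l2 by simp_all
  have zseg: "closed_segment (?z p) (?z q) = ?z ` closed_segment p q" for p q
  proof -
    have "(1 - u) *\<^sub>R ?z p + u *\<^sub>R ?z q = ?z ((1 - u) *\<^sub>R p + u *\<^sub>R q)" for u
      unfolding emb_def laff by (simp add: algebra_simps)
    then show ?thesis unfolding closed_segment_image_interval by (simp add: image_image)
  qed
  let ?T = "convex hull {emb (?v 7) 0, emb (?v 2) 0, ?c}"
  have T: "l (pr x) \<ge> 0 \<and> snd (snd x) = - \<epsilon> * l (pr x)" if x: "x \<in> ?T" for x
  proof -
    from x obtain u v t where uvt: "0 \<le> u" "0 \<le> v" "0 \<le> t" "u + v + t = 1"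
      "x = u *\<^sub>R emb (?v 7) 0 + v *\<^sub>R emb (?v 2) 0 + t *\<^sub>R ?c" unfolding convex_hull_3 by blast
    have px: "pr x = u *\<^sub>R ?v 7 + v *\<^sub>R ?v 2 + t *\<^sub>R w" and zx: "snd (snd x) = - \<epsilon> * (t * l w)"
      unfolding uvt(5) by (simp_all add: pr_def emb_def prod_eq_iff)
    have "l (pr x) = u * l (?v 7) + v * l (?v 2) + t * l w"
    proof -
      have "cos \<beta> = u * cos \<beta> + v * cos \<beta> + t * cos \<beta>" using uvt(4) by (simp flip: distrib_right)
      then show ?thesis unfolding px l_def by (simp add: inner_add_right right_diff_distrib)
    qed
    then have "l (pr x) = t * l w" unfolding l7 l2 by simp
    then show ?thesis using zx uvt lw by simp
  qed
  \<comment> \<open>On such an arc \<open>\<epsilon> * z\<close> is nonnegative, on the triangle it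
    is nonpositive. A common point therefore lies on the circle and on the line of the base; on the
    circle the arc has only its ends, and these are off that line.\<close>
  have raised: "clear_of (lift \<kappa> ` closed_segment (?v i) (?v j)) (emb (?v 7) 0) (emb (?v 2) 0) ?c"
    if "\<epsilon> * \<kappa> > 0" and off: "l (?v i) \<noteq> 0" "l (?v j) \<noteq> 0" for \<kappa> i j
  proof (rule clear_of_disjoint[OF compact_arc])
    have False if x: "x \<in> lift \<kappa> ` closed_segment (?v i) (?v j)" "x \<in> ?T" for x
    proof -
      obtain p where p: "p \<in> closed_segment (?v i) (?v j)" "x = lift \<kappa> p" using x by auto
      have lp: "l p \<ge> 0" "\<kappa> * (1 - (fst p)\<^sup>2 - (snd p)\<^sup>2) = - \<epsilon> * l p" 
        using T[OF x(2)] unfolding p(2) pr_lift by (simp_all add: lift_def)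
      then have e: "\<epsilon> * \<kappa> * (1 - (fst p)\<^sup>2 - (snd p)\<^sup>2) = - (\<epsilon> * \<epsilon> * l p)" by (simp add: mult.assoc)
      have "norm p \<le> 1" using norm_chord_le p by blast
      then have "0 \<le> 1 - (fst p)\<^sup>2 - (snd p)\<^sup>2" by (simp add: norm_le_1_iff)
      then have "0 \<le> \<epsilon> * \<kappa> * (1 - (fst p)\<^sup>2 - (snd p)\<^sup>2)" using \<open>\<epsilon> * \<kappa> > 0\<close> by simp
      moreover have "0 \<le> \<epsilon> * \<epsilon> * l p" using lp by simp
      ultimately have 0: "\<epsilon> * \<kappa> * (1 - (fst p)\<^sup>2 - (snd p)\<^sup>2) = 0" "\<epsilon> * \<epsilon> * l p = 0" using e by linarith+
      then have "norm p = 1" "l p = 0" using \<epsilon> \<open>\<epsilon> * \<kappa> > 0\<close> by (auto simp: norm_prod_eq_1)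
      then show False using chord_sphere[OF p(1)] off by auto
    qed
    then show "lift \<kappa> ` closed_segment (?v i) (?v j) \<inter> ?T = {}" by blast
  qed
  have inner: "clear_of (lift \<kappa> ` closed_segment (?v i) (?v j)) (emb (?v 7) 0) (emb (?v 2) 0) ?c"
    if "l (?v i) < 0" "l (?v j) < 0" for \<kappa> i j
  proof (rule clear_of_disjoint[OF compact_arc])
    have False if x: "x \<in> lift \<kappa> ` closed_segment (?v i) (?v j)" "x \<in> ?T" for x
    proof -
      obtain u where u: "0 \<le> u" "u \<le> 1" "pr x = (1 - u) *\<^sub>R ?v i + u *\<^sub>R ?v j" using x by (auto simp: closed_segment_def)
      have "(1 - u) * l (?v i) + u * l (?v j) < 0" using that u \<open>l (?v i) < 0\<close> \<open>l (?v j) < 0\<close> by (intro convex_bound_lt) auto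
      then show False using T[OF x(2)] u(3) by (simp add: laff)
    qed
    then show "lift \<kappa> ` closed_segment (?v i) (?v j) \<inter> ?T = {}" by blast
  qed
  text \<open>The edges at the ends of the base lie on the lines with outer normals \<open>v\<^sub>6\<close> and \<open>v\<^sub>3\<close>.\<close>
  have corner: "clear_of (lift \<kappa> ` closed_segment (?v i) (?v j)) (emb (?v i) 0) b c"
    if ij: "\<bar>real i - real m\<bar> = 1" "\<bar>real j - real m\<bar> = 1"
      and bc: "emb (?v m) 0 \<bullet> b < cos \<beta>" "emb (?v m) 0 \<bullet> c < cos \<beta>" for \<kappa> i j m b c
  proof (rule clear_of_halfspace[where n = "- emb (?v m) 0"])
    have e: "emb p 0 \<bullet> x = p \<bullet> pr x" for p x by (cases x) (simp add: emb_def pr_def inner_prod_def)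
    have vm: "?v m \<bullet> ?v r = cos \<beta>" if "\<bar>real r - real m\<bar> = 1" for r
    proof -
      have "\<bar>real m * \<beta> - real r * \<beta>\<bar> = \<bar>real r - real m\<bar> * \<beta>"
      proof -
        have "real m * \<beta> - real r * \<beta> = (real m - real r) * \<beta>" by (simp add: left_diff_distrib)
        then show ?thesis using \<beta>(1) by (simp add: abs_mult abs_minus_commute)
      qed
      then have "cos \<bar>real m * \<beta> - real r * \<beta>\<bar> = cos \<beta>" using that by simp
      then show ?thesis by (simp add: inner_cpt)
    qed
    show "- emb (?v m) 0 \<bullet> emb (?v i) 0 < - emb (?v m) 0 \<bullet> b" "- emb (?v m) 0 \<bullet> emb (?v i) 0 < - emb (?v m) 0 \<bullet> c"
      using bc vm[OF ij(1)] by (simp_all add: e[of _ "emb (?v i) 0"])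
    fix y assume "y \<in> lift \<kappa> ` closed_segment (?v i) (?v j)"
    then obtain u where u: "pr y = (1 - u) *\<^sub>R ?v i + u *\<^sub>R ?v j" by (auto simp: closed_segment_def)
    have "?v m \<bullet> pr y = cos \<beta>" unfolding u using vm[OF ij(1)] vm[OF ij(2)] by (simp add: inner_add_right algebra_simps)
    then show "- emb (?v m) 0 \<bullet> y \<le> - emb (?v m) 0 \<bullet> emb (?v i) 0"
      using vm[OF ij(1)] by (simp add: e)
  qed
  \<comment> \<open>As \<open>2 * \<beta>\<close> exceeds a right angle, the products of
    \<open>w\<close> with \<open>v 3\<close> and \<open>v 6\<close> are negative, which puts
    \<open>w\<close> on the inner side of both corner lines.\<close>
  have c4: "cos (2 * \<beta>) < cos \<beta>" "cos (4 * \<beta>) < cos \<beta>" "cos (2 * \<beta>) < 0"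
  proof -
    show "cos (2 * \<beta>) < cos \<beta>" "cos (4 * \<beta>) < cos \<beta>" using \<beta> by (intro cos_less_cos; simp)+
    have "cos (2 * \<beta>) < cos (pi / 2)" using \<beta> by (intro cos_less_cos) (simp_all add: \<beta>_def)
    then show "cos (2 * \<beta>) < 0" by simp
  qed
  have ze: "emb p 0 \<bullet> emb q z = p \<bullet> q" for p q z by (simp add: emb_def inner_prod_def)
  have wm: "emb (?v m) 0 \<bullet> ?c = 2 * cos (real m * \<beta> - \<beta>)" for m
    by (simp add: ze w_def inner_cpt)
  have c6: "cos (5 * \<beta>) = cos (2 * \<beta>)"
  proof -
    have "5 * \<beta> = 2 * pi - 2 * \<beta>" using \<beta>(2) by simp
    moreover have "cos (2 * pi - 2 * \<beta>) = cos (2 * \<beta>)" by (simp add: cos_diff)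
    ultimately show ?thesis by (simp only:)
  qed
  have A: "clear_of ?A (emb (?v 7) 0) (emb (?v 2) 0) ?c"
  proof (rule clear_of_book)
    show "finite left_edges" by (simp add: left_edges_def)
    fix r s assume "(r, s) \<in> left_edges"
    then consider "r = 1" "s = 3" | "r = 6" "s = 1" | "r = 3" "s = 5" | "r = 4" "s = 6" | "r = 5" "s = 7" | "r = 2" "s = 4"
      unfolding left_edges_def by blast
    then show "clear_of (lift (k (fst (r, s))) ` closed_segment (?v r) (?v s)) (emb (?v 7) 0) (emb (?v 2) 0) ?c"
    proof cases
      case 1
      then show ?thesis using raised[of "k 1" 1 3] k l1 lneg[of 3] by simp
    next
      case 2
      then show ?thesis using raised[of "k 6" 6 1] k l1 lneg[of 6] by simp
    next
      case 3
      then show ?thesis using inner[of 3 5] lneg[of 3] lneg[of 5] by simp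
    next
      case 4
      then show ?thesis using inner[of 4 6] lneg[of 4] lneg[of 6] by simp
    next
      case 5
      have "clear_of (lift (k 5) ` closed_segment (?v 7) (?v 5)) (emb (?v 7) 0) (emb (?v 2) 0) ?c"
      proof (rule corner[where m = 6])
        show "emb (?v 6) 0 \<bullet> emb (?v 2) 0 < cos \<beta>" using c4 by (simp add: ze inner_cpt)
        show "emb (?v 6) 0 \<bullet> ?c < cos \<beta>" using c4 cb c6 wm[of 6] by simp
      qed simp_all
      then show ?thesis using 5 by (simp add: closed_segment_commute)
    next
      case 6
      have "clear_of (lift (k 2) ` closed_segment (?v 2) (?v 4)) (emb (?v 2) 0) (emb (?v 7) 0) ?c"
      proof (rule corner[where m = 3])
        show "emb (?v 3) 0 \<bullet> emb (?v 7) 0 < cos \<beta>"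
          using c4 cos_minus[of "4 * \<beta>"] by (simp add: ze inner_cpt)
        show "emb (?v 3) 0 \<bullet> ?c < cos \<beta>" using c4 cb wm[of 3] by simp
      qed simp_all
      then show ?thesis unfolding 6 fst_conv by (subst clear_of_commute)
    qed
  qed
  have nd: "det2 (pr (emb (?v 2) 0) - pr (emb (?v 7) 0)) (pr ?c - pr (emb (?v 7) 0)) \<noteq> 0"
  proof -
    have "?v 7 = (1, 0)" using \<beta>(2) by (simp add: cpt_def)
    then have "det2 (pr (emb (?v 2) 0) - pr (emb (?v 7) 0)) (pr ?c - pr (emb (?v 7) 0)) =
       (cos (2 * \<beta>) - 1) * (2 * sin \<beta>) - sin (2 * \<beta>) * (2 * cos \<beta> - 1)"
      by (simp add: det2_def w_def cpt_def)
    also have "\<dots> = - 2 * sin \<beta> * (2 * ((sin \<beta>)\<^sup>2 + (cos \<beta>)\<^sup>2) - cos \<beta>)"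
      unfolding cos_double_sin sin_double by algebra
    also have "\<dots> = - 2 * sin \<beta> * (2 - cos \<beta>)" by simp
    also have "\<dots> \<noteq> 0" using cb by simp
    finally show ?thesis .
  qed
  have "ambient_isotopic (?A \<union> closed_segment (emb (?v 7) 0) (emb (?v 2) 0))
     (?A \<union> (closed_segment (emb (?v 7) 0) ?c \<union> closed_segment ?c (emb (?v 2) 0)))"
    by (rule triangle_move[OF A nd])
  moreover have "star \<beta> k = ?A \<union> closed_segment (emb (?v 7) 0) (emb (?v 2) 0)"
  proof -
    have E: "star_edges = left_edges \<union> {(7, 2)}" by (auto simp: star_edges_def left_edges_def)
    have "star \<beta> k = ?A \<union> book (\<lambda>i. real i * \<beta>) (\<lambda>e. k (fst e)) {(7, 2)}"
      unfolding star_def E book_Un ..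
    moreover have "book (\<lambda>i. real i * \<beta>) (\<lambda>e. k (fst e)) {(7, 2)} = closed_segment (emb (?v 7) 0) (emb (?v 2) 0)"
      by (rule book_flat) (simp add: k)
    ultimately show ?thesis by (simp only:)
  qed
  moreover have "closed_segment (emb (?v 7) 0) ?c \<union> closed_segment ?c (emb (?v 2) 0) = ?z ` C"
    unfolding C_def image_Un zseg[symmetric] v7[symmetric] v2[symmetric] z7 z2 ..
  ultimately show ?thesis by simp
qed


text \<open>Lowering all sheets by \<open>k 7\<close> makes the base flat, as
  \<open>star_lower_chain\<close> wants; raising them again adds the paraboloid term to the heights
  over \<open>C\<close>.\<close>

lemma star_chain:
  fixes k :: "nat \<Rightarrow> real" and \<epsilon> :: real
  assumes k: "\<epsilon> * (k 1 - k 7) > 0" "\<epsilon> * (k 6 - k 7) > 0" and \<epsilon>: "\<epsilon> \<noteq> 0"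
  defines "\<beta> \<equiv> 2 * pi / 7"
  defines "w \<equiv> 2 *\<^sub>R cpt \<beta>" and "l \<equiv> \<lambda>p. cpt \<beta> \<bullet> p - cos \<beta>"
  defines "C \<equiv> closed_segment (cpt (7 * \<beta>)) w \<union> closed_segment w (cpt (2 * \<beta>))"
  shows "ambient_isotopic (star \<beta> k)
    (book (\<lambda>i. real i * \<beta>) (\<lambda>e. k (fst e)) left_edges \<union>
     (\<lambda>p. emb p (- \<epsilon> * l p + k 7 * (1 - (fst p)\<^sup>2 - (snd p)\<^sup>2))) ` C)"
proof -
  define k' where "k' i = k i - k 7" for i
  have 1: "shear (- k 7) ` star \<beta> k = star \<beta> k'"
    unfolding star_def shear_book k'_def by simp
  have 2: "ambient_isotopic (star \<beta> k')
    (book (\<lambda>i. real i * \<beta>) (\<lambda>e. k' (fst e)) left_edges \<union> (\<lambda>p. emb p (- \<epsilon> * l p)) ` C)"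
    unfolding \<beta>_def w_def l_def C_def by (rule star_lower_chain) (use k \<epsilon> in \<open>auto simp: k'_def\<close>)
  have e: "shear (k 7) (emb p z) = emb p (z + k 7 * (1 - (fst p)\<^sup>2 - (snd p)\<^sup>2))" for p z
    by (simp add: shear_def emb_def)
  have 3: "shear (k 7) ` (book (\<lambda>i. real i * \<beta>) (\<lambda>e. k' (fst e)) left_edges \<union> (\<lambda>p. emb p (- \<epsilon> * l p)) ` C)
     = book (\<lambda>i. real i * \<beta>) (\<lambda>e. k (fst e)) left_edges \<union>
     (\<lambda>p. emb p (- \<epsilon> * l p + k 7 * (1 - (fst p)\<^sup>2 - (snd p)\<^sup>2))) ` C"
    unfolding image_Un shear_book image_image e by (simp add: k'_def)
  have "ambient_isotopic (star \<beta> k) (star \<beta> k')"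
    using ambient_isotopic_paraboloid[of "star \<beta> k" "- k 7"] unfolding 1 .
  also note 2
  also note ambient_isotopic_paraboloid[of _ "k 7"]
  finally show ?thesis unfolding 3 .
qed

lemma compact_book: "finite E \<Longrightarrow> compact (book \<theta> h E)"
  unfolding book_def by (intro compact_UN) (auto intro: compact_arc)

text \<open>From \<open>v\<close> the segment runs strictly beyond the tangent plane of the ball at
  \<open>v\<close>, so it leaves the ball at once.\<close>

lemma outer_segment_norm:
  fixes v w :: "'a::real_inner"
  assumes "p \<in> closed_segment v w" "norm v = 1" "w \<bullet> v > 1" "norm p \<le> 1"
  shows "p = v"
proof -
  obtain u where u: "0 \<le> u" "u \<le> 1" "p = (1 - u) *\<^sub>R v + u *\<^sub>R w"
    using assms(1) by (auto simp: closed_segment_def)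
  have "p \<bullet> v \<le> 1" using norm_cauchy_schwarz[of p v] assms by simp
  moreover have "v \<bullet> v = 1" using assms(2) by (simp add: norm_eq_sqrt_inner)
  then have "p \<bullet> v = 1 + u * (w \<bullet> v - 1)" unfolding u(3) by (simp add: inner_add_left algebra_simps)
  ultimately have "u * (w \<bullet> v - 1) \<le> 0" by simp
  then have "u = 0" using assms(3) u(1) by (simp add: mult_le_0_iff)
  then show ?thesis using u by simp
qed

text \<open>With the edge 7 below its two crossing partners (\<open>\<epsilon> = 1\<close>) or above
  them (\<open>\<epsilon> = - 1\<close>), \<open>star_chain\<close> leads to graphs over the same
  planar path \<open>C\<close>. Over the unit disk \<open>C\<close> has only its two ends, so no
  other edge obstructs the change of height from one graph to the other.\<close>

lemma star_swap7:
  fixes k :: "nat \<Rightarrow> real"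
  assumes k: "k 7 < k 1" "k 7 < k 6" "k 1 < x" "k 6 < x"
  defines "\<beta> \<equiv> 2 * pi / 7"
  shows "ambient_isotopic (star \<beta> k) (star \<beta> (k(7 := x)))"
proof -
  define w where "w = 2 *\<^sub>R cpt \<beta>"
  define l where "l p = cpt \<beta> \<bullet> p - cos \<beta>" for p
  define C where "C = closed_segment (cpt (7 * \<beta>)) w \<union> closed_segment w (cpt (2 * \<beta>))"
  let ?A = "book (\<lambda>i. real i * \<beta>) (\<lambda>e. k (fst e)) left_edges"
  let ?k = "k(7 := x)"
  define \<zeta> where "\<zeta> \<epsilon> c p = - \<epsilon> * l p + c * (1 - (fst p)\<^sup>2 - (snd p)\<^sup>2)" for \<epsilon> c p
  have fin: "finite left_edges" by (simp add: left_edges_def)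
  have A: "book (\<lambda>i. real i * \<beta>) (\<lambda>e. ?k (fst e)) left_edges = ?A"
    by (rule book_cong) (auto simp: left_edges_def)
  have "ambient_isotopic (star \<beta> k) (?A \<union> (\<lambda>p. emb p (\<zeta> 1 (k 7) p)) ` C)"
    unfolding \<zeta>_def \<beta>_def w_def l_def C_def by (rule star_chain) (use k in auto)
  also have "ambient_isotopic (?A \<union> (\<lambda>p. emb p (\<zeta> 1 (k 7) p)) ` C) (?A \<union> (\<lambda>p. emb p (\<zeta> (- 1) x p)) ` C)"
  proof (rule ambient_isotopic_graph_change)
    show "compact ?A" by (rule compact_book[OF fin])
    show "compact C" by (auto simp: C_def intro: compact_Un)
    show "continuous_on C (\<zeta> 1 (k 7))" "continuous_on C (\<zeta> (- 1) x)"
      unfolding \<zeta>_def l_def by (intro continuous_intros)+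
    fix p assume p: "p \<in> C" "p \<in> pr ` ?A"
    then obtain a b where "p \<in> closed_segment (cpt a) (cpt b)" unfolding book_def by (auto simp: image_iff)
    then have n: "norm p \<le> 1" by (rule norm_chord_le)
    have \<beta>: "0 < \<beta>" "7 * \<beta> = 2 * pi" by (auto simp: \<beta>_def)
    \<comment> \<open>This gives the product \<open>2 * cos \<beta>\<close> of \<open>w\<close> with
      either end of \<open>C\<close> a value above 1, as \<open>outer_segment_norm\<close>
      requires.\<close>
    have "cos (pi / 3) < cos \<beta>" using \<beta> by (intro cos_less_cos) (auto simp: \<beta>_def)
    then have cb: "cos \<beta> > 1 / 2" by (simp add: cos_60)
    have c6: "cos (\<beta> - 7 * \<beta>) = cos \<beta>" unfolding \<beta>(2) by (simp add: cos_diff)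
    have "p = cpt (7 * \<beta>) \<or> p = cpt (2 * \<beta>)"
      using p(1) n cb c6 outer_segment_norm[of p "cpt (7 * \<beta>)" w] outer_segment_norm[of p "cpt (2 * \<beta>)" w]
      unfolding C_def by (auto simp: w_def inner_cpt closed_segment_commute)
    then have "l p = 0" "norm p = 1" using c6 by (auto simp: l_def inner_cpt)
    then have "\<zeta> \<epsilon> c p = 0" for \<epsilon> c by (simp add: \<zeta>_def norm_prod_eq_1)
    then show "\<zeta> 1 (k 7) p = \<zeta> (- 1) x p" by simp
  qed
  also have "ambient_isotopic (?A \<union> (\<lambda>p. emb p (\<zeta> (- 1) x p)) ` C) (star \<beta> ?k)"
  proof (rule ambient_isotopic_sym)
    have "ambient_isotopic (star \<beta> ?k) (book (\<lambda>i. real i * \<beta>) (\<lambda>e. ?k (fst e)) left_edges \<union>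
       (\<lambda>p. emb p (- (- 1) * l p + ?k 7 * (1 - (fst p)\<^sup>2 - (snd p)\<^sup>2))) ` C)"
      unfolding \<beta>_def w_def l_def C_def by (rule star_chain) (use k in auto)
    then show "ambient_isotopic (star \<beta> ?k) (?A \<union> (\<lambda>p. emb p (\<zeta> (- 1) x p)) ` C)"
      unfolding A \<zeta>_def fun_upd_same .
  qed
  finally show ?thesis .
qed

section \<open>Moving exceptional crossings around the star\<close>

lemma next7_in: "i \<in> {1, 2, 3, 4, 5, 6, 7} \<Longrightarrow> next7 i \<in> {1, 2, 3, 4, 5, 6, 7}"
  by auto

lemma next7_inj: "i \<in> {1, 2, 3, 4, 5, 6, 7} \<Longrightarrow> j \<in> {1, 2, 3, 4, 5, 6, 7} \<Longrightarrow> next7 i = next7 j \<longleftrightarrow> i = j"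
  by auto

text \<open>\<open>star_swap7\<close> is the case \<open>p = 6\<close>; conjugation with
  \<open>star_rotate\<close> passes from \<open>p\<close> to \<open>next7 p\<close>, and six such
  steps reach every edge.\<close>

lemma star_swap:
  assumes "p \<in> {1, 2, 3, 4, 5, 6, 7}" "k (next7 p) < k p" "k (next7 p) < k (next7 (next7 p))"
    "k p < x" "k (next7 (next7 p)) < x"
  shows "ambient_isotopic (star (2 * pi / 7) k) (star (2 * pi / 7) (k(next7 p := x)))"
proof -
  define Q where "Q p \<longleftrightarrow> (\<forall>k. k (next7 p) < k p \<longrightarrow> k (next7 p) < k (next7 (next7 p)) \<longrightarrow>
    k p < x \<longrightarrow> k (next7 (next7 p)) < x \<longrightarrow>
    ambient_isotopic (star (2 * pi / 7) k) (star (2 * pi / 7) (k(next7 p := x))))" for p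
  have 6: "Q 6" unfolding Q_def using star_swap7 by simp
  have step: "Q (next7 p)" if p: "p \<in> {1, 2, 3, 4, 5, 6, 7}" and Q: "Q p" for p
    unfolding Q_def
  proof (intro allI impI)
    fix k assume a: "k (next7 (next7 p)) < k (next7 p)" "k (next7 (next7 p)) < k (next7 (next7 (next7 p)))"
      "k (next7 p) < x" "k (next7 (next7 (next7 p))) < x"
    let ?k = "k \<circ> next7"
    have "ambient_isotopic (star (2 * pi / 7) k) (star (2 * pi / 7) ?k)" by (rule star_rotate)
    also have "ambient_isotopic (star (2 * pi / 7) ?k) (star (2 * pi / 7) (?k(next7 p := x)))"
      using Q a unfolding Q_def by simp
    also have "star (2 * pi / 7) (?k(next7 p := x)) = star (2 * pi / 7) (k(next7 (next7 p) := x) \<circ> next7)"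
      by (rule star_cong) (use next7_inj[OF _ next7_in[OF p]] in simp)
    also have "ambient_isotopic \<dots> (star (2 * pi / 7) (k(next7 (next7 p) := x)))"
      by (rule ambient_isotopic_sym[OF star_rotate])
    finally show "ambient_isotopic (star (2 * pi / 7) k) (star (2 * pi / 7) (k(next7 (next7 p) := x)))" .
  qed
  have 7: "Q 7" using step[OF _ 6] by simp
  have 1: "Q 1" using step[OF _ 7] by simp
  have 2: "Q 2" using step[OF _ 1] by simp
  have 3: "Q 3" using step[OF _ 2] by simp
  have 4: "Q 4" using step[OF _ 3] by simp
  have 5: "Q 5" using step[OF _ 4] by simp
  have "Q p" using assms(1) 1 2 3 4 5 6 7 by auto
  then show ?thesis using assms unfolding Q_def by blast
qed

text \<open>Quantifying over all heights with the given signs leaves a condition on sign sets alone,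
  which can be transported without naming heights.\<close>

definition good_signs :: "R3 set \<Rightarrow> nat set \<Rightarrow> bool" where
  "good_signs T S \<longleftrightarrow> (\<forall>k. crossing_signs k S \<longrightarrow> ambient_isotopic (star (2 * pi / 7) k) T)"

text \<open>Lifting the edge \<open>next7 p\<close> above its neighbours reverses just its own two
  crossings, \<open>p\<close> and \<open>next7 p\<close>; the other five do not involve it.\<close>

lemma crossing_signs_raise:
  assumes "p \<in> {1, 2, 3, 4, 5, 6, 7}" "p \<notin> S" "next7 p \<notin> S"
    "crossing_signs k (insert (next7 p) S)" "k p < x" "k (next7 (next7 p)) < x"
  shows "crossing_signs (k(next7 p := x)) (insert p S)"
  unfolding crossing_signs_def
proof
  fix i :: nat assume i: "i \<in> {1, 2, 3, 4, 5, 6, 7}"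
  have ne: "p \<noteq> next7 p" "next7 (next7 p) \<noteq> next7 p" using assms(1) by auto
  consider "i = p" | "i = next7 p" | "i \<noteq> p" "i \<noteq> next7 p" by blast
  then show "if i \<in> insert p S then (k(next7 p := x)) i < (k(next7 p := x)) (next7 i)
    else (k(next7 p := x)) (next7 i) < (k(next7 p := x)) i"
  proof cases
    case 1
    then show ?thesis using assms(2,3,5,6) ne by simp
  next
    case 2
    then show ?thesis using assms(2,3,5,6) ne by simp
  next
    case 3
    then have "next7 i \<noteq> next7 p" using next7_inj i assms(1) by blast
    then show ?thesis using bspec[OF assms(4)[unfolded crossing_signs_def] i] 3 by (simp split: if_splits)
  qed
qed

lemma crossing_signs_lower:
  assumes "p \<in> {1, 2, 3, 4, 5, 6, 7}" "p \<notin> S" "next7 p \<notin> S"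
    "crossing_signs k (insert p S)" "x < k p" "x < k (next7 (next7 p))"
  shows "crossing_signs (k(next7 p := x)) (insert (next7 p) S)"
  unfolding crossing_signs_def
proof
  fix i :: nat assume i: "i \<in> {1, 2, 3, 4, 5, 6, 7}"
  have ne: "p \<noteq> next7 p" "next7 (next7 p) \<noteq> next7 p" using assms(1) by auto
  consider "i = p" | "i = next7 p" | "i \<noteq> p" "i \<noteq> next7 p" by blast
  then show "if i \<in> insert (next7 p) S then (k(next7 p := x)) i < (k(next7 p := x)) (next7 i)
    else (k(next7 p := x)) (next7 i) < (k(next7 p := x)) i"
  proof cases
    case 1
    then show ?thesis using assms(2,3,5,6) ne by simp
  next
    case 2
    then show ?thesis using assms(2,3,5,6) ne by simp
  next
    case 3
    then have "next7 i \<noteq> next7 p" using next7_inj i assms(1) by blast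
    then show ?thesis using bspec[OF assms(4)[unfolded crossing_signs_def] i] 3 by (simp split: if_splits)
  qed
qed

text \<open>In a star with the exception at \<open>next7 p\<close>, the edge \<open>next7 p\<close>
  lies below both neighbours. Lifting it leads to the exception at \<open>p\<close>, which is
  already known to be good.\<close>

lemma good_signs_move_right:
  assumes p: "p \<in> {1, 2, 3, 4, 5, 6, 7}" "p \<notin> S" "next7 p \<notin> S" and good: "good_signs T (insert p S)"
  shows "good_signs T (insert (next7 p) S)"
  unfolding good_signs_def
proof (intro allI impI)
  fix k assume k: "crossing_signs k (insert (next7 p) S)"
  define x where "x = max (k p) (k (next7 (next7 p))) + 1"
  have x: "k p < x" "k (next7 (next7 p)) < x" by (auto simp: x_def)
  have "next7 p \<in> {1, 2, 3, 4, 5, 6, 7}" "p \<noteq> next7 p" using p(1) by auto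
  then have "k (next7 p) < k p" "k (next7 p) < k (next7 (next7 p))"
    using k p unfolding crossing_signs_def by (metis insert_iff)+
  then have "ambient_isotopic (star (2 * pi / 7) k) (star (2 * pi / 7) (k(next7 p := x)))"
    using star_swap[OF p(1)] x by blast
  also have "ambient_isotopic \<dots> T"
    using good crossing_signs_raise[OF p k x] unfolding good_signs_def by blast
  finally show "ambient_isotopic (star (2 * pi / 7) k) T" .
qed

text \<open>Now the edge \<open>next7 p\<close> lies above both neighbours. Lowering it is
  \<open>star_swap\<close> read backwards, from the lowered heights to the given ones.\<close>

lemma good_signs_move_left:
  assumes p: "p \<in> {1, 2, 3, 4, 5, 6, 7}" "p \<notin> S" "next7 p \<notin> S" and good: "good_signs T (insert (next7 p) S)"
  shows "good_signs T (insert p S)"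
  unfolding good_signs_def
proof (intro allI impI)
  fix k assume k: "crossing_signs k (insert p S)"
  define x where "x = min (k p) (k (next7 (next7 p))) - 1"
  have x: "x < k p" "x < k (next7 (next7 p))" by (auto simp: x_def)
  have m: "next7 p \<in> {1, 2, 3, 4, 5, 6, 7}" "p \<noteq> next7 p" "next7 (next7 p) \<noteq> next7 p" using p(1) by auto
  then have "k p < k (next7 p)" "k (next7 (next7 p)) < k (next7 p)"
    using k p unfolding crossing_signs_def by (metis insert_iff)+
  then have "ambient_isotopic (star (2 * pi / 7) (k(next7 p := x))) (star (2 * pi / 7) (k(next7 p := x, next7 p := k (next7 p))))"
    using m x by (intro star_swap[OF p(1)]) auto
  then have "ambient_isotopic (star (2 * pi / 7) k) (star (2 * pi / 7) (k(next7 p := x)))"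
    unfolding fun_upd_upd fun_upd_triv by (rule ambient_isotopic_sym)
  also have "ambient_isotopic \<dots> T"
    using good crossing_signs_lower[OF p k x] unfolding good_signs_def by blast
  finally show "ambient_isotopic (star (2 * pi / 7) k) T" .
qed

text \<open>The trefoil of K_7 has the pattern \<open>{4, 7}\<close>. The left half of the long
  cycle shows \<open>{5, 7}\<close>, the right half one of the six patterns listed, depending on
  \<open>n\<close>.\<close>

lemma two_negative_crossings:
  assumes "good_signs T {4, 7}"
  shows "good_signs T {5, 7}" "good_signs T {1, 6}" "good_signs T {2, 6}" "good_signs T {3, 6}"
    "good_signs T {4, 6}" "good_signs T {5, 6}"
proof -
  show 57: "good_signs T {5, 7}" using good_signs_move_right[of 4 "{7}" T] assms by simp
  have 37: "good_signs T {3, 7}" using good_signs_move_left[of 3 "{7}" T] assms by simp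
  have 27: "good_signs T {2, 7}" using good_signs_move_left[of 2 "{7}" T] 37 by simp
  have 17: "good_signs T {1, 7}" using good_signs_move_left[of 1 "{7}" T] 27 by simp
  have *: "good_signs T {j, 6}" if "good_signs T {j, 7}" "j \<noteq> 6" "j \<noteq> 7" for j
    using good_signs_move_left[of 6 "{j}" T] that by (simp add: insert_commute)
  show "good_signs T {1, 6}" "good_signs T {2, 6}" "good_signs T {3, 6}" "good_signs T {4, 6}" "good_signs T {5, 6}"
    by (rule *[OF 17] *[OF 27] *[OF 37] *[OF assms] *[OF 57]; simp)+
qed

section \<open>The book representation of the complete graph\<close>

lemma rmod_eq: "x \<ge> 1 \<Longrightarrow> x \<le> 2 * n \<Longrightarrow> rmod n x = (if x \<le> n then x else x - n)"
proof -
  assume x: "x \<ge> 1" "x \<le> 2 * n"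
  have "rmod n x = (x - 1) mod n + 1"
    using x mod_add_self2[of "x - 1" n] by (simp add: rmod_def)
  moreover have "(x - 1) mod n = (if x \<le> n then x - 1 else x - 1 - n)"
    using x by (auto simp: le_mod_geq mod_if)
  ultimately show ?thesis using x by auto
qed

lemma sheet_ofI:
  assumes "in_sheet n s a b" "\<And>s'. in_sheet n s' a b \<Longrightarrow> s' = s"
  shows "sheet_of n a b = s"
  unfolding sheet_of_def by (rule some_equality) (fact assms)+

lemma in_sheet_commute: "in_sheet n s b a = in_sheet n s a b"
  by (simp add: in_sheet_def insert_commute)

lemma sheet_of_commute: "sheet_of n b a = sheet_of n a b"
  by (simp add: sheet_of_def in_sheet_commute)

text \<open>The rounded halves of \<open>n + 1\<close>, \<open>n\<close> and \<open>n - 1\<close>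
  unite both parities in one formula; the additional sheet for odd \<open>n\<close> contributes only
  to the first family of edges.\<close>

lemma in_sheet_alt:
  "in_sheet n s a b \<longleftrightarrow> 1 \<le> s \<and>
     (s \<le> (n + 1) div 2 \<and> (\<exists>j\<in>{1..n div 2}. {a, b} = {s, s + j}) \<or>
      s \<le> n div 2 \<and> (\<exists>j\<in>{1..(n - 1) div 2}. {a, b} = {s + (n + 1) div 2, rmod n (s + (n + 1) div 2 + j)}))"
proof (cases "even n")
  case True
  then have m: "(n + 1) div 2 = n div 2" "(n - 1) div 2 = n div 2 - 1" by (auto elim!: evenE)
  show ?thesis unfolding in_sheet_def Let_def m using True by (simp only: if_True) blast
next
  case False
  then have m: "(n + 1) div 2 = n div 2 + 1" "(n - 1) div 2 = n div 2" by (auto elim!: oddE)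
  show ?thesis
  proof (cases "s = n div 2 + 1")
    case True
    show ?thesis unfolding in_sheet_def Let_def m True using False by simp
  next
    case ne: False
    then have "s \<le> n div 2 + 1 \<longleftrightarrow> s \<le> n div 2" by auto
    then show ?thesis unfolding in_sheet_def Let_def m using False ne by (simp add: add_ac) blast
  qed
qed

text \<open>Since \<open>sheet_of\<close> is a choice, its value is known only once the sheet is
  seen to be unique. The alternatives are an edge starting at \<open>a <= M\<close>, one starting at
  \<open>a > M\<close>, and a long one that starts at \<open>b\<close> and wraps around past
  \<open>n\<close>.\<close>

lemma in_sheet_iff:
  assumes M: "M = (n + 1) div 2" and ab: "1 \<le> a" "a < b" "b \<le> n"
  shows "in_sheet n s a b \<longleftrightarrow> s = a \<and> a \<le> M \<and> b - a \<le> n div 2 \<or>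
    s + M = a \<and> a > M \<or> s + M = b \<and> b > M \<and> b - a > n div 2"
    (is "_ \<longleftrightarrow> ?R")
proof
  have nM: "n div 2 + M = n" by (simp add: M)
  assume "in_sheet n s a b"
  then consider j where "1 \<le> s" "s \<le> M" "j \<in> {1..n div 2}" "{a, b} = {s, s + j}"
    | j where "1 \<le> s" "s \<le> n div 2" "j \<in> {1..(n - 1) div 2}" "{a, b} = {s + M, rmod n (s + M + j)}"
    unfolding in_sheet_alt M[symmetric] by blast
  then show ?R
  proof cases
    case 1
    then show ?thesis using ab by (auto simp: doubleton_eq_iff)
  next
    case j: 2
    have r: "rmod n (s + M + j) = (if s + M + j \<le> n then s + M + j else s + M + j - n)"
      using j nM by (intro rmod_eq) auto
    consider "a = s + M" | "b = s + M" "a = rmod n (s + M + j)" using j by (auto simp: doubleton_eq_iff)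
    then show ?thesis
    proof cases
      case 1
      then show ?thesis using j by simp
    next
      case 2
      with r ab(2) have "\<not> s + M + j \<le> n" "a = s + M + j - n" by (auto split: if_splits)
      moreover have "j \<le> (n - 1) div 2" "1 \<le> s" using j by auto
      ultimately have "b > M" "b - a > n div 2" using 2 ab by arith+
      then show ?thesis using 2 by blast
    qed
  qed
next
  assume ?R
  then consider "s = a" "a \<le> M" "b - a \<le> n div 2" | j where "s + M = a" "a > M" "j = b - a" "rmod n (a + j) = b"
    | j where "s + M = b" "b > M" "b - a > n div 2" "j = n - (b - a)" "rmod n (b + j) = a"
    using ab by (auto simp: rmod_eq)
  then show "in_sheet n s a b"
  proof cases
    case 1
    have "\<exists>j\<in>{1..n div 2}. {a, b} = {s, s + j}" by (rule bexI[of _ "b - a"]) (use 1 ab in auto)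
    then show ?thesis using 1 ab unfolding in_sheet_alt M[symmetric] by blast
  next
    case 2
    have "\<exists>j\<in>{1..(n - 1) div 2}. {a, b} = {s + M, rmod n (s + M + j)}"
      by (rule bexI[of _ j]) (use 2 ab M in auto)
    moreover have "1 \<le> s" "s \<le> n div 2" using 2 ab M by linarith+
    ultimately show ?thesis unfolding in_sheet_alt M[symmetric] by blast
  next
    case 3
    have "\<exists>j\<in>{1..(n - 1) div 2}. {a, b} = {s + M, rmod n (s + M + j)}"
    proof (rule bexI[of _ j])
      have "n \<le> n div 2 + (n - 1) div 2 + 1" by simp
      then show "j \<in> {1..(n - 1) div 2}" unfolding atLeastAtMost_iff 3(4) using 3(3) ab by linarith
    qed (use 3 in \<open>auto simp: insert_commute\<close>)
    moreover have "1 \<le> s" "s \<le> n div 2" using 3 ab M by linarith+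
    ultimately show ?thesis unfolding in_sheet_alt M[symmetric] by blast
  qed
qed

lemma sheet_of_eq:
  assumes "1 \<le> a" "a < b" "b \<le> n"
  shows "sheet_of n a b = (if b - a > n div 2 then b - (n + 1) div 2
     else if a \<le> (n + 1) div 2 then a else a - (n + 1) div 2)"
proof -
  note i = in_sheet_iff[OF refl assms]
  have "(n + 1) div 2 \<le> n div 2 + 1" by simp
  then show ?thesis using assms by (intro sheet_ofI) (auto simp: i split: if_splits)
qed

section \<open>Heights of the edges and the trefoil in K_7\<close>

definition edge_height :: "nat \<Rightarrow> nat \<times> nat \<Rightarrow> real" where
  "edge_height n e = sheet_height n (sheet_of n (fst e) (snd e))"

lemma edge_height_commute: "edge_height n (b, a) = edge_height n (a, b)"
  by (simp add: edge_height_def sheet_of_commute)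

lemma nsheets_eq: "nsheets n = (n + 1) div 2"
  by (auto simp: nsheets_def elim!: evenE oddE)

text \<open>The differences are taken in the reals, so later comparisons of heights are linear and
  free of truncated subtraction.\<close>

lemma edge_height_eq:
  assumes "1 \<le> a" "a < b" "b \<le> n"
  shows "edge_height n (a, b) = real ((n + 1) div 2) + 1 -
    (if b - a > n div 2 then real b - real ((n + 1) div 2)
     else if a \<le> (n + 1) div 2 then real a else real a - real ((n + 1) div 2))"
proof -
  define M where "M = (n + 1) div 2"
  define D where "D = n div 2"
  have M: "M + D = n" "D \<le> M" "M \<le> D + 1" by (auto simp: M_def D_def)
  have s: "sheet_of n a b = (if b - a > D then b - M else if a \<le> M then a else a - M)"
    unfolding M_def D_def by (rule sheet_of_eq[OF assms])
  have "sheet_of n a b \<le> M" unfolding s using M assms by auto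
  then have h: "edge_height n (a, b) = real M + 1 - real (sheet_of n a b)"
    unfolding edge_height_def sheet_height_def nsheets_eq fst_conv snd_conv M_def[symmetric] by (simp add: of_nat_diff)
  have "b - a > D \<Longrightarrow> M \<le> b" using M assms by arith
  then consider "b - a > D" "M \<le> b" | "\<not> b - a > D" "a \<le> M" | "\<not> b - a > D" "\<not> a \<le> M" by blast
  then show ?thesis unfolding h s M_def[symmetric] D_def[symmetric] by cases (simp_all add: of_nat_diff)
qed

lemma cycle_knot_book:
  "cycle_knot n cs = book (\<lambda>i. real i * (2 * pi / real n)) (edge_height n)
     ((\<lambda>k. (cs ! k, cs ! ((k + 1) mod length cs))) ` {..<length cs})"
proof -
  have v: "vert2 n i = cpt (real i * (2 * pi / real n))" for i
    by (simp add: vert2_def cpt_def mult.commute)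
  show ?thesis unfolding cycle_knot_def book_def edge_arc_def v edge_height_def by auto
qed

lemma star_edges_alt: "star_edges = left_edges \<union> {(7, 2)}"
  by (auto simp: star_edges_def left_edges_def)

text \<open>K_7 has four sheets and sheet \<open>s\<close> has height \<open>5 - s\<close>; the
  value at \<open>i\<close> belongs to the star edge leaving \<open>i\<close>.\<close>

definition trefoil_heights :: "nat \<Rightarrow> real" where
  "trefoil_heights i = (if i = 1 then 4 else if i = 2 then 3 else if i = 3 then 2 else if i = 4 then 1
     else if i = 5 then 4 else if i = 6 then 3 else 2)"

lemma trefoil_star: "cycle_knot 7 [1, 3, 5, 7, 2, 4, 6] = star (2 * pi / 7) trefoil_heights"
proof -
  let ?cs = "[1, 3, 5, 7, 2, 4, 6] :: nat list"
  have E: "(\<lambda>k. (?cs ! k, ?cs ! ((k + 1) mod length ?cs))) ` {..<length ?cs} = star_edges"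
  proof -
    have "{..<length ?cs} = {0, 1, 2, 3, 4, 5, 6}" by auto
    then have "(\<lambda>k. (?cs ! k, ?cs ! ((k + 1) mod length ?cs))) ` {..<length ?cs} =
        {(1, 3), (3, 5), (5, 7), (7, 2), (2, 4), (4, 6), (6, 1)}"
      by (simp add: insert_commute)
    then show ?thesis by (auto simp: star_edges_def)
  qed
  have h: "edge_height 7 e = trefoil_heights (fst e)" if "e \<in> star_edges" for e
    using that edge_height_commute[of 7 6 1] edge_height_commute[of 7 7 2] unfolding star_edges_def
    by (elim insertE emptyE) (simp_all add: edge_height_eq trefoil_heights_def)
  show ?thesis unfolding cycle_knot_book E star_def using h by (intro book_cong_angle) simp
qed

lemma trefoil_signs: "good_signs (cycle_knot 7 [1, 3, 5, 7, 2, 4, 6]) {4, 7}"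
proof -
  have "crossing_signs trefoil_heights {4, 7}"
    by (simp add: crossing_signs_def trefoil_heights_def)
  then show ?thesis unfolding good_signs_def trefoil_star
    by (auto intro: star_isotopic)
qed

text \<open>The vertices of one half fill only part of the circle; they are first spread to the
  regular heptagon, for which \<open>good_signs\<close> is formulated.\<close>

lemma star_trefoil:
  assumes "0 < \<delta>" "\<delta> \<le> 2 * pi / 7" "crossing_signs k S" "good_signs T S"
  shows "ambient_isotopic (star \<delta> k) T"
proof -
  have "ambient_isotopic (star \<delta> k) (star (2 * pi / 7) k)"
    using assms by (intro star_isotopic[of _ _ k S]) auto
  then show ?thesis using assms ambient_isotopic_trans unfolding good_signs_def by blast
qed

text \<open>Relabelling by \<open>r\<close> amounts to a rotation by \<open>r\<close> steps. It
  brings the right half, on the vertices 8, ..., 14, to the labels 1, ..., 7.\<close>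

lemma book_shift_star:
  "ambient_isotopic (book (\<lambda>i. real i * \<delta>) h ((\<lambda>(a, b). (a + r, b + r)) ` star_edges))
     (book (\<lambda>i. real i * \<delta>) (\<lambda>(a, b). h (a + r, b + r)) star_edges)"
proof -
  let ?\<theta> = "\<lambda>i. real i * \<delta>"
  have e: "(\<lambda>i. (?\<theta> \<circ> (\<lambda>a. a + r)) i + - (real r * \<delta>)) = ?\<theta>"
    by (simp add: fun_eq_iff algebra_simps)
  show ?thesis
    using book_rotate[of "?\<theta> \<circ> (\<lambda>a. a + r)" "\<lambda>(a, b). h (a + r, b + r)" star_edges "- (real r * \<delta>)"]
    unfolding e book_reindex .
qed

section \<open>The long Hamiltonian cycle\<close>

definition long_cycle_edges :: "nat \<Rightarrow> (nat \<times> nat) set" where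
  "long_cycle_edges n = left_edges \<union> right_edges \<union> {(7, 9)} \<union> (\<lambda>i. (i, Suc i)) ` {14..<n} \<union> {(n, 2)}"

lemma long_cycle_edges:
  fixes n :: nat
  assumes n: "n \<ge> 14"
  defines "cs \<equiv> [1, 3, 5, 7, 9, 11, 13, 8, 10, 12, 14] @ [15..<n + 1] @ [2, 4, 6]"
  shows "(\<lambda>k. (cs ! k, cs ! ((k + 1) mod length cs))) ` {..<length cs} = long_cycle_edges n"
proof -
  note upt_Suc [simp del]
  have len: "length cs = n" using n by (simp add: cs_def)
  have front: "cs ! k = [1, 3, 5, 7, 9, 11, 13, 8, 10, 12, 14] ! k" if "k < 11" for k
    unfolding cs_def nth_append using that by simp
  \<comment> \<open>Position 10 holds the entry 14, and from there to the entry \<open>n\<close> the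
    values increase by one.\<close>
  have mid: "cs ! k = k + 4" if "10 \<le> k" "k \<le> n - 4" for k
  proof (cases "k = 10")
    case True then show ?thesis using front[of 10] by simp
  next
    case False
    then show ?thesis unfolding cs_def nth_append using that n by simp
  qed
  have tail: "cs ! (n - 3 + k) = [2, 4, 6] ! k" if "k < 3" for k
  proof -
    have "length [1, 3, 5, 7, 9, 11, 13, 8, 10, 12, 14 :: nat] = 11" "length [15..<n + 1] = n - 14"
      using n by simp_all
    moreover have "\<not> n - 3 + k < 11" "\<not> n - 3 + k - 11 < n - 14" "n - 3 + k - 11 - (n - 14) = k"
      using that n by arith+
    ultimately show ?thesis unfolding cs_def nth_append by (simp only: if_False)
  qed
  have "{..<n} = {..<10} \<union> {10..<n - 4} \<union> {n - 4} \<union> {n - 3, n - 2, n - 1}"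
    using n by auto
  moreover have "{..<10} = {0, 1, 2, 3, 4, 5, 6, 7, 8, 9 :: nat}" by auto
  ultimately have S: "{..<n} = {0, 1, 2, 3, 4, 5, 6, 7, 8, 9} \<union> {10..<n - 4} \<union> {n - 4} \<union> {n - 3, n - 2, n - 1}"
    by (simp only:)
  have t: "cs ! (n - 3) = 2" "cs ! (n - 2) = 4" "cs ! (n - 1) = 6"
  proof -
    have e: "n - 3 + 1 = n - 2" "n - 3 + 2 = n - 1" using n by simp_all
    show "cs ! (n - 3) = 2" "cs ! (n - 2) = 4" "cs ! (n - 1) = 6"
      using tail[of 0] tail[of 1, unfolded e] tail[of 2, unfolded e] by simp_all
  qed
  have f: "cs ! 0 = 1" "cs ! 1 = 3" "cs ! 2 = 5" "cs ! 3 = 7" "cs ! 4 = 9" "cs ! 5 = 11" "cs ! 6 = 13" "cs ! 7 = 8"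
    "cs ! 8 = 10" "cs ! 9 = 12" "cs ! 10 = 14"
    by (simp_all add: front)
  let ?f = "\<lambda>k. (cs ! k, cs ! ((k + 1) mod n))"
  have 1: "?f ` {0, 1, 2, 3, 4, 5, 6, 7, 8, 9} = right_edges \<union> {(1, 3), (3, 5), (5, 7), (7, 9)}"
    using n by (simp add: f right_edges_def insert_commute del: One_nat_def) 
  have 2: "?f ` {10..<n - 4} = (\<lambda>i. (i, Suc i)) ` {14..<n}"
  proof -
    have "?f k = (k + 4, Suc (k + 4))" if "k \<in> {10..<n - 4}" for k
    proof -
      have "(k + 1) mod n = k + 1" using that by (intro mod_less) auto
      then show ?thesis using that mid[of k] mid[of "k + 1"] by simp
    qed
    then have "?f ` {10..<n - 4} = (\<lambda>i. (i, Suc i)) ` (\<lambda>k. k + 4) ` {10..<n - 4}"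
      unfolding image_image by (rule image_cong[OF refl])
    also have "(\<lambda>k. k + 4) ` {10..<n - 4} = {14..<n}" using n by (simp add: image_add_atLeastLessThan')
    finally show ?thesis .
  qed
  have 3: "?f (n - 4) = (n, 2)"
  proof -
    have "n - 4 + 1 = n - 3" using n by simp
    then show ?thesis using mid[of "n - 4"] t n by simp
  qed
  have 4: "?f (n - 3) = (2, 4)" "?f (n - 2) = (4, 6)" "?f (n - 1) = (6, 1)"
  proof -
    have "n - 3 + 1 = n - 2" "n - 2 + 1 = n - 1" "n - 1 + 1 = n" using n by simp_all
    then show "?f (n - 3) = (2, 4)" "?f (n - 2) = (4, 6)" "?f (n - 1) = (6, 1)" using t f(1) n by simp_all
  qed
  have "?f ` {..<n} = (right_edges \<union> {(1, 3), (3, 5), (5, 7), (7, 9)}) \<union> (\<lambda>i. (i, Suc i)) ` {14..<n} \<union> {(n, 2)} \<union> {(2, 4), (4, 6), (6, 1)}"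
  proof -
    have "?f ` {n - 4} = {(n, 2)}" "?f ` {n - 3, n - 2, n - 1} = {(2, 4), (4, 6), (6, 1)}"
      unfolding image_insert image_empty 3 4 by (rule refl)+
    then show ?thesis unfolding S image_Un 1 2 by (simp only:)
  qed
  then show ?thesis unfolding len by (auto simp: long_cycle_edges_def left_edges_def)
qed


thm_deps ambient_isotopic_lipschitz_family family_bound_disjoint book_isotopic book_remove_chain
  book_cut two_negative_crossings book_shift_star long_cycle_edges

theorem mainTheorem9:
  fixes n :: nat
  assumes "n \<ge> 14"
  shows "isotopic_to_connected_sum
           (cycle_knot n ([1, 3, 5, 7, 9, 11, 13, 8, 10, 12, 14] @ [15..<n + 1] @ [2, 4, 6]))
           (cycle_knot 7 [1, 3, 5, 7, 2, 4, 6])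
           (cycle_knot 7 [1, 3, 5, 7, 2, 4, 6])"
proof -
  let ?T = "cycle_knot 7 [1, 3, 5, 7, 2, 4, 6]"
  define \<delta> where "\<delta> = 2 * pi / real n"
  let ?\<theta> = "\<lambda>i. real i * \<delta>"
  define M where "M = (n + 1) div 2"
  define f where "f = edge_height n"
  \<comment> \<open>No left edge crosses a right edge, so each half may choose its own zero level.
    The right half is measured from {7,9}, which crosses it; the left half keeps its heights, which
    stay above the flattened edge {n,2}.\<close>
  define h where "h e = (if e \<in> left_edges then f e else if e \<in> right_edges then f e - f (7, 9) else 0)" for e
  have M: "M \<ge> 7" "n div 2 \<ge> 7" using assms by (auto simp: M_def)
  have \<delta>: "0 < \<delta>" "\<delta> \<le> 2 * pi / 7" "real n * \<delta> = 2 * pi"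
    using assms by (auto simp: \<delta>_def field_simps)
  \<comment> \<open>Edges spanning at most 5 steps are shorter than \<open>n div 2\<close>, so the
    wrapping case of \<open>edge_height_eq\<close> does not occur.\<close>
  have short: "f (a, b) = real M + 1 - (if a \<le> M then real a else real a - real M)"
    if "1 \<le> a" "a < b" "b \<le> n" "b - a \<le> 5" for a b
    using that M unfolding f_def by (subst edge_height_eq) (auto simp: M_def)
  have comm: "f (b, a) = f (a, b)" for a b unfolding f_def by (rule edge_height_commute)
  have fl: "f (1, 3) = real M" "f (2, 4) = real M - 1" "f (3, 5) = real M - 2" "f (4, 6) = real M - 3"
    "f (5, 7) = real M - 4" "f (6, 1) = real M" "f (7, 9) = real M - 6"
    using M assms by (simp_all add: short comm[of 6 "Suc 0"])
  \<comment> \<open>The height above {7,9} of an edge with smaller end \<open>a\<close> from 8 to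
    12; since {7,9} has height \<open>M - 6\<close>, the two cases are the sheets \<open>a\<close>
    and \<open>a - M\<close>.\<close>
  define g where "g a = (if a \<le> M then 7 - real a else real M + 7 - real a)" for a
  have fr: "f (8, 10) = f (7, 9) + g 8" "f (9, 11) = f (7, 9) + g 9" "f (10, 12) = f (7, 9) + g 10"
    "f (11, 13) = f (7, 9) + g 11" "f (12, 14) = f (7, 9) + g 12" "f (13, 8) = f (7, 9) + g 8"
    using M assms by (simp_all add: short comm[of 13 8] fl(7) g_def)
  \<comment> \<open>The edge {n,2} crosses only the two edges at vertex 1, which have height
    \<open>M\<close>; being lower already, it may be pressed down to 0.\<close>
  have fn2: "f (n, 2) < real M - 1"
  proof -
    have "f (n, 2) = real M + 1 - (real n - real M)"
      unfolding comm[of n 2] unfolding f_def using assms by (subst edge_height_eq) (auto simp: M_def)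
    moreover have "real M + 2 < real n" using assms by (simp add: M_def)
    ultimately show ?thesis by simp
  qed
  have hl: "h (1, 3) = real M" "h (2, 4) = real M - 1" "h (3, 5) = real M - 2" "h (4, 6) = real M - 3"
    "h (5, 7) = real M - 4" "h (6, 1) = real M" "h (7, 9) = 0"
    using fl by (simp_all add: h_def left_edges_def right_edges_def)
  have hr: "h (8, 10) = g 8" "h (9, 11) = g 9" "h (10, 12) = g 10"
    "h (11, 13) = g 11" "h (12, 14) = g 12" "h (13, 8) = g 8"
    using fr by (simp_all add: h_def left_edges_def right_edges_def)
  have h0: "h (7, 2) = 0" "h (14, 9) = 0" "h (n, 2) = 0" "\<And>i. i \<ge> 14 \<Longrightarrow> h (i, j) = 0" for j
    using assms by (auto simp: h_def left_edges_def right_edges_def)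
  have gne: "g 8 \<noteq> 0" "g 9 \<noteq> 0" "g 10 \<noteq> 0" "g 11 \<noteq> 0" "g 12 \<noteq> 0"
    "g 8 \<noteq> g 9" "g 9 \<noteq> g 10" "g 10 \<noteq> g 11" "g 11 \<noteq> g 12" "g 12 \<noteq> g 8"
    using M(1) by (auto simp: g_def split: if_splits)
  have raised: "h e \<noteq> 0" if "e \<in> left_edges \<union> right_edges" for e
  proof -
    have "real M \<noteq> 0" "real M - 1 \<noteq> 0" "real M - 2 \<noteq> 0" "real M - 3 \<noteq> 0" "real M - 4 \<noteq> 0"
      using M(1) by linarith+
    then show ?thesis using that unfolding left_edges_def right_edges_def
      by (elim UnE insertE emptyE) (simp_all only: hl hr gne not_False_eq_True)
  qed
  have ord: "convex_order {1..n} ?\<theta>" using convex_order_regular[of \<delta> n] \<delta> by simp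
  have "cycle_knot n ([1, 3, 5, 7, 9, 11, 13, 8, 10, 12, 14] @ [15..<n + 1] @ [2, 4, 6]) = book ?\<theta> f (long_cycle_edges n)"
    unfolding cycle_knot_book long_cycle_edges[OF assms] \<delta>_def f_def ..
  also have "ambient_isotopic \<dots> (book ?\<theta> h (long_cycle_edges n))"
    unfolding book_def
  proof (rule book_isotopic[OF finite_atLeastAtMost _ ord ord])
    show "long_cycle_edges n \<subseteq> {1..n} \<times> {1..n}"
      using assms by (auto simp: long_cycle_edges_def left_edges_def right_edges_def)
    show "a \<noteq> b" if "(a, b) \<in> long_cycle_edges n" for a b
      using that assms by (auto simp: long_cycle_edges_def left_edges_def right_edges_def)
    define S where "S = left_edges \<union> right_edges \<union> {(7, 9)}"
    fix a b c d assume e: "(a, b) \<in> long_cycle_edges n" "(c, d) \<in> long_cycle_edges n" "(a, b) \<noteq> (c, d)"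
    \<comment> \<open>Equal height order before and after flattening. It is needed only for pairs
      that really cross: those inside each half, {7,9} with the edges at 8, and {n,2} with the edges
      at 1.\<close>
    define cr where "cr x y \<longleftrightarrow> f x < f y \<and> h x < h y \<or> f y < f x \<and> h y < h x" for x y
    have cr_sym: "cr y x" if "cr x y" for x y using that unfolding cr_def by blast
    have crL: "cr (1, 3) (2, 4)" "cr (2, 4) (3, 5)" "cr (3, 5) (4, 6)" "cr (4, 6) (5, 7)" "cr (5, 7) (6, 1)"
      using M unfolding cr_def fl hl by simp_all
    have crR: "cr (8, 10) (9, 11)" "cr (9, 11) (10, 12)" "cr (10, 12) (11, 13)" "cr (11, 13) (12, 14)" "cr (12, 14) (13, 8)"
      "cr (7, 9) (13, 8)" "cr (7, 9) (8, 10)"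
      using gne unfolding cr_def fr hr hl by (auto simp: neq_iff)
    have crN: "cr (1, 3) (n, 2)" "cr (6, 1) (n, 2)"
      using fn2 M unfolding cr_def fl hl h0 by simp_all
    note cr = crL crL[THEN cr_sym] crR crR[THEN cr_sym] crN crN[THEN cr_sym]
    have S14: "1 \<le> i \<and> i < 14 \<and> 1 \<le> j \<and> j \<le> 14 \<and> i \<noteq> j" if "(i, j) \<in> S" for i j
      using that by (auto simp: S_def left_edges_def right_edges_def)
    have split: "(i, j) \<in> S \<or> 14 \<le> i \<and> i < n \<and> j = Suc i \<or> i = n \<and> j = 2" if "(i, j) \<in> long_cycle_edges n" for i j
      using that by (auto simp: long_cycle_edges_def S_def)
    have goal: "b = c \<and> a \<noteq> d \<or> d = a \<and> c \<noteq> b \<or>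
       c \<noteq> a \<and> c \<noteq> b \<and> d \<noteq> a \<and> d \<noteq> b \<and> (separated a b c d \<or> cr (a, b) (c, d))"
    proof -
      have SS: ?thesis if "(a, b) \<in> S" "(c, d) \<in> S"
        using that e(3) unfolding S_def left_edges_def right_edges_def
        by (elim UnE insertE emptyE) (simp_all add: separated_def cr del: One_nat_def)
      have SC: "j = i' \<or> i' \<noteq> i \<and> i' \<noteq> j \<and> Suc i' \<noteq> i \<and> Suc i' \<noteq> j \<and> separated i j i' (Suc i') \<and> separated i' (Suc i') i j"
        if "(i, j) \<in> S" "14 \<le> i'" for i j i'
        using S14[OF that(1)] that(2) by (auto simp: separated_def)
      have SN: "i = 2 \<and> j \<noteq> n \<or> j = n \<and> i \<noteq> 2 \<or> n \<noteq> i \<and> n \<noteq> j \<and> 2 \<noteq> i \<and> 2 \<noteq> j \<and>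
          (separated i j n 2 \<and> separated n 2 i j \<or> cr (i, j) (n, 2))"
        if "(i, j) \<in> S" for i j
        using that assms unfolding S_def left_edges_def right_edges_def
        by (elim UnE insertE emptyE) (auto simp: separated_def cr simp del: One_nat_def)
      from split[OF e(1)] split[OF e(2)] show ?thesis
      proof (elim disjE conjE)
        assume "(a, b) \<in> S" "(c, d) \<in> S"
        then show ?thesis by (rule SS)
      next
        assume "(a, b) \<in> S" "14 \<le> c" "c < n" "d = Suc c"
        then show ?thesis using SC[of a b c] S14[of a b] by auto
      next
        assume "(a, b) \<in> S" "c = n" "d = 2"
        then show ?thesis using SN[of a b] S14[of a b] assms by auto
      next
        assume "14 \<le> a" "a < n" "b = Suc a" "(c, d) \<in> S"
        then show ?thesis using SC[of c d a] S14[of c d] by auto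
      next
        assume "14 \<le> a" "a < n" "b = Suc a" "14 \<le> c" "c < n" "d = Suc c"
        then show ?thesis using e(3) by (auto simp: separated_def)
      next
        assume "14 \<le> a" "a < n" "b = Suc a" "c = n" "d = 2"
        then show ?thesis by (auto simp: separated_def)
      next
        assume "a = n" "b = 2" "(c, d) \<in> S"
        then show ?thesis using SN[of c d] S14[of c d] assms cr_sym by auto
      next
        assume "a = n" "b = 2" "14 \<le> c" "c < n" "d = Suc c"
        then show ?thesis by (auto simp: separated_def)
      next
        assume "a = n" "b = 2" "c = n" "d = 2"
        then show ?thesis using e(3) by simp
      qed
    qed
    then show "b = c \<and> a \<noteq> d \<or> d = a \<and> c \<noteq> b \<or>
       c \<noteq> a \<and> c \<noteq> b \<and> d \<noteq> a \<and> d \<noteq> b \<and>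
         (separated a b c d \<or> f (a, b) < f (c, d) \<and> h (a, b) < h (c, d) \<or>
          f (c, d) < f (a, b) \<and> h (c, d) < h (a, b))"
      unfolding cr_def .
  qed
  also have "ambient_isotopic \<dots> (book ?\<theta> h (left_edges \<union> right_edges \<union> {(7, 9)} \<union> {(14, 2)}))"
    unfolding long_cycle_edges_def
  proof (rule book_remove_chain[OF assms ord])
    show "h e \<noteq> 0" if "e \<in> left_edges \<union> right_edges" for e using that by (rule raised)
    show "h e = 0" if "e \<notin> left_edges \<union> right_edges" for e using that by (simp add: h_def)
  qed
  finally have K: "ambient_isotopic (cycle_knot n ([1, 3, 5, 7, 9, 11, 13, 8, 10, 12, 14] @ [15..<n + 1] @ [2, 4, 6]))
    (book ?\<theta> h (left_edges \<union> right_edges \<union> {(7, 9), (14, 2)}))"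
    unfolding Un_assoc Un_insert_left Un_empty_left .
  show ?thesis
  proof (rule book_cut[OF assms, where h = h], fold \<delta>_def)
    show "h e \<noteq> 0" if "e \<in> left_edges \<union> right_edges" for e using that by (rule raised)
    show "h (7, 9) = 0" "h (14, 2) = 0" "h (7, 2) = 0" "h (14, 9) = 0" using hl h0 by auto
    show "ambient_isotopic (cycle_knot n ([1, 3, 5, 7, 9, 11, 13, 8, 10, 12, 14] @ [15..<n + 1] @ [2, 4, 6]))
      (book ?\<theta> h (left_edges \<union> right_edges \<union> {(7, 9), (14, 2)}))" by (rule K)
    show "ambient_isotopic (book ?\<theta> h (left_edges \<union> {(7, 2)})) ?T"
    proof -
      define k where "k i = (if i = 7 then 0 else if i = 6 then real M else real M + 1 - real i)" for i :: nat
      have "book ?\<theta> h (left_edges \<union> {(7, 2)}) = star \<delta> k"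
        unfolding star_def star_edges_alt using hl h0
        by (intro book_cong) (auto simp: left_edges_def k_def)
      \<comment> \<open>The heights fall from 1 to 5, rise to \<open>M\<close> at 6, drop to 0 at
        the flat closing edge 7 and rise again to \<open>M\<close> at 1.\<close>
      moreover have "crossing_signs k {5, 7}" using M by (simp add: crossing_signs_def k_def)
      ultimately show ?thesis
        using star_trefoil[OF \<delta>(1,2)] two_negative_crossings(1)[OF trefoil_signs] by simp
    qed
    show "ambient_isotopic (book ?\<theta> h (right_edges \<union> {(14, 9)})) ?T"
    proof -
      define k where "k i = (if i = 7 then 0 else if i = 6 then g 8 else g (i + 7))" for i :: nat
      have "right_edges \<union> {(14, 9)} = (\<lambda>(a, b). (a + 7, b + 7)) ` star_edges"
        by (auto simp: right_edges_def star_edges_def)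
      then have "ambient_isotopic (book ?\<theta> h (right_edges \<union> {(14, 9)})) (book ?\<theta> (\<lambda>(a, b). h (a + 7, b + 7)) star_edges)"
        using book_shift_star[of \<delta> h 7] by simp
      also have "book ?\<theta> (\<lambda>(a, b). h (a + 7, b + 7)) star_edges = star \<delta> k"
        unfolding star_def using hr h0 by (intro book_cong) (auto simp: star_edges_def k_def)
      also have "ambient_isotopic (star \<delta> k) ?T"
      proof -
        \<comment> \<open>Along 8, ..., 12 the heights drop by one at each step, except for a jump
          up where the vertex first exceeds \<open>M\<close>. The cases locate this jump; for
          \<open>M = 7\<close> it precedes 8, and for \<open>M >= 12\<close> it comes after
          12.\<close>
        consider "M = 7" | "M = 8" | "M = 9" | "M = 10" | "M = 11" | "M \<ge> 12" using M by linarith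
        then obtain S where S: "crossing_signs k S" "S \<in> {{5, 7}, {1, 6}, {2, 6}, {3, 6}, {4, 6}, {5, 6}}"
        proof cases
          case 1 then show ?thesis by (intro that[of "{5, 7}"]) (simp_all add: crossing_signs_def k_def g_def)
        next
          case 2 then show ?thesis by (intro that[of "{1, 6}"]) (simp_all add: crossing_signs_def k_def g_def)
        next
          case 3 then show ?thesis by (intro that[of "{2, 6}"]) (simp_all add: crossing_signs_def k_def g_def)
        next
          case 4 then show ?thesis by (intro that[of "{3, 6}"]) (simp_all add: crossing_signs_def k_def g_def)
        next
          case 5 then show ?thesis by (intro that[of "{4, 6}"]) (simp_all add: crossing_signs_def k_def g_def)
        next
          case 6 then show ?thesis by (intro that[of "{5, 6}"]) (simp_all add: crossing_signs_def k_def g_def)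
        qed
        have "good_signs ?T S"
          using S(2) by (elim insertE emptyE) (simp_all only: two_negative_crossings[OF trefoil_signs])
        then show ?thesis by (rule star_trefoil[OF \<delta>(1,2) S(1)])
      qed
      finally show ?thesis .
    qed
  qed
qed

end
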